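(* Let $F\in\mathcal I_{\mathrm{Lip}}$. For every $x\in\mathbb R^N$ and $\xi\in\mathbb R^d$ set $$f(x,\xi):=\limsup_{\rho\to0^+}\frac{F(\xi,Q_\rho(x))}{\rho^N},$$ where in $F(\xi,\cdot)$ the vector $\xi$ denotes the constant function with value $\xi$. Then $f\in\mathcal F_{\mathrm{Lip}}$ and $$F(u,D)=\int_Df(x,u(x))\,dx$$ for every $D\in\mathcal O(\mathbb R^N)$ and every $u\in L^p(D;\mathbb R^d)$. If, in addition, $F\in\mathcal I_{\mathrm{Lip}}\cap\mathcal I_{\mathrm{sc}}$, then the function $\xi\mapsto f(x,\xi)$ is $\mathcal A$-quasiconvex for every $x\in\mathbb R^N$; that is, $f\in\mathcal F_{\mathrm{Lip}}\cap\mathcal F_{\mathrm{qc}}$.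
   Context: Fixed throughout: positive integers $N,d,l$ and $p,q\in(1,+\infty)$ with $\frac1p+\frac1q=1$. $\mathcal O(\mathbb R^N)$ is the collection of all bounded open subsets of $\mathbb R^N$; for $D\in\mathcal O(\mathbb R^N)$, $\mathcal O(D)$ is the collection of all open subsets of $D$. $Q_\rho(x)$ is the open cube with center $x$, side length $\rho$ and sides parallel to the coordinate axes. $W^{-1,p}(D;\mathbb R^m)$ is the dual of $W^{1,q}_0(D;\mathbb R^m)$, the latter normed by $\|\nabla u\|_{L^q(D)}$, with the dual norm; $L^p$ functions are viewed as elements of it by integration. Operator: $A^1,\dots,A^N\in\mathbb R^{l\times d}$ are fixed matrices with the constant-rank property: there is $r\in\mathbb N$ with $\operatorname{rank}\big(\sum_{i=1}^N A^iw_i\big)=r$ for all $w\in\mathbb R^N\setminus\{0\}$. For $u\in L^p_{\mathrm{loc}}(\mathbb R^N;\mathbb R^d)$, $\mathcal Au$ is the distribution $\langle\mathcal Au,\psi\rangle=-\sum_i\int_{\mathbb R^N}(A^iu)\cdot\partial_i\psi\,dx$, $\psi\in C_c^\infty(\mathbb R^N;\mathbb R^l)$. For $D\in\mathcal O(\mathbb R^N)$ and $u\in L^p(D;\mathbb R^d)$, $\mathcal A_Du\in W^{-1,p}(D;\mathbb R^l)$ is defined by $\langle\mathcal A_Du,\psi\rangle=-\sum_i\int_D(A^iu)\cdot\partial_i\psi\,dx$, $\psi\in W^{1,q}_0(D;\mathbb R^l)$. Set $\|u\|_D^{\mathcal A}:=\|u\|_{W^{-1,p}(D;\mathbb R^d)}+\|\mathcal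 A_Du\|_{W^{-1,p}(D;\mathbb R^l)}$. $\mathcal A$-quasiconvexity and constants: a locally bounded Borel function $g:\mathbb R^d\to\mathbb R$ is $\mathcal A$-quasiconvex if, for a cube $Q\subset\mathbb R^N$ (the notion does not depend on $Q$), $g(\xi)\le\frac1{|Q|}\int_Qg(\xi+w(x))\,dx$ for every $\xi\in\mathbb R^d$ and every $Q$-periodic $w\in C^\infty(\mathbb R^N;\mathbb R^d)$ with $\mathcal Aw=0$ in $\mathbb R^N$ and $\int_Qw\,dx=0$. The wave cone is $\Lambda:=\bigcup_{w\in\mathbb R^N\setminus\{0\}}\ker\big(\sum_iA^iw_i\big)\subset\mathbb R^d$. Constants $c_0\ge1$ and $c_1\ge\hat c_1\ge1$ are fixed, where $\hat c_1$ is a constant such that, in the case $\operatorname{span}(\Lambda)=\mathbb R^d$, every $\mathcal A$-quasiconvex $g:\mathbb R^d\to[0,+\infty)$ with $\frac1{c_0}|\xi|^p-c_0\le g(\xi)\le c_0(1+|\xi|^p)$ for all $\xi$ satisfies $|g(\xi_1)-g(\xi_2)|\le\hat c_1\big(1+\min\{g(\xi_1),g(\xi_2)\}^{\frac{p-1}p}+|\xi_1-\xi_2|^{p-1}\big)|\xi_1-\xi_2|$ for all $\xi_1,\xi_2$ (such a constant exists in that case). Classes of integrands: $\mathcal F$ is the collection of all Carathéodory functions $f:\mathbb R^N\times\mathbb R^d\to[0,+\infty)$ with $\frac1{c_0}|\xi|^p-c_0\le f(x,\xi)\le c_0(1+|\xi|^p)$ for every $x,\xi$. $\mathcal F_{\mathrm{Lip}}$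 is the set of $f\in\mathcal F$ with $|f(x,\xi_1)-f(x,\xi_2)|\le c_1\big(1+\min\{f(x,\xi_1),f(x,\xi_2)\}^{\frac{p-1}p}+|\xi_1-\xi_2|^{p-1}\big)|\xi_1-\xi_2|$ for every $x,\xi_1,\xi_2$. $\mathcal F_{\mathrm{qc}}$ is the set of $f\in\mathcal F$ such that $f(x,\cdot)$ is $\mathcal A$-quasiconvex for every $x\in\mathbb R^N$. Classes of functionals: $\mathcal I$ is the collection of all functionals $F$ assigning to each pair $(u,D)$, with $D\in\mathcal O(\mathbb R^N)$ and $u\in L^p(D;\mathbb R^d)$, a value $F(u,D)\in[0,+\infty)$ such that for all such $(u,D)$: (a) $\frac1{c_0}\|u\|_{L^p(D)}^p-c_0|D|\le F(u,D)\le c_0(|D|+\|u\|_{L^p(D)}^p)$; (b) the set function $B\mapsto F(u,B):=F(u|_B,B)$ on $\mathcal O(D)$ can be extended to a nonnegative measure on all Borel subsets of $D$. $\mathcal I_{\mathrm{Lip}}$ is the set of $F\in\mathcal I$ such that (c) $|F(u,D)-F(v,D)|\le c_1\big(|D|^{\frac{p-1}p}+\min\{F(u,D),F(v,D)\}^{\frac{p-1}p}+\|u-v\|_{L^p(D)}^{p-1}\big)\|u-v\|_{L^p(D)}$ for all $D\in\mathcal O(\mathbb R^N)$ and $u,v\in L^p(D;\mathbb R^d)$. $\mathcal I_{\mathrm{sc}}$ is the set of $F\in\mathcal I$ such that for every $D\in\mathcal O(\mathbb R^N)$ the functional $u\mapsto F(u,D)$ is lower semicontinuous for the topology induced on $L^p(D;\mathbb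 R^d)$ by $\|\cdot\|_D^{\mathcal A}$. *)

theory Defs
  imports "HOL-Analysis.Analysis"
begin

section \<open>Domains and cubes\<close>

definition bounded_opens :: "(real^'n) set set" where
  "bounded_opens = {D. open D \<and> bounded D}"

definition cube :: "real \<Rightarrow> real^'n \<Rightarrow> (real^'n) set" where
  "cube \<rho> x = {y. \<forall>i. \<bar>y $ i - x $ i\<bar> < \<rho> / 2}"

section \<open>Lebesgue spaces\<close>

text \<open>Elements of $L^p(D)$ are represented by functions on the whole space of which only the
  values on \<open>D\<close>, up to null sets, are relevant.\<close>

definition Lp :: "real \<Rightarrow> (real^'n) set \<Rightarrow> (real^'n \<Rightarrow> 'b::euclidean_space) set" where
  "Lp p D = {u. u \<in> borel_measurable (lebesgue_on D) \<and>
                integrable (lebesgue_on D) (\<lambda>x. norm (u x) powr p)}"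

definition Lp_norm :: "real \<Rightarrow> (real^'n) set \<Rightarrow> (real^'n \<Rightarrow> 'b::euclidean_space) \<Rightarrow> real" where
  "Lp_norm p D u = (LINT x|lebesgue_on D. norm (u x) powr p) powr (1 / p)"

section \<open>Smooth functions, Sobolev spaces and their duals\<close>

primrec Ck :: "nat \<Rightarrow> (real^'n \<Rightarrow> 'b::real_normed_vector) \<Rightarrow> bool" where
  "Ck 0 f \<longleftrightarrow> continuous_on UNIV f"
| "Ck (Suc k) f \<longleftrightarrow> (\<forall>x. f differentiable (at x)) \<and>
      (\<forall>i. Ck k (\<lambda>x. frechet_derivative f (at x) (axis i 1)))"

definition smooth :: "(real^'n \<Rightarrow> 'b::real_normed_vector) \<Rightarrow> bool" where
  "smooth f \<longleftrightarrow> (\<forall>k. Ck k f)"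

definition test_functions :: "(real^'n) set \<Rightarrow> (real^'n \<Rightarrow> real^'m) set" where
  "test_functions D = {\<phi>. smooth \<phi> \<and> (\<exists>K. compact K \<and> K \<subseteq> D \<and> (\<forall>x. x \<notin> K \<longrightarrow> \<phi> x = 0))}"

definition grad :: "(real^'n \<Rightarrow> real^'m) \<Rightarrow> real^'n \<Rightarrow> real^'n^'m" where
  "grad \<phi> x = jacobian \<phi> (at x)"

text \<open>A function \<open>\<psi>\<close> in $W^{1,q}_0(D)$ is represented by the pair \<open>(\<psi>, G)\<close> with its weak
  gradient \<open>G\<close>: the pairs are the limits, in the $W^{1,q}$ norm, of \<open>(\<phi>, grad \<phi>)\<close> for test
  functions \<open>\<phi>\<close>. Such a limit \<open>G\<close> is automatically the weak gradient of \<open>\<psi>\<close> in \<open>D\<close>. The norm of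
  a matrix is the Euclidean (Frobenius) one, and the \<open>i\<close>-th partial derivative is \<open>column i G\<close>.\<close>

definition W1q0 :: "real \<Rightarrow> (real^'n) set \<Rightarrow> ((real^'n \<Rightarrow> real^'m) \<times> (real^'n \<Rightarrow> real^'n^'m)) set" where
  "W1q0 q D = {(\<psi>, G). \<psi> \<in> Lp q D \<and> G \<in> Lp q D \<and>
     (\<exists>\<phi>. (\<forall>k::nat. \<phi> k \<in> test_functions D) \<and>
          (\<lambda>k. Lp_norm q D (\<lambda>x. \<phi> k x - \<psi> x)) \<longlonglongrightarrow> 0 \<and>
          (\<lambda>k. Lp_norm q D (\<lambda>x. grad (\<phi> k) x - G x)) \<longlonglongrightarrow> 0)}"

text \<open>The norm of $W^{-1,p}(D)$, where \<open>q\<close> is the conjugate exponent.\<close>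

definition dual_norm ::
  "real \<Rightarrow> (real^'n) set \<Rightarrow> ((real^'n \<Rightarrow> real^'m) \<times> (real^'n \<Rightarrow> real^'n^'m) \<Rightarrow> real) \<Rightarrow> ennreal" where
  "dual_norm q D T = (SUP (\<psi>, G) \<in> {(\<psi>, G) \<in> W1q0 q D. Lp_norm q D G \<le> 1}. ennreal \<bar>T (\<psi>, G)\<bar>)"

definition Lp_functional ::
  "(real^'n) set \<Rightarrow> (real^'n \<Rightarrow> real^'m) \<Rightarrow> (real^'n \<Rightarrow> real^'m) \<times> (real^'n \<Rightarrow> real^'n^'m) \<Rightarrow> real" where
  "Lp_functional D u = (\<lambda>(\<psi>, G). LINT x|lebesgue_on D. u x \<bullet> \<psi> x)"

section \<open>The operator\<close>

definition symbol :: "('n::finite \<Rightarrow> real^'d^'l) \<Rightarrow> real^'n \<Rightarrow> real^'d^'l" where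
  "symbol A w = (\<Sum>i\<in>UNIV. (w $ i) *\<^sub>R A i)"

definition constant_rank :: "('n::finite \<Rightarrow> real^'d^'l) \<Rightarrow> bool" where
  "constant_rank A \<longleftrightarrow> (\<exists>r. \<forall>w. w \<noteq> 0 \<longrightarrow> rank (symbol A w) = r)"

definition wave_cone :: "('n::finite \<Rightarrow> real^'d^'l) \<Rightarrow> (real^'d) set" where
  "wave_cone A = (\<Union>w\<in>UNIV - {0}. {\<xi>. symbol A w *v \<xi> = 0})"

definition A_distribution ::
  "('n::finite \<Rightarrow> real^'d^'l) \<Rightarrow> (real^'n \<Rightarrow> real^'d) \<Rightarrow> (real^'n \<Rightarrow> real^'l) \<Rightarrow> real" where
  "A_distribution A u \<psi> = - (\<Sum>i\<in>UNIV. LINT x|lebesgue. (A i *v u x) \<bullet> column i (grad \<psi> x))"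

definition A_functional ::
  "('n::finite \<Rightarrow> real^'d^'l) \<Rightarrow> (real^'n) set \<Rightarrow> (real^'n \<Rightarrow> real^'d) \<Rightarrow>
     (real^'n \<Rightarrow> real^'l) \<times> (real^'n \<Rightarrow> real^'n^'l) \<Rightarrow> real" where
  "A_functional A D u = (\<lambda>(\<psi>, G). - (\<Sum>i\<in>UNIV. LINT x|lebesgue_on D. (A i *v u x) \<bullet> column i (G x)))"

definition A_norm ::
  "('n::finite \<Rightarrow> real^'d^'l) \<Rightarrow> real \<Rightarrow> (real^'n) set \<Rightarrow> (real^'n \<Rightarrow> real^'d) \<Rightarrow> ennreal" where
  "A_norm A q D u = dual_norm q D (Lp_functional D u) + dual_norm q D (A_functional A D u)"

section \<open>Quasiconvexity\<close>

text \<open>The notion does not depend on the cube; here the inequality is required on every cube.\<close>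

definition A_quasiconvex :: "('n::finite \<Rightarrow> real^'d^'l) \<Rightarrow> (real^'d \<Rightarrow> real) \<Rightarrow> bool" where
  "A_quasiconvex A g \<longleftrightarrow>
     g \<in> borel_measurable borel \<and> (\<forall>K. compact K \<longrightarrow> bounded (g ` K)) \<and>
     (\<forall>\<rho> z \<xi> w. \<rho> > 0 \<longrightarrow> smooth w \<longrightarrow> (\<forall>x i. w (x + axis i \<rho>) = w x) \<longrightarrow>
        (\<forall>\<psi>\<in>test_functions UNIV. A_distribution A w \<psi> = 0) \<longrightarrow>
        (LINT x|lebesgue_on (cube \<rho> z). w x) = 0 \<longrightarrow>
        g \<xi> \<le> (LINT x|lebesgue_on (cube \<rho> z). g (\<xi> + w x)) / measure lebesgue (cube \<rho> z))"

definition p_growth :: "real \<Rightarrow> real \<Rightarrow> (real^'d \<Rightarrow> real) \<Rightarrow> bool" where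
  "p_growth p c g \<longleftrightarrow>
     (\<forall>\<xi>. norm \<xi> powr p / c - c \<le> g \<xi> \<and> g \<xi> \<le> c * (1 + norm \<xi> powr p))"

definition p_Lipschitz :: "real \<Rightarrow> real \<Rightarrow> (real^'d \<Rightarrow> real) \<Rightarrow> bool" where
  "p_Lipschitz p c g \<longleftrightarrow>
     (\<forall>\<xi>1 \<xi>2. \<bar>g \<xi>1 - g \<xi>2\<bar> \<le>
        c * (1 + min (g \<xi>1) (g \<xi>2) powr ((p - 1) / p) + norm (\<xi>1 - \<xi>2) powr (p - 1)) * norm (\<xi>1 - \<xi>2))"

definition qc_Lipschitz_constant :: "('n::finite \<Rightarrow> real^'d^'l) \<Rightarrow> real \<Rightarrow> real \<Rightarrow> real \<Rightarrow> bool" where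
  "qc_Lipschitz_constant A p c0 c \<longleftrightarrow>
     (span (wave_cone A) = UNIV \<longrightarrow>
        (\<forall>g. A_quasiconvex A g \<longrightarrow> (\<forall>\<xi>. 0 \<le> g \<xi>) \<longrightarrow> p_growth p c0 g \<longrightarrow> p_Lipschitz p c g))"

section \<open>Integrands\<close>

definition Caratheodory :: "(real^'n \<Rightarrow> real^'d \<Rightarrow> real) \<Rightarrow> bool" where
  "Caratheodory f \<longleftrightarrow> (\<forall>\<xi>. (\<lambda>x. f x \<xi>) \<in> borel_measurable lebesgue) \<and> (\<forall>x. continuous_on UNIV (f x))"

definition class_F :: "real \<Rightarrow> real \<Rightarrow> (real^'n \<Rightarrow> real^'d \<Rightarrow> real) set" where
  "class_F p c0 = {f. Caratheodory f \<and> (\<forall>x \<xi>. 0 \<le> f x \<xi>) \<and> (\<forall>x. p_growth p c0 (f x))}"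

definition class_F_Lip :: "real \<Rightarrow> real \<Rightarrow> real \<Rightarrow> (real^'n \<Rightarrow> real^'d \<Rightarrow> real) set" where
  "class_F_Lip p c0 c1 = {f \<in> class_F p c0. \<forall>x. p_Lipschitz p c1 (f x)}"

definition class_F_qc ::
  "('n::finite \<Rightarrow> real^'d^'l) \<Rightarrow> real \<Rightarrow> real \<Rightarrow> (real^'n \<Rightarrow> real^'d \<Rightarrow> real) set" where
  "class_F_qc A p c0 = {f \<in> class_F p c0. \<forall>x. A_quasiconvex A (f x)}"

section \<open>Functionals\<close>

text \<open>\<open>F u D\<close> is only relevant for \<open>D\<close> bounded open and \<open>u \<in> Lp p D\<close>. The second clause of
  \<open>class_I\<close> says that \<open>F u D\<close> depends only on the element of $L^p(D)$ represented by \<open>u\<close>;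
  hence \<open>F u B\<close>, for \<open>B \<subseteq> D\<close> open, is the value of \<open>F\<close> at the restriction of \<open>u\<close> to \<open>B\<close>.\<close>

definition class_I ::
  "real \<Rightarrow> real \<Rightarrow> ((real^'n \<Rightarrow> real^'d) \<Rightarrow> (real^'n) set \<Rightarrow> real) set" where
  "class_I p c0 = {F. \<forall>D\<in>bounded_opens. \<forall>u\<in>Lp p D.
     0 \<le> F u D \<and>
     (\<forall>v\<in>Lp p D. (AE x in lebesgue_on D. u x = v x) \<longrightarrow> F u D = F v D) \<and>
     Lp_norm p D u powr p / c0 - c0 * measure lebesgue D \<le> F u D \<and>
     F u D \<le> c0 * (measure lebesgue D + Lp_norm p D u powr p) \<and>
     (\<exists>\<mu>. sets \<mu> = sets (restrict_space borel D) \<and>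
          (\<forall>B. open B \<and> B \<subseteq> D \<longrightarrow> emeasure \<mu> B = ennreal (F u B)))}"

definition class_I_Lip ::
  "real \<Rightarrow> real \<Rightarrow> real \<Rightarrow> ((real^'n \<Rightarrow> real^'d) \<Rightarrow> (real^'n) set \<Rightarrow> real) set" where
  "class_I_Lip p c0 c1 = {F \<in> class_I p c0. \<forall>D\<in>bounded_opens. \<forall>u\<in>Lp p D. \<forall>v\<in>Lp p D.
     \<bar>F u D - F v D\<bar> \<le>
       c1 * (measure lebesgue D powr ((p - 1) / p) + min (F u D) (F v D) powr ((p - 1) / p)
             + Lp_norm p D (\<lambda>x. u x - v x) powr (p - 1)) * Lp_norm p D (\<lambda>x. u x - v x)}"

definition class_I_sc ::
  "('n::finite \<Rightarrow> real^'d^'l) \<Rightarrow> real \<Rightarrow> real \<Rightarrow> real \<Rightarrow> ((real^'n \<Rightarrow> real^'d) \<Rightarrow> (real^'n) set \<Rightarrow> real) set" where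
  "class_I_sc A p q c0 = {F \<in> class_I p c0. \<forall>D\<in>bounded_opens. \<forall>u\<in>Lp p D. \<forall>\<epsilon>>0. \<exists>\<delta>>0. \<forall>v\<in>Lp p D.
     A_norm A q D (\<lambda>x. v x - u x) < ennreal \<delta> \<longrightarrow> F u D - \<epsilon> < F v D}"

definition upper_cube_density ::
  "((real^'n \<Rightarrow> real^'d) \<Rightarrow> (real^'n) set \<Rightarrow> real) \<Rightarrow> real^'n \<Rightarrow> real^'d \<Rightarrow> ereal" where
  "upper_cube_density F x \<xi> =
     Limsup (at_right 0) (\<lambda>\<rho>. ereal (F (\<lambda>_. \<xi>) (cube \<rho> x) / \<rho> ^ CARD('n)))"

end

theory Submission
  imports Defs
begin

text \<open>
  For fixed \<open>u\<close> the functional extends to a finite Borel measure. By outer regularity the Lipschitz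
  estimate passes from open to Borel sets, so two measures belonging to \<open>u\<close> and \<open>v\<close> agree on Borel
  subsets of \<open>{u = v}\<close>. The measure of a constant function is dominated by a multiple of Lebesgue
  measure, and the limit of its quotients on cubes is its Radon-Nikodym density. Summing over the
  level sets of a simple function gives the integral formula for it, and density of the simple
  functions in $L^p$ together with the Lipschitz estimate gives it for all \<open>u\<close>.

  For quasiconvexity at a given point, let \<open>Q\<close> be a small cube around it and test lower
  semicontinuity on \<open>Q\<close> with \<open>\<xi> + w (n x + s)\<close>. These functions converge to \<open>\<xi>\<close> in the weak norm
  as \<open>n \<rightarrow> \<infinity>\<close>, uniformly in the translation \<open>s\<close>. Averaging the resulting inequality over \<open>s\<close> in
  a period cell turns its right-hand side, by Fubini and periodicity, into the exact average of
  \<open>F (\<xi> + w s) Q\<close> for every \<open>n\<close>; hence no two-scale limit is needed, and the reverse Fatou lemma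
  for \<open>Q\<close> shrinking to the point gives the inequality at every point.
\<close>

section \<open>Cubes and Lebesgue density\<close>

text \<open>Two features of the statement shape the proof. First, the hypotheses on \<open>F\<close>
  give values on open sets only, whereas level sets of simple functions and good sets of the density
  theorem are Borel; each comparison is therefore made on open sets and then transferred by
  regularity. Secondly, quasiconvexity is claimed at every point, although the density is only a
  limsup of cube quotients and need not be regular in \<open>x\<close>. The averaged inequality is
  therefore proved on a whole cube, where the vectors \<open>\<xi> + w s\<close> enter as constant
  functions: no coefficient has to be frozen at a point, and division by the cube volume leaves
  exactly the quotients that define the density. The two sides need different information as the
  cube shrinks: a sequence of side lengths along which the quotients at \<open>\<xi>\<close>
  approach their limsup and, for the other vectors, only that the limsup along this sequence is at
  most the density. A limsup offers both. One \<open>n\<close> serves all shifts because the weak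
  norm bound depends on \<open>w\<close> only through its sup bound and its period cell, not through
  its phase.\<close>

lemma cube_eq_box: "cube \<rho> x = box (\<chi> i. x $ i - \<rho> / 2) (\<chi> i. x $ i + \<rho> / 2)"
  by (simp add: cube_def mem_box_cart set_eq_iff abs_less_iff algebra_simps)
    (smt (verit, best) field_sum_of_halves)

lemma open_cube [simp]: "open (cube \<rho> x)"
  by (simp add: cube_eq_box open_box)

lemma bounded_cube [simp]: "bounded (cube \<rho> x)"
  by (simp add: cube_eq_box bounded_box)

lemma cube_in_bounded_opens [simp]: "cube \<rho> x \<in> bounded_opens"
  by (simp add: bounded_opens_def)

lemma cube_in_sets [measurable, simp]: "cube \<rho> x \<in> sets borel"
  by simp

lemma cube_mono: "\<rho> \<le> \<sigma> \<Longrightarrow> cube \<rho> x \<subseteq> cube \<sigma> x"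
  unfolding cube_def by (intro Collect_mono impI allI) (smt (verit) divide_right_mono)

lemma center_in_cube [simp]: "0 < \<rho> \<Longrightarrow> x \<in> cube \<rho> x"
  by (simp add: cube_def)

lemma measure_lborel_cube:
  assumes "0 \<le> \<rho>"
  shows "measure lborel (cube \<rho> (x :: real^'n)) = \<rho> ^ CARD('n)"
proof -
  have "measure lborel (cube \<rho> x) = prod (\<lambda>i. \<rho>) (UNIV :: 'n set)"
    using assms unfolding cube_eq_box measure_lborel_box_eq measure_lborel_cbox_eq[symmetric]
    by (subst content_cbox_cart) (auto simp: interval_ne_empty_cart algebra_simps)
  then show ?thesis by simp
qed

lemma emeasure_lborel_cube:
  assumes "0 \<le> \<rho>"
  shows "emeasure lborel (cube \<rho> (x :: real^'n)) = ennreal (\<rho> ^ CARD('n))"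
  using emeasure_lborel_box_finite[of "\<chi> i. x $ i - \<rho> / 2" "\<chi> i. x $ i + \<rho> / 2"]
    measure_lborel_cube[OF assms, of x]
  by (simp add: cube_eq_box emeasure_eq_ennreal_measure)

lemma measure_lebesgue_cube:
  assumes "0 \<le> \<rho>"
  shows "measure lebesgue (cube \<rho> (x :: real^'n)) = \<rho> ^ CARD('n)"
  by (simp add: measure_lborel_cube[OF assms])

text \<open>The l1 bound on the norm gives a crude radius; what matters is that it is a fixed
  multiple of the side.\<close>

lemma cube_subset_ball:
  fixes \<rho> :: real
  assumes "0 < \<rho>"
  shows "cube \<rho> (x :: real^'n) \<subseteq> ball x (CARD('n) * \<rho>)"
proof
  fix y assume "y \<in> cube \<rho> x"
  then have y: "\<bar>y $ i - x $ i\<bar> < \<rho> / 2" for i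
    by (simp add: cube_def)
  have "norm (y - x) \<le> (\<Sum>i\<in>UNIV. \<bar>(y - x) $ i\<bar>)"
    by (rule norm_le_l1_cart)
  also have "\<dots> < (\<Sum>i\<in>(UNIV::'n set). \<rho>)"
    using y assms by (intro sum_strict_mono) (auto intro!: less_le_trans[OF y])
  finally show "y \<in> ball x (CARD('n) * \<rho>)"
    by (simp add: dist_norm norm_minus_commute)
qed

lemma eventually_cube_subset:
  assumes "open U" "(x :: real^'n) \<in> U"
  shows "eventually (\<lambda>\<rho>. cube \<rho> x \<subseteq> U) (at_right 0)"
proof -
  obtain e where e: "0 < e" "ball x e \<subseteq> U"
    using assms open_contains_ball by blast
  have "cube \<rho> x \<subseteq> U" if "0 < \<rho>" "\<rho> < e / CARD('n)" for \<rho>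
  proof -
    have "CARD('n) * \<rho> \<le> e"
      using that by (simp add: field_simps)
    then show ?thesis
      using cube_subset_ball[OF that(1), of x] subset_ball[of "CARD('n) * \<rho>" e x] e(2) by blast
  qed
  then show ?thesis
    by (intro eventually_at_rightI[of _ "e / CARD('n)"]) (use e in auto)
qed

text \<open>Around each bad point choose a cube inside a tight open superset of \<open>E\<close> on which the complement
  of \<open>E\<close> is not small; a disjoint subfamily of enclosing balls from Vitali's lemma bounds the outer
  measure of the bad points.\<close>

lemma density_failure_negligible:
  fixes E :: "(real^'n) set"
  assumes E: "E \<in> sets borel" and t: "0 < t"
  shows "negligible {x \<in> E. \<not> eventually (\<lambda>\<rho>. measure lborel (cube \<rho> x - E) \<le> t * \<rho> ^ CARD('n)) (at_right 0)}"
    (is "negligible ?Z")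
  unfolding negligible_outer_le
proof (intro allI impI)
  fix e :: real assume "0 < e"
  \<comment> \<open>A cube of side \<open>r x\<close> lies in the ball of radius
    \<open>R x = CARD('n) * r x\<close>. Vitali's enlargement of this ball by the factor 5 lies in
    the cube of side \<open>10 * R x\<close>, whose volume is \<open>K * r x ^ CARD('n)\<close>. The
    tolerance \<open>e'\<close> is chosen so that \<open>K / t * e' = e\<close>.\<close>
  define K where "K = (10 * real CARD('n)) ^ CARD('n)"
  have "0 < K" by (simp add: K_def)
  define e' where "e' = e * t / K"
  have "0 < e'" using \<open>0 < e\<close> t \<open>0 < K\<close> by (simp add: e'_def)
  obtain U where U: "open U" "E \<subseteq> U" "U - E \<in> lmeasurable" "emeasure lebesgue (U - E) < ennreal e'"
    using sets_lebesgue_outer_open[of E e'] E \<open>0 < e'\<close> by auto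
  have mU: "measure lebesgue (U - E) \<le> e'"
    using U(3,4) \<open>0 < e'\<close> by (simp add: emeasure_eq_measure2 ennreal_less_iff)
  \<comment> \<open>The restriction \<open>\<rho> < 1\<close> keeps the radii \<open>R x\<close>
    bounded, as Vitali's lemma requires.\<close>
  have "\<exists>\<rho>. 0 < \<rho> \<and> \<rho> < 1 \<and> cube \<rho> x \<subseteq> U \<and> t * \<rho> ^ CARD('n) < measure lborel (cube \<rho> x - E)"
    if "x \<in> ?Z" for x
  proof -
    have "frequently (\<lambda>\<rho>. t * \<rho> ^ CARD('n) < measure lborel (cube \<rho> x - E)) (at_right 0)"
      using that by (simp add: frequently_def not_less)
    moreover have "eventually (\<lambda>\<rho>::real. 0 < \<rho> \<and> \<rho> < 1 \<and> cube \<rho> x \<subseteq> U) (at_right 0)"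
    proof (intro eventually_conj eventually_at_right_less)
      show "eventually (\<lambda>\<rho>::real. \<rho> < 1) (at_right 0)"
        by (intro eventually_at_rightI[of 0 1]) auto
      show "eventually (\<lambda>\<rho>. cube \<rho> x \<subseteq> U) (at_right 0)"
        using that U by (intro eventually_cube_subset) auto
    qed
    ultimately have "frequently (\<lambda>\<rho>. t * \<rho> ^ CARD('n) < measure lborel (cube \<rho> x - E) \<and>
        0 < \<rho> \<and> \<rho> < 1 \<and> cube \<rho> x \<subseteq> U) (at_right 0)"
      by (rule frequently_eventually_frequently)
    then show ?thesis
      using frequently_ex by fastforce
  qed
  then have "\<forall>x\<in>?Z. \<exists>\<rho>. 0 < \<rho> \<and> \<rho> < 1 \<and> cube \<rho> x \<subseteq> U \<and> t * \<rho> ^ CARD('n) < measure lborel (cube \<rho> x - E)"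
    by (intro ballI)
  from bchoice[OF this] obtain r where "\<forall>x\<in>?Z. 0 < r x \<and> r x < 1 \<and> cube (r x) x \<subseteq> U \<and>
      t * r x ^ CARD('n) < measure lborel (cube (r x) x - E)"
    by (rule exE)
  then have r: "0 < r x" "r x < 1" "cube (r x) x \<subseteq> U"
      "t * r x ^ CARD('n) < measure lborel (cube (r x) x - E)" if "x \<in> ?Z" for x
    using that by simp_all
  define R where "R x = CARD('n) * r x" for x
  have R: "0 < R x \<and> R x \<le> CARD('n)" if "x \<in> ?Z" for x
    using r[OF that] by (simp add: R_def)
  have "?Z \<subseteq> (\<Union>x\<in>?Z. ball x (R x))"
  proof
    fix x assume "x \<in> ?Z"
    then show "x \<in> (\<Union>x\<in>?Z. ball x (R x))"
      using R[of x] by (intro UN_I[of x]) auto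
  qed
  from Vitali_covering_lemma_balls[OF this R]
  obtain C where C: "countable C" "C \<subseteq> ?Z" "pairwise (\<lambda>i j. disjnt (ball i (R i)) (ball j (R j))) C"
    "?Z \<subseteq> (\<Union>i\<in>C. ball i (5 * R i))" by blast
  let ?T = "\<Union>i\<in>C. ball i (5 * R i)"
  have bound: "measure lebesgue (\<Union>i\<in>I. ball i (5 * R i)) \<le> e" if I: "I \<subseteq> C" "finite I" for I
  proof -
    have IZ: "i \<in> ?Z" if "i \<in> I" for i using that I C(2) by blast
    have *: "measure lebesgue (ball i (5 * R i)) \<le> K / t * measure lebesgue (cube (r i) i - E)" if "i \<in> I" for i
    proof -
      have "ball i (5 * R i) \<subseteq> cube (10 * R i) i"
      proof
        fix y assume "y \<in> ball i (5 * R i)"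
        then have "norm (y - i) < 5 * R i" by (simp add: dist_norm norm_minus_commute)
        then show "y \<in> cube (10 * R i) i"
          unfolding cube_def using component_le_norm_cart[of "y - i"] by (auto intro: le_less_trans)
      qed
      then have "measure lebesgue (ball i (5 * R i)) \<le> measure lebesgue (cube (10 * R i) i)"
        by (intro measure_mono_fmeasurable) (auto simp: lmeasurable_open)
      also have "\<dots> = K * r i ^ CARD('n)"
        using R[OF IZ[OF that]] by (subst measure_lebesgue_cube) (auto simp: K_def R_def power_mult_distrib)
      also have "\<dots> \<le> K * (measure lebesgue (cube (r i) i - E) / t)"
        using r(4)[OF IZ[OF that]] t \<open>0 < K\<close> E by (intro mult_left_mono) (auto simp: field_simps)
      finally show ?thesis by simp
    qed
    have cE: "cube (r i) i - E \<in> lmeasurable" for i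
      using E by (intro fmeasurable_Diff) (auto simp: lmeasurable_open)
    have "measure lebesgue (\<Union>i\<in>I. ball i (5 * R i)) \<le> (\<Sum>i\<in>I. measure lebesgue (ball i (5 * R i)))"
      using I by (intro measure_UNION_le) auto
    also have "\<dots> \<le> (\<Sum>i\<in>I. K / t * measure lebesgue (cube (r i) i - E))"
      by (intro sum_mono *)
    also have "\<dots> = K / t * measure lebesgue (\<Union>i\<in>I. cube (r i) i - E)"
    proof -
      have "pairwise (\<lambda>i j. disjnt (cube (r i) i - E) (cube (r j) j - E)) I"
      proof (rule pairwiseI)
        fix i j assume ij: "i \<in> I" "j \<in> I" "i \<noteq> j"
        then have "disjnt (ball i (R i)) (ball j (R j))"
          using C(3) I(1) unfolding pairwise_def by blast
        then show "disjnt (cube (r i) i - E) (cube (r j) j - E)"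
          using cube_subset_ball[of "r i" i] cube_subset_ball[of "r j" j] r(1)[OF IZ] ij
          unfolding R_def disjnt_def by blast
      qed
      then show ?thesis
        using I cE by (subst measure_UNION') (auto simp: sum_distrib_left)
    qed
    also have "\<dots> \<le> K / t * measure lebesgue (U - E)"
      using t \<open>0 < K\<close> U r(3)[OF IZ] I(2) fmeasurableD[OF cE]
      by (intro mult_left_mono measure_mono_fmeasurable sets.finite_UN) auto
    also have "\<dots> \<le> K / t * e'"
      using mU t \<open>0 < K\<close> by (intro mult_left_mono) auto
    also have "\<dots> = e" using t \<open>0 < K\<close> by (simp add: e'_def)
    finally show ?thesis .
  qed
  have "?T \<in> lmeasurable" "measure lebesgue ?T \<le> e"
    using fmeasurable_UN_bound[OF C(1) _ bound] measure_UN_bound[OF C(1) _ bound] by auto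
  then show "\<exists>T. ?Z \<subseteq> T \<and> T \<in> lmeasurable \<and> measure lebesgue T \<le> e"
    using C(4) by blast
qed

text \<open>Lebesgue's density theorem for cubes: the thresholds \<open>1 / Suc k\<close> reduce
  convergence to countably many negligible sets.\<close>

lemma AE_cube_density:
  fixes E :: "(real^'n) set"
  assumes E: "E \<in> sets borel"
  shows "AE x in lborel. x \<in> E \<longrightarrow>
    ((\<lambda>\<rho>. measure lborel (cube \<rho> x - E) / \<rho> ^ CARD('n)) \<longlongrightarrow> 0) (at_right 0)"
proof -
  let ?Z = "\<lambda>k::nat. {x \<in> E. \<not> eventually (\<lambda>\<rho>. measure lborel (cube \<rho> x - E) \<le> 1 / real (Suc k) * \<rho> ^ CARD('n)) (at_right 0)}"
  have "AE x in lebesgue. \<forall>k. x \<notin> ?Z k"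
    unfolding AE_all_countable
  proof
    fix k
    have "negligible (?Z k)"
      by (intro density_failure_negligible[OF E]) simp
    then show "AE x in lebesgue. x \<notin> ?Z k"
      unfolding eventually_ae_filter_negligible by (intro exI[of _ "?Z k"]) auto
  qed
  then have "AE x in lborel. \<forall>k. x \<notin> ?Z k"
    by (simp only: AE_completion_iff)
  then show ?thesis
  proof (rule AE_mp, intro AE_I2 impI)
    fix x assume x: "\<forall>k. x \<notin> ?Z k" "x \<in> E"
    show "((\<lambda>\<rho>. measure lborel (cube \<rho> x - E) / \<rho> ^ CARD('n)) \<longlongrightarrow> 0) (at_right 0)"
    proof (rule tendstoI)
      fix e :: real assume "0 < e"
      then obtain k where k: "1 / real (Suc k) < e"
        using nat_approx_posE by blast
      have "eventually (\<lambda>\<rho>. measure lborel (cube \<rho> x - E) \<le> 1 / real (Suc k) * \<rho> ^ CARD('n)) (at_right 0)"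
        using x by blast
      then show "\<forall>\<^sub>F \<rho> in at_right 0. dist (measure lborel (cube \<rho> x - E) / \<rho> ^ CARD('n)) 0 < e"
        using eventually_at_right_less[of "0::real"]
      proof eventually_elim
        case (elim \<rho>)
        then have "measure lborel (cube \<rho> x - E) / \<rho> ^ CARD('n) \<le> 1 / real (Suc k)"
          by (simp add: divide_le_eq del: of_nat_Suc)
        then show ?case
          using k elim by (simp add: dist_real_def abs_of_nonneg)
      qed
    qed
  qed
qed

section \<open>Extension to Borel measures\<close>

lemma integral_lebesgue_on_borel:
  fixes g :: "real^'n \<Rightarrow> real"
  assumes "D \<in> sets borel" "g \<in> borel_measurable borel"
  shows "(LINT x|lebesgue_on D. g x) = (LINT x|lborel. indicator D x * g x)"
  using assms by (simp add: integral_restrict_space integral_completion)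

lemma nn_integral_lebesgue_on_borel:
  fixes g :: "real^'n \<Rightarrow> ennreal"
  assumes "D \<in> sets borel" "g \<in> borel_measurable borel"
  shows "(\<integral>\<^sup>+x. g x \<partial>lebesgue_on D) = (\<integral>\<^sup>+x\<in>D. g x \<partial>lborel)"
  using assms by (simp add: nn_integral_restrict_space nn_integral_completion)

lemma borel_measurable_lebesgue_on:
  "u \<in> borel_measurable borel \<Longrightarrow> u \<in> borel_measurable (lebesgue_on D)"
  by (intro measurable_restrict_space1 measurable_completion) simp

lemma bounded_opensD: "D \<in> bounded_opens \<Longrightarrow> open D" "D \<in> bounded_opens \<Longrightarrow> D \<in> sets borel"
  "D \<in> bounded_opens \<Longrightarrow> D \<in> lmeasurable"
  "D \<in> bounded_opens \<Longrightarrow> emeasure lborel D < \<infinity>"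
  using emeasure_bounded_finite[of D] by (auto simp: bounded_opens_def lmeasurable_open)

lemma bounded_opens_subset: "D \<in> bounded_opens \<Longrightarrow> open B \<Longrightarrow> B \<subseteq> D \<Longrightarrow> B \<in> bounded_opens"
  by (auto simp: bounded_opens_def intro: bounded_subset)

section \<open>Membership in Lp and norms on bounded open sets\<close>

lemma Lp_bounded:
  fixes u :: "real^'n \<Rightarrow> 'b::euclidean_space"
  assumes "D \<in> bounded_opens" "u \<in> borel_measurable borel" "\<And>x. norm (u x) \<le> B" "0 \<le> p"
  shows "u \<in> Lp p D"
proof -
  interpret finite_measure "lebesgue_on D"
    using assms(1) by (intro finite_measure_lebesgue_on bounded_opensD)
  have "integrable (lebesgue_on D) (\<lambda>x. norm (u x) powr p)"
    using assms borel_measurable_lebesgue_on[of "\<lambda>x. norm (u x) powr p" D]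
    by (intro integrable_const_bound[of _ "B powr p"]) (auto intro!: powr_mono2)
  then show ?thesis
    unfolding Lp_def using borel_measurable_lebesgue_on[OF assms(2)] by blast
qed

lemma Lp_const [simp]: "D \<in> bounded_opens \<Longrightarrow> 0 \<le> p \<Longrightarrow> (\<lambda>_. \<xi>) \<in> Lp p D"
  by (rule Lp_bounded[where B = "norm \<xi>"]) auto

lemma Lp_subset:
  assumes "u \<in> Lp p D" "B \<subseteq> D" "B \<in> sets borel" "D \<in> sets borel"
  shows "u \<in> Lp p B"
proof -
  have "u \<in> borel_measurable (lebesgue_on B)"
    using assms by (intro measurable_restrict_mono[of u "lebesgue" D borel B]) (auto simp: Lp_def)
  moreover have "integrable (lebesgue_on B) (\<lambda>x. norm (u x) powr p)"
    using assms integrable_mult_indicator[of B lebesgue "\<lambda>x. indicator D x *\<^sub>R norm (u x) powr p"]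
    by (simp add: Lp_def integrable_restrict_space Int_absorb2 flip: mult.assoc indicator_inter_arith)
  ultimately show ?thesis by (simp add: Lp_def)
qed

lemma Lp_norm_nonneg [simp]: "0 \<le> Lp_norm p D u"
  by (simp add: Lp_norm_def)

lemma Lp_norm_powr:
  assumes "0 < p"
  shows "Lp_norm p D u powr p = (LINT x|lebesgue_on D. norm (u x) powr p)"
proof -
  have "0 \<le> (LINT x|lebesgue_on D. norm (u x) powr p)"
    by (intro Bochner_Integration.integral_nonneg) simp
  then show ?thesis
    using assms unfolding Lp_norm_def powr_powr by simp
qed

lemma Lp_norm_const:
  assumes "D \<in> bounded_opens" "0 < p"
  shows "Lp_norm p D (\<lambda>_. \<xi>) = norm \<xi> * measure lebesgue D powr (1 / p)"
proof -
  have "D \<in> sets lebesgue"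
    using bounded_opensD(3)[OF assms(1)] by (rule fmeasurableD)
  then have "(LINT x|lebesgue_on D. norm \<xi> powr p) = measure lebesgue D * norm \<xi> powr p"
    by (subst lebesgue_integral_const) (simp add: measure_restrict_space space_restrict_space)
  then show ?thesis
    using assms(2) unfolding Lp_norm_def by (simp add: powr_mult powr_powr mult.commute del: lebesgue_integral_const)
qed

text \<open>The Lipschitz estimate compares \<open>F u\<close>, \<open>F v\<close> and the
  \<open>Lp\<close> distance on one and the same open set, so a single \<open>U\<close> has to be
  tight for several measures at once. Intersecting finitely many tight sets with \<open>D\<close>
  achieves this because each measure is monotone.\<close>

lemma outer_regular_common:
  fixes \<M> :: "'a::{second_countable_topology, complete_space} measure set"
  assumes "finite \<M>" and \<M>: "\<And>M. M \<in> \<M> \<Longrightarrow> sets M = sets borel" "\<And>M. M \<in> \<M> \<Longrightarrow> finite_measure M"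
    and E: "E \<in> sets borel" "E \<subseteq> D" "open D" and e: "0 < e"
  obtains U where "open U" "E \<subseteq> U" "U \<subseteq> D" "\<And>M. M \<in> \<M> \<Longrightarrow> measure M U \<le> measure M E + e"
proof -
  have "\<exists>U. open U \<and> E \<subseteq> U \<and> measure M U \<le> measure M E + e" if M: "M \<in> \<M>" for M
  proof -
    interpret finite_measure M by (rule \<M>(2)[OF M])
    have "(INF U\<in>{U. E \<subseteq> U \<and> open U}. emeasure M U) < emeasure M E + ennreal e"
      using outer_regular[of M E] \<M>(1)[OF M] E e emeasure_finite
      by (auto simp: ennreal_less_top ennreal_add_left_cancel_less emeasure_eq_measure simp flip: ennreal_plus)
    then obtain U where "E \<subseteq> U" "open U" "emeasure M U < emeasure M E + ennreal e"
      unfolding INF_less_iff by blast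
    then show ?thesis
      using e by (intro exI[of _ U]) (auto simp: emeasure_eq_measure ennreal_less_iff simp flip: ennreal_plus)
  qed
  then obtain U where U: "open (U M)" "E \<subseteq> U M" "measure M (U M) \<le> measure M E + e" if "M \<in> \<M>" for M
    by metis
  show thesis
  proof
    show "open ((\<Inter>M\<in>\<M>. U M) \<inter> D)"
      using U assms by (intro open_Int open_INT) auto
    show "E \<subseteq> (\<Inter>M\<in>\<M>. U M) \<inter> D" "(\<Inter>M\<in>\<M>. U M) \<inter> D \<subseteq> D"
      using U(2) E by auto
    fix M assume M: "M \<in> \<M>"
    interpret finite_measure M by (rule \<M>(2)[OF M])
    have "measure M ((\<Inter>M\<in>\<M>. U M) \<inter> D) \<le> measure M (U M)"
      using M U(1)[OF M] by (intro finite_measure_mono) (auto simp: \<M>(1)[OF M])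
    then show "measure M ((\<Inter>M\<in>\<M>. U M) \<inter> D) \<le> measure M E + e"
      using U(3)[OF M] by simp
  qed
qed

locale Lip_functional =
  fixes p c0 c1 :: real
    and F :: "(real^'n \<Rightarrow> real^'d) \<Rightarrow> (real^'n) set \<Rightarrow> real"
  assumes p: "1 < p" and c0: "1 \<le> c0" and c1: "1 \<le> c1"
    and F_Lip: "F \<in> class_I_Lip p c0 c1"
begin

lemma F_class_I: "F \<in> class_I p c0"
  using F_Lip by (simp add: class_I_Lip_def)

lemmas F_props = F_class_I[unfolded class_I_def mem_Collect_eq, THEN bspec, THEN bspec]

lemma F_nonneg: "D \<in> bounded_opens \<Longrightarrow> u \<in> Lp p D \<Longrightarrow> 0 \<le> F u D"
  and F_lower: "D \<in> bounded_opens \<Longrightarrow> u \<in> Lp p D \<Longrightarrow> Lp_norm p D u powr p / c0 - c0 * measure lebesgue D \<le> F u D"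
  and F_upper: "D \<in> bounded_opens \<Longrightarrow> u \<in> Lp p D \<Longrightarrow> F u D \<le> c0 * (measure lebesgue D + Lp_norm p D u powr p)"
  by (simp_all only: F_props)

lemma F_cong_AE:
  "D \<in> bounded_opens \<Longrightarrow> u \<in> Lp p D \<Longrightarrow> v \<in> Lp p D \<Longrightarrow> AE x in lebesgue_on D. u x = v x \<Longrightarrow> F u D = F v D"
  using F_props[THEN conjunct2, THEN conjunct1, THEN bspec, THEN mp] .

lemma F_measure:
  "D \<in> bounded_opens \<Longrightarrow> u \<in> Lp p D \<Longrightarrow> \<exists>\<mu>. sets \<mu> = sets (restrict_space borel D) \<and>
     (\<forall>B. open B \<and> B \<subseteq> D \<longrightarrow> emeasure \<mu> B = ennreal (F u B))"
  by (simp only: F_props)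

lemma F_Lipschitz: "D \<in> bounded_opens \<Longrightarrow> u \<in> Lp p D \<Longrightarrow> v \<in> Lp p D \<Longrightarrow>
   \<bar>F u D - F v D\<bar> \<le>
       c1 * (measure lebesgue D powr ((p - 1) / p) + min (F u D) (F v D) powr ((p - 1) / p)
             + Lp_norm p D (\<lambda>x. u x - v x) powr (p - 1)) * Lp_norm p D (\<lambda>x. u x - v x)"
  using F_Lip[unfolded class_I_Lip_def mem_Collect_eq, THEN conjunct2, THEN bspec, THEN bspec, THEN bspec] .

text \<open>Encoded on all Borel sets of the space, with the complement of \<open>D\<close> null,
  rather than on the trace of \<open>D\<close>: the measures for different \<open>u\<close> and the
  measures with a Lebesgue density then share one sigma-algebra, and outer regularity in the whole
  space applies.\<close>

definition is_ext :: "(real^'n \<Rightarrow> real^'d) \<Rightarrow> (real^'n) set \<Rightarrow> (real^'n) measure \<Rightarrow> bool" where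
  "is_ext u D N \<longleftrightarrow> sets N = sets borel \<and> finite_measure N \<and> emeasure N (- D) = 0 \<and>
     (\<forall>B. open B \<and> B \<subseteq> D \<longrightarrow> measure N B = F u B)"

lemma ex_ext:
  assumes D: "D \<in> bounded_opens" and u: "u \<in> Lp p D"
  shows "\<exists>N. is_ext u D N"
proof -
  obtain \<mu> where \<mu>: "sets \<mu> = sets (restrict_space borel D)"
    "\<And>B. open B \<Longrightarrow> B \<subseteq> D \<Longrightarrow> emeasure \<mu> B = ennreal (F u B)"
    using F_measure[OF D u] by blast
  have space: "space \<mu> = D"
    using sets_eq_imp_space_eq[OF \<mu>(1)] by (simp add: space_restrict_space)
  have id: "(\<lambda>x. x) \<in> measurable \<mu> borel"
    using measurable_restrict_space1[OF measurable_ident] by (simp add: measurable_cong_sets[OF \<mu>(1) refl] id_def)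
  \<comment> \<open>The push-forward under the inclusion of \<open>D\<close>: it vanishes outside
    \<open>D\<close> by construction, and it is finite because the open set \<open>D\<close> itself
    has the value \<open>F u D\<close>.\<close>
  define N where "N = distr \<mu> borel (\<lambda>x. x)"
  have N: "emeasure N E = emeasure \<mu> (E \<inter> D)" if "E \<in> sets borel" for E
    using that id by (simp add: N_def emeasure_distr space)
  have open_N: "emeasure N B = ennreal (F u B)" if "open B" "B \<subseteq> D" for B
    using that N[of B] \<mu>(2) by (simp add: Int_absorb2)
  have "emeasure N (space N) = ennreal (F u D)"
    using N[of UNIV] \<mu>(2)[of D] bounded_opensD(1)[OF D] by (simp add: N_def)
  then have fin: "finite_measure N"
    by (intro finite_measureI) simp
  have "measure N B = F u B" if "open B" "B \<subseteq> D" for B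
    using open_N[OF that] F_nonneg[OF bounded_opens_subset[OF D that] Lp_subset[OF u that(2)]] that bounded_opensD[OF D]
    by (simp add: measure_def)
  moreover have "emeasure N (- D) = 0"
    using N[of "- D"] bounded_opensD[OF D] by simp
  ultimately show ?thesis
    using fin by (intro exI[of _ N]) (simp add: is_ext_def N_def)
qed

text \<open>Arbitrary unless \<open>D\<close> is bounded open and \<open>u \<in> Lp p D\<close>.\<close>

definition ext :: "(real^'n \<Rightarrow> real^'d) \<Rightarrow> (real^'n) set \<Rightarrow> (real^'n) measure" where
  "ext u D = (SOME N. is_ext u D N)"

lemma
  assumes "D \<in> bounded_opens" "u \<in> Lp p D"
  shows sets_ext: "sets (ext u D) = sets borel"
    and finite_ext: "finite_measure (ext u D)"
    and ext_outside: "emeasure (ext u D) (- D) = 0"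
    and ext_open: "open B \<Longrightarrow> B \<subseteq> D \<Longrightarrow> measure (ext u D) B = F u B"
proof -
  have "is_ext u D (ext u D)"
    unfolding ext_def by (rule someI_ex[OF ex_ext[OF assms]])
  then show "sets (ext u D) = sets borel" "finite_measure (ext u D)" "emeasure (ext u D) (- D) = 0"
    "open B \<Longrightarrow> B \<subseteq> D \<Longrightarrow> measure (ext u D) B = F u B"
    by (simp_all only: is_ext_def)
qed

text \<open>Both values are taken by the single measure \<open>ext u D\<close>.\<close>

lemma F_mono:
  assumes "D \<in> bounded_opens" "u \<in> Lp p D" "open B" "B \<subseteq> D"
  shows "F u B \<le> F u D"
proof -
  interpret finite_measure "ext u D" by (rule finite_ext[OF assms(1,2)])
  have "measure (ext u D) B \<le> measure (ext u D) D"
    using assms bounded_opensD[OF assms(1)] by (intro finite_measure_mono) (auto simp: sets_ext)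
  then show ?thesis
    using assms bounded_opensD[OF assms(1)] by (simp add: ext_open)
qed

text \<open>The \<open>Lp\<close> distance of \<open>u\<close> and \<open>v\<close> is governed by a
  measure too: let \<open>m\<close> have the density \<open>norm (u x - v x) powr p\<close> on
  \<open>D\<close>. Since \<open>m\<close> vanishes on \<open>E\<close>, an open \<open>U\<close>
  that is tight for \<open>m\<close> and for both extensions makes the distance on \<open>U\<close>
  arbitrarily small. Boundedness of \<open>u\<close> and \<open>v\<close> makes \<open>m\<close>
  finite, hence outer regular.\<close>

lemma ext_eq_on:
  assumes D: "D \<in> bounded_opens"
    and u: "u \<in> borel_measurable borel" "\<And>x. norm (u x) \<le> B1"
    and v: "v \<in> borel_measurable borel" "\<And>x. norm (v x) \<le> B2"
    and E: "E \<in> sets borel" "E \<subseteq> D" and eq: "\<And>x. x \<in> E \<Longrightarrow> u x = v x"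
  shows "measure (ext u D) E = measure (ext v D) E"
proof -
  have uL: "u \<in> Lp p D" and vL: "v \<in> Lp p D"
    using p by (auto intro: Lp_bounded[OF D u] Lp_bounded[OF D v])
  define w where "w x = norm (u x - v x) powr p" for x
  have w [measurable]: "w \<in> borel_measurable borel"
    using u(1) v(1) unfolding w_def by measurable
  have w0: "0 \<le> w x" for x by (simp add: w_def)
  have w_le: "w x \<le> (B1 + B2) powr p" for x
    unfolding w_def using p norm_triangle_ineq4[of "u x" "v x"] u(2)[of x] v(2)[of x]
    by (intro powr_mono2) auto
  define m where "m = density lborel (\<lambda>x. ennreal (indicator D x * w x))"
  have Dm [measurable]: "D \<in> sets borel" by (rule bounded_opensD[OF D])
  have m: "emeasure m U = (\<integral>\<^sup>+x\<in>U. ennreal (indicator D x * w x) \<partial>lborel)" if "U \<in> sets borel" for U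
    using that unfolding m_def by (subst emeasure_density) auto
  have "emeasure m (space m) \<le> (\<integral>\<^sup>+x\<in>D. ennreal ((B1 + B2) powr p) \<partial>lborel)"
    using m[of UNIV] w_le by (auto simp: m_def intro!: nn_integral_mono ennreal_leI split: split_indicator)
  also have "\<dots> < \<infinity>"
    using bounded_opensD(4)[OF D] by (simp add: nn_integral_cmult_indicator ennreal_mult_less_top)
  finally interpret m: finite_measure m
    by (intro finite_measureI) auto
  interpret Nu: finite_measure "ext u D" by (rule finite_ext[OF D uL])
  interpret Nv: finite_measure "ext v D" by (rule finite_ext[OF D vL])
  have mE: "measure m E = 0"
  proof -
    have "emeasure m E = (\<integral>\<^sup>+(x::real^'n). 0 \<partial>lborel)"
      unfolding m[OF E(1)] by (intro nn_integral_cong) (auto simp: w_def eq split: split_indicator)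
    then show ?thesis by (simp add: measure_def)
  qed
  \<comment> \<open>The Lipschitz bound on \<open>U\<close> when the \<open>Lp\<close> distance is
    at most \<open>e powr (1 / p)\<close>, with \<open>F u D\<close> dominating the minimum by
    monotonicity. The last summand \<open>e\<close> pays for passing from \<open>E\<close> to
    \<open>U\<close>.\<close>
  define G where "G e = c1 * (measure lebesgue D powr ((p - 1) / p) + F u D powr ((p - 1) / p)
      + (e powr (1 / p)) powr (p - 1)) * e powr (1 / p) + e" for e
  have est: "\<bar>measure (ext u D) E - measure (ext v D) E\<bar> \<le> G e" if e: "0 < e" for e
  proof -
    obtain U where U: "open U" "E \<subseteq> U" "U \<subseteq> D"
      "\<And>M. M \<in> {ext u D, ext v D, m} \<Longrightarrow> measure M U \<le> measure M E + e"
      using Nu.finite_measure_axioms Nv.finite_measure_axioms m.finite_measure_axioms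
      by (rule_tac outer_regular_common[of "{ext u D, ext v D, m}" E D e])
         (auto simp: E bounded_opensD(1)[OF D] e sets_ext[OF D uL] sets_ext[OF D vL] m_def)
    have Ub: "U \<in> bounded_opens" using D U bounded_opens_subset by blast
    have uU: "u \<in> Lp p U" "v \<in> Lp p U"
      using p by (auto intro: Lp_bounded[OF Ub u] Lp_bounded[OF Ub v])
    have FU: "F u U = measure (ext u D) U" "F v U = measure (ext v D) U"
      using ext_open[OF D uL U(1,3)] ext_open[OF D vL U(1,3)] by auto
    have "Lp_norm p U (\<lambda>x. u x - v x) = measure m U powr (1 / p)"
    proof -
      have "(LINT x|lebesgue_on U. w x) = (LINT x|lborel. indicator U x * w x)"
        using Ub by (intro integral_lebesgue_on_borel) (auto dest: bounded_opensD)
      also have "\<dots> = enn2real (\<integral>\<^sup>+x. ennreal (indicator U x * w x) \<partial>lborel)"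
        using U(1) w0 by (intro integral_eq_nn_integral) auto
      also have "(\<integral>\<^sup>+x. ennreal (indicator U x * w x) \<partial>lborel) = emeasure m U"
        using U by (subst m) (auto intro!: nn_integral_cong split: split_indicator)
      finally show ?thesis by (simp add: Lp_norm_def w_def measure_def)
    qed
    moreover have "measure m U powr (1 / p) \<le> e powr (1 / p)"
      using U(4)[of m] mE p by (intro powr_mono2) auto
    ultimately have LU: "Lp_norm p U (\<lambda>x. u x - v x) \<le> e powr (1 / p)" by simp
    have "measure lebesgue U \<le> measure lebesgue D"
      using U bounded_opensD[OF D] bounded_opensD[OF Ub] by (intro measure_mono_fmeasurable) auto
    moreover have "min (F u U) (F v U) \<le> F u D"
      using F_mono[OF D uL U(1,3)] by simp
    ultimately have "\<bar>F u U - F v U\<bar> \<le> c1 * (measure lebesgue D powr ((p - 1) / p) + F u D powr ((p - 1) / p)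
      + (e powr (1 / p)) powr (p - 1)) * e powr (1 / p)"
      using F_nonneg[OF Ub uU(1)] F_nonneg[OF Ub uU(2)] p c1
      by (intro order_trans[OF F_Lipschitz[OF Ub uU]] mult_mono add_mono powr_mono2 LU)
         (auto intro!: add_nonneg_nonneg mult_nonneg_nonneg)
    moreover have "measure (ext u D) E \<le> measure (ext u D) U" "measure (ext v D) E \<le> measure (ext v D) U"
      using U by (auto intro!: Nu.finite_measure_mono Nv.finite_measure_mono simp: sets_ext[OF D uL] sets_ext[OF D vL])
    moreover have "measure (ext u D) U \<le> measure (ext u D) E + e" "measure (ext v D) U \<le> measure (ext v D) E + e"
      using U(4)[of "ext u D"] U(4)[of "ext v D"] by auto
    ultimately show ?thesis
      unfolding G_def FU by linarith
  qed
  have "(G \<longlongrightarrow> 0) (at_right 0)"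
  proof -
    have 1: "((\<lambda>e. e powr (1 / p)) \<longlongrightarrow> 0) (at_right (0::real))"
      using p by (intro tendsto_zero_powrI[OF tendsto_ident_at tendsto_const])
        (auto intro: eventually_mono[OF eventually_at_right_less])
    have "((\<lambda>e. (e powr (1 / p)) powr (p - 1)) \<longlongrightarrow> 0) (at_right (0::real))"
      using p by (intro tendsto_zero_powrI[OF 1 tendsto_const]) auto
    with 1 have "(G \<longlongrightarrow> c1 * (measure lebesgue D powr ((p - 1) / p) + F u D powr ((p - 1) / p) + 0) * 0 + 0) (at_right 0)"
      unfolding G_def by (intro tendsto_intros)
    then show ?thesis by simp
  qed
  then have "\<bar>measure (ext u D) E - measure (ext v D) E\<bar> \<le> 0"
    by (intro tendsto_lowerbound[where f = G and F = "at_right 0"])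
       (use est in \<open>auto intro: eventually_mono[OF eventually_at_right_less]\<close>)
  then show ?thesis by simp
qed

text \<open>The growth bound is available on open sets; a tight open superset carries it to Borel
  sets at the cost of \<open>?C * e' = e\<close>. This domination yields absolute continuity and
  later makes the part of a cube outside a level set harmless.\<close>

lemma ext_const_le:
  assumes D: "D \<in> bounded_opens" and E: "E \<in> sets borel" "E \<subseteq> D"
  shows "measure (ext (\<lambda>_. \<xi>) D) E \<le> c0 * (1 + norm \<xi> powr p) * measure lborel E"
proof (rule field_le_epsilon)
  let ?C = "c0 * (1 + norm \<xi> powr p)"
  have C: "0 < ?C" using c0 by (intro mult_pos_pos add_pos_nonneg) auto
  fix e :: real assume e: "0 < e"
  define e' where "e' = e / ?C"
  have e': "0 < e'" using e C by (simp add: e'_def)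
  \<comment> \<open>Lebesgue measure cut off at \<open>D\<close>, which is finite and thus outer
    regular.\<close>
  define m where "m = density lborel (indicator D :: real^'n \<Rightarrow> ennreal)"
  have Dm [measurable]: "D \<in> sets borel" by (rule bounded_opensD[OF D])
  have cL: "(\<lambda>_. \<xi>) \<in> Lp p D" using D p by simp
  have m: "emeasure m U = emeasure lborel U" if "U \<in> sets borel" "U \<subseteq> D" for U
    using that unfolding m_def by (subst emeasure_density) (auto simp: Int_absorb1 Int_absorb2 simp flip: indicator_inter_arith)
  have "emeasure m (space m) = emeasure lborel D"
    unfolding m_def by (subst emeasure_density) auto
  then interpret m: finite_measure m
    using bounded_opensD(4)[OF D] by (intro finite_measureI) auto
  interpret N: finite_measure "ext (\<lambda>_. \<xi>) D" by (rule finite_ext[OF D cL])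
  obtain U where U: "open U" "E \<subseteq> U" "U \<subseteq> D" "measure m U \<le> measure m E + e'"
    using m.finite_measure_axioms
    by (rule_tac outer_regular_common[of "{m}" E D e'])
       (auto simp: E bounded_opensD(1)[OF D] e' m_def)
  have Ub: "U \<in> bounded_opens" using D U bounded_opens_subset by blast
  have "measure lborel U \<le> measure lborel E + e'"
    using U m[of U] m[of E] E by (simp add: measure_def)
  have "measure (ext (\<lambda>_. \<xi>) D) E \<le> F (\<lambda>_. \<xi>) U"
    using U E by (subst ext_open[OF D cL, symmetric]) (auto intro!: N.finite_measure_mono simp: sets_ext[OF D cL])
  also have "\<dots> \<le> c0 * (measure lebesgue U + Lp_norm p U (\<lambda>_. \<xi>) powr p)"
    using Ub p by (intro F_upper) auto
  also have "Lp_norm p U (\<lambda>_. \<xi>) powr p = norm \<xi> powr p * measure lebesgue U"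
    using Ub p by (simp add: Lp_norm_const powr_mult powr_powr)
  also have "c0 * (measure lebesgue U + norm \<xi> powr p * measure lebesgue U) = ?C * measure lborel U"
    using U by (simp add: algebra_simps)
  also have "\<dots> \<le> ?C * (measure lborel E + e')"
    using C by (intro mult_left_mono) (auto simp: \<open>measure lborel U \<le> measure lborel E + e'\<close>)
  also have "\<dots> = ?C * measure lborel E + e"
    unfolding distrib_left[of ?C] e'_def using less_imp_neq[OF C] by (simp del: mult_eq_0_iff)
  finally show "measure (ext (\<lambda>_. \<xi>) D) E \<le> ?C * measure lborel E + e" .
qed

end

section \<open>The density\<close>

lemma Lip_bound_mono:
  fixes s t a b c n :: real
  assumes "0 \<le> s" "s \<le> t" "0 \<le> a" "0 \<le> c" "0 \<le> n"
  shows "c * (1 + s powr a + b) * n \<le> c * (1 + t powr a + b) * n"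
  by (intro mult_right_mono mult_left_mono add_mono powr_mono2 order_refl assms)

text \<open>The limit is one-sided because \<open>dens_lessD\<close> bounds the quotients only by
  numbers strictly above the density.\<close>

lemma tendsto_Lip_bound:
  fixes s a b c n :: real
  assumes "0 \<le> s" "0 < a"
  shows "((\<lambda>t. t + c * (1 + t powr a + b) * n) \<longlongrightarrow> s + c * (1 + s powr a + b) * n) (at_right s)"
proof -
  have "eventually (\<lambda>t. 0 \<le> t) (at_right s)"
    using eventually_at_right_less[of s] by (rule eventually_mono) (use assms in linarith)
  then have "((\<lambda>t. t powr a) \<longlongrightarrow> s powr a) (at_right s)"
    using assms by (intro tendsto_powr'[OF tendsto_ident_at tendsto_const]) blast
  then show ?thesis
    by (intro tendsto_add tendsto_mult tendsto_ident_at tendsto_const)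
qed

context Lip_functional
begin

definition quot :: "real^'n \<Rightarrow> real^'d \<Rightarrow> real \<Rightarrow> real" where
  "quot x \<xi> \<rho> = F (\<lambda>_. \<xi>) (cube \<rho> x) / \<rho> ^ CARD('n)"

definition dens :: "real^'n \<Rightarrow> real^'d \<Rightarrow> real" where
  "dens x \<xi> = real_of_ereal (upper_cube_density F x \<xi>)"

lemma const_Lp [simp]: "D \<in> bounded_opens \<Longrightarrow> (\<lambda>_. \<xi>) \<in> Lp p D"
  using p by simp

lemma quot_lower: "0 < \<rho> \<Longrightarrow> norm \<xi> powr p / c0 - c0 \<le> quot x \<xi> \<rho>"
  and quot_upper: "0 < \<rho> \<Longrightarrow> quot x \<xi> \<rho> \<le> c0 * (1 + norm \<xi> powr p)"
  and quot_nonneg: "0 < \<rho> \<Longrightarrow> 0 \<le> quot x \<xi> \<rho>"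
proof -
  assume \<rho>: "0 < \<rho>"
  define m where "m = \<rho> ^ CARD('n)"
  have m: "0 < m" using \<rho> by (simp add: m_def)
  have vol: "measure lebesgue (cube \<rho> x) = m"
    using \<rho> by (subst measure_lebesgue_cube) (auto simp: m_def)
  have nrm: "Lp_norm p (cube \<rho> x) (\<lambda>_. \<xi>) powr p = norm \<xi> powr p * m"
    using p m unfolding Lp_norm_const[OF cube_in_bounded_opens order.strict_trans[OF zero_less_one p]] vol
    by (simp add: powr_mult powr_powr)
  have "norm \<xi> powr p * m / c0 - c0 * m \<le> F (\<lambda>_. \<xi>) (cube \<rho> x)"
    using F_lower[of "cube \<rho> x" "\<lambda>_. \<xi>"] by (simp only: vol nrm cube_in_bounded_opens const_Lp)
  then have "(norm \<xi> powr p / c0 - c0) * m \<le> F (\<lambda>_. \<xi>) (cube \<rho> x)"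
    by (simp add: algebra_simps)
  then show "norm \<xi> powr p / c0 - c0 \<le> quot x \<xi> \<rho>"
    unfolding quot_def m_def[symmetric] using m by (simp add: pos_le_divide_eq)
  have "F (\<lambda>_. \<xi>) (cube \<rho> x) \<le> c0 * (m + norm \<xi> powr p * m)"
    using F_upper[of "cube \<rho> x" "\<lambda>_. \<xi>"] by (simp only: vol nrm cube_in_bounded_opens const_Lp)
  then show "quot x \<xi> \<rho> \<le> c0 * (1 + norm \<xi> powr p)"
    unfolding quot_def m_def[symmetric] using m by (simp add: pos_divide_le_eq algebra_simps)
  show "0 \<le> quot x \<xi> \<rho>"
    unfolding quot_def using F_nonneg[of "cube \<rho> x" "\<lambda>_. \<xi>"] \<rho> by simp
qed

lemma eventually_quot: "(\<And>\<rho>. 0 < \<rho> \<Longrightarrow> P \<rho>) \<Longrightarrow> eventually P (at_right (0::real))"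
  by (auto intro: eventually_mono[OF eventually_at_right_less])

text \<open>The growth condition confines the quotients between 0 and
  \<open>c0 * (1 + norm \<xi> powr p)\<close>. Hence the limsup is finite, and
  \<open>real_of_ereal\<close> in \<open>dens\<close> loses nothing.\<close>

lemma upper_cube_density_eq: "upper_cube_density F x \<xi> = ereal (dens x \<xi>)"
  and upper_cube_density_finite: "\<bar>upper_cube_density F x \<xi>\<bar> \<noteq> \<infinity>"
proof -
  have "upper_cube_density F x \<xi> = Limsup (at_right 0) (\<lambda>\<rho>. ereal (quot x \<xi> \<rho>))"
    by (simp add: upper_cube_density_def quot_def)
  moreover have "ereal 0 \<le> Limsup (at_right 0) (\<lambda>\<rho>. ereal (quot x \<xi> \<rho>))"
    by (intro le_Limsup eventually_quot) (auto simp: quot_nonneg)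
  moreover have "Limsup (at_right 0) (\<lambda>\<rho>. ereal (quot x \<xi> \<rho>)) \<le> ereal (c0 * (1 + norm \<xi> powr p))"
    by (intro Limsup_bounded eventually_quot) (auto simp: quot_upper)
  ultimately show "\<bar>upper_cube_density F x \<xi>\<bar> \<noteq> \<infinity>"
    by (cases "upper_cube_density F x \<xi>") auto
  then show "upper_cube_density F x \<xi> = ereal (dens x \<xi>)"
    by (simp add: dens_def ereal_real)
qed

lemma Limsup_quot: "Limsup (at_right 0) (\<lambda>\<rho>. ereal (quot x \<xi> \<rho>)) = ereal (dens x \<xi>)"
  unfolding upper_cube_density_eq[symmetric] by (simp add: upper_cube_density_def quot_def)

text \<open>With the three lemmas that follow, this replaces the limsup by eventual bounds on the
  quotients. From the density alone one gets eventual upper bounds, but no eventual lower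
  bounds.\<close>

lemma dens_leI: "eventually (\<lambda>\<rho>. quot x \<xi> \<rho> \<le> t) (at_right 0) \<Longrightarrow> dens x \<xi> \<le> t"
  using Limsup_bounded[of "\<lambda>\<rho>. ereal (quot x \<xi> \<rho>)" "ereal t" "at_right 0"] by (simp add: Limsup_quot)

lemma dens_geI: "eventually (\<lambda>\<rho>. t \<le> quot x \<xi> \<rho>) (at_right 0) \<Longrightarrow> t \<le> dens x \<xi>"
  using le_Limsup[of "at_right 0" "ereal t" "\<lambda>\<rho>. ereal (quot x \<xi> \<rho>)"] by (simp add: Limsup_quot)

lemma dens_lessD: "dens x \<xi> < t \<Longrightarrow> eventually (\<lambda>\<rho>. quot x \<xi> \<rho> < t) (at_right 0)"
  using Limsup_lessD[of "at_right 0" "\<lambda>\<rho>. ereal (quot x \<xi> \<rho>)" "ereal t"] by (simp add: Limsup_quot)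

lemma dens_eq_lim: "((\<lambda>\<rho>. quot x \<xi> \<rho>) \<longlongrightarrow> l) (at_right 0) \<Longrightarrow> dens x \<xi> = l"
  using lim_imp_Limsup[of "at_right (0::real)" "\<lambda>\<rho>. ereal (quot x \<xi> \<rho>)" "ereal l"] by (simp add: Limsup_quot)

lemma dens_lower: "norm \<xi> powr p / c0 - c0 \<le> dens x \<xi>"
  and dens_upper: "dens x \<xi> \<le> c0 * (1 + norm \<xi> powr p)"
  and dens_nonneg [simp]: "0 \<le> dens x \<xi>"
  by (rule dens_geI, rule eventually_quot, erule quot_lower)
    (rule dens_leI, rule eventually_quot, erule quot_upper, rule dens_geI, rule eventually_quot, erule quot_nonneg)

text \<open>Every term scales with the cube volume \<open>m\<close>, because
  \<open>m powr ((p - 1) / p) * m powr (1 / p) = m\<close>. The minimum is weakened to the value at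
  \<open>\<xi>2\<close>: a one-sided bound that is monotone in this value can pass to the
  limsup.\<close>

lemma quot_Lipschitz:
  assumes \<rho>: "0 < \<rho>"
  shows "quot x \<xi>1 \<rho> \<le> quot x \<xi>2 \<rho> + c1 * (1 + quot x \<xi>2 \<rho> powr ((p - 1) / p) + norm (\<xi>1 - \<xi>2) powr (p - 1)) * norm (\<xi>1 - \<xi>2)"
proof -
  define m where "m = \<rho> ^ CARD('n)"
  have m: "0 < m" using \<rho> by (simp add: m_def)
  have vol: "measure lebesgue (cube \<rho> x) = m"
    using \<rho> by (subst measure_lebesgue_cube) (auto simp: m_def)
  have nrm: "Lp_norm p (cube \<rho> x) (\<lambda>_. \<xi>1 - \<xi>2) = norm (\<xi>1 - \<xi>2) * m powr (1 / p)"
    using p by (simp add: Lp_norm_const vol)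
  have F: "F (\<lambda>_. \<xi>) (cube \<rho> x) = m * quot x \<xi> \<rho>" for \<xi>
    using m unfolding quot_def m_def[symmetric] by simp
  have "min (m * quot x \<xi>1 \<rho>) (m * quot x \<xi>2 \<rho>) powr ((p - 1) / p) \<le> (m * quot x \<xi>2 \<rho>) powr ((p - 1) / p)"
    using m p quot_nonneg[OF \<rho>] by (intro powr_mono2) auto
  then have "c1 * (m powr ((p - 1) / p) + min (m * quot x \<xi>1 \<rho>) (m * quot x \<xi>2 \<rho>) powr ((p - 1) / p)
      + (norm (\<xi>1 - \<xi>2) * m powr (1 / p)) powr (p - 1)) * (norm (\<xi>1 - \<xi>2) * m powr (1 / p))
    \<le> c1 * (m powr ((p - 1) / p) + (m * quot x \<xi>2 \<rho>) powr ((p - 1) / p)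
      + (norm (\<xi>1 - \<xi>2) * m powr (1 / p)) powr (p - 1)) * (norm (\<xi>1 - \<xi>2) * m powr (1 / p))"
    using c1 by (intro mult_right_mono mult_left_mono add_mono order_refl) auto
  moreover have "\<bar>m * quot x \<xi>1 \<rho> - m * quot x \<xi>2 \<rho>\<bar> \<le> c1 * (m powr ((p - 1) / p) + min (m * quot x \<xi>1 \<rho>) (m * quot x \<xi>2 \<rho>) powr ((p - 1) / p)
      + (norm (\<xi>1 - \<xi>2) * m powr (1 / p)) powr (p - 1)) * (norm (\<xi>1 - \<xi>2) * m powr (1 / p))"
    using F_Lipschitz[of "cube \<rho> x" "\<lambda>_. \<xi>1" "\<lambda>_. \<xi>2"] unfolding vol nrm F by simp
  ultimately have "m * quot x \<xi>1 \<rho> - m * quot x \<xi>2 \<rho> \<le> c1 * (m powr ((p - 1) / p) + (m * quot x \<xi>2 \<rho>) powr ((p - 1) / p)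
      + (norm (\<xi>1 - \<xi>2) * m powr (1 / p)) powr (p - 1)) * (norm (\<xi>1 - \<xi>2) * m powr (1 / p))"
    by linarith
  also have "(norm (\<xi>1 - \<xi>2) * m powr (1 / p)) powr (p - 1) = norm (\<xi>1 - \<xi>2) powr (p - 1) * m powr ((p - 1) / p)"
    using p by (simp add: powr_mult powr_powr)
  also have "(m * quot x \<xi>2 \<rho>) powr ((p - 1) / p) = m powr ((p - 1) / p) * quot x \<xi>2 \<rho> powr ((p - 1) / p)"
    using m quot_nonneg[OF \<rho>] by (simp add: powr_mult)
  also have "c1 * (m powr ((p - 1) / p) + m powr ((p - 1) / p) * quot x \<xi>2 \<rho> powr ((p - 1) / p)
      + norm (\<xi>1 - \<xi>2) powr (p - 1) * m powr ((p - 1) / p)) * (norm (\<xi>1 - \<xi>2) * m powr (1 / p))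
    = (m powr ((p - 1) / p) * m powr (1 / p)) *
      (c1 * (1 + quot x \<xi>2 \<rho> powr ((p - 1) / p) + norm (\<xi>1 - \<xi>2) powr (p - 1)) * norm (\<xi>1 - \<xi>2))"
    by (simp add: algebra_simps)
  also have "m powr ((p - 1) / p) * m powr (1 / p) = m"
    using m p by (simp add: powr_add[symmetric] add_divide_distrib[symmetric])
  finally have "m * quot x \<xi>1 \<rho> \<le> m * (quot x \<xi>2 \<rho> + c1 * (1 + quot x \<xi>2 \<rho> powr ((p - 1) / p) + norm (\<xi>1 - \<xi>2) powr (p - 1)) * norm (\<xi>1 - \<xi>2))"
    by (simp add: distrib_left)
  then show ?thesis using m by simp
qed

text \<open>For \<open>t\<close> above \<open>dens x \<xi>2\<close> the quotients at
  \<open>\<xi>2\<close> are eventually below \<open>t\<close>; as \<open>\<phi>\<close> is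
  increasing, \<open>\<phi> t\<close> bounds the quotients at \<open>\<xi>1\<close>. Then
  \<open>t\<close> decreases to the density.\<close>

lemma dens_le_dens:
  "dens x \<xi>1 \<le> dens x \<xi>2 + c1 * (1 + dens x \<xi>2 powr ((p - 1) / p) + norm (\<xi>1 - \<xi>2) powr (p - 1)) * norm (\<xi>1 - \<xi>2)"
proof -
  define \<phi> where "\<phi> t = t + c1 * (1 + t powr ((p - 1) / p) + norm (\<xi>1 - \<xi>2) powr (p - 1)) * norm (\<xi>1 - \<xi>2)" for t
  have le: "dens x \<xi>1 \<le> \<phi> t" if t: "dens x \<xi>2 < t" for t
  proof (rule dens_leI)
    show "eventually (\<lambda>\<rho>. quot x \<xi>1 \<rho> \<le> \<phi> t) (at_right 0)"
      using dens_lessD[OF t] eventually_at_right_less[of "0::real"]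
    proof eventually_elim
      case (elim \<rho>)
      have "quot x \<xi>1 \<rho> \<le> \<phi> (quot x \<xi>2 \<rho>)"
        unfolding \<phi>_def using elim by (intro quot_Lipschitz)
      also have "\<dots> \<le> \<phi> t"
        unfolding \<phi>_def
        by (rule add_mono[OF less_imp_le Lip_bound_mono]) (use elim p c1 quot_nonneg[of \<rho> x \<xi>2] in simp_all)
      finally show ?case .
    qed
  qed
  have "(\<phi> \<longlongrightarrow> \<phi> (dens x \<xi>2)) (at_right (dens x \<xi>2))"
    unfolding \<phi>_def by (rule tendsto_Lip_bound) (use p in simp_all)
  then have "dens x \<xi>1 \<le> \<phi> (dens x \<xi>2)"
    by (rule tendsto_lowerbound) (rule eventually_mono[OF eventually_at_right_less le], assumption, simp)
  then show ?thesis by (simp add: \<phi>_def)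
qed

text \<open>The minimum reappears when the one-sided bound is used with the smaller of the two
  values in second place.\<close>

lemma p_Lipschitz_dens: "p_Lipschitz p c1 (dens x)"
  unfolding p_Lipschitz_def
proof (intro allI)
  fix \<xi>1 \<xi>2
  show "\<bar>dens x \<xi>1 - dens x \<xi>2\<bar> \<le> c1 * (1 + min (dens x \<xi>1) (dens x \<xi>2) powr ((p - 1) / p) +
     norm (\<xi>1 - \<xi>2) powr (p - 1)) * norm (\<xi>1 - \<xi>2)"
  proof (cases "dens x \<xi>2 \<le> dens x \<xi>1")
    case True
    then have "\<bar>dens x \<xi>1 - dens x \<xi>2\<bar> = dens x \<xi>1 - dens x \<xi>2" "min (dens x \<xi>1) (dens x \<xi>2) = dens x \<xi>2"
      by auto
    then show ?thesis using dens_le_dens[of x \<xi>1 \<xi>2] by (simp only: diff_le_eq add.commute)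
  next
    case False
    then have "\<bar>dens x \<xi>1 - dens x \<xi>2\<bar> = dens x \<xi>2 - dens x \<xi>1" "min (dens x \<xi>1) (dens x \<xi>2) = dens x \<xi>1"
      by auto
    then show ?thesis
      using dens_le_dens[of x \<xi>2 \<xi>1] by (simp only: diff_le_eq add.commute norm_minus_commute[of \<xi>1])
  qed
qed

lemma continuous_dens: "continuous_on UNIV (dens x)"
  unfolding continuous_on_def
proof (intro ballI)
  fix \<xi>
  have "((\<lambda>\<eta>. c1 * (1 + dens x \<xi> powr ((p - 1) / p) + norm (\<eta> - \<xi>) powr (p - 1)) * norm (\<eta> - \<xi>)) \<longlongrightarrow>
     c1 * (1 + dens x \<xi> powr ((p - 1) / p) + norm (\<xi> - \<xi>) powr (p - 1)) * norm (\<xi> - \<xi>)) (at \<xi>)"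
    using p by (intro tendsto_intros tendsto_powr') auto
  then have lim: "((\<lambda>\<eta>. c1 * (1 + dens x \<xi> powr ((p - 1) / p) + norm (\<eta> - \<xi>) powr (p - 1)) * norm (\<eta> - \<xi>)) \<longlongrightarrow> 0) (at \<xi>)"
    by simp
  have le: "norm (dens x \<eta> - dens x \<xi>) \<le> c1 * (1 + dens x \<xi> powr ((p - 1) / p) + norm (\<eta> - \<xi>) powr (p - 1)) * norm (\<eta> - \<xi>)" for \<eta>
  proof -
    have "\<bar>dens x \<eta> - dens x \<xi>\<bar> \<le> c1 * (1 + min (dens x \<eta>) (dens x \<xi>) powr ((p - 1) / p) +
     norm (\<eta> - \<xi>) powr (p - 1)) * norm (\<eta> - \<xi>)"
      by (rule p_Lipschitz_dens[unfolded p_Lipschitz_def, THEN spec, THEN spec])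
    also have "\<dots> \<le> c1 * (1 + dens x \<xi> powr ((p - 1) / p) + norm (\<eta> - \<xi>) powr (p - 1)) * norm (\<eta> - \<xi>)"
      by (rule Lip_bound_mono) (use p c1 in simp_all)
    finally show ?thesis unfolding real_norm_def .
  qed
  have "((\<lambda>\<eta>. dens x \<eta> - dens x \<xi>) \<longlongrightarrow> 0) (at \<xi>)"
    by (rule Lim_null_comparison[OF always_eventually[OF allI[OF le]] lim])
  then show "(dens x \<longlongrightarrow> dens x \<xi>) (at \<xi>)"
    unfolding LIM_zero_iff .
qed



text \<open>Shrinking the cube to side \<open>r\<close> costs at most \<open>C\<close> times the
  volume of the shell, and the smaller cube lies in every cube of side \<open>\<rho>\<close> whose
  centre is within \<open>(\<rho> - r) / 2\<close> of \<open>x\<close>. Monotonicity of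
  \<open>F\<close> then preserves the strict inequality: the value is lower semicontinuous in the
  centre.\<close>

lemma open_F_cube_greater: "open {x. a < F (\<lambda>_. \<xi>) (cube \<rho> x)}"
proof (cases "0 < \<rho>")
  case False
  have "cube \<rho> x = {}" for x :: "real^'n"
  proof (rule equals0I)
    fix y assume "y \<in> cube \<rho> x"
    then have "\<bar>y $ undefined - x $ undefined\<bar> < \<rho> / 2" by (simp add: cube_def)
    then show False using False abs_ge_zero[of "y $ undefined - x $ undefined"] by linarith
  qed
  then show ?thesis by simp
next
  case \<rho>: True
  define C where "C = c0 * (1 + norm \<xi> powr p)"
  have "\<exists>e>0. ball x e \<subseteq> {x. a < F (\<lambda>_. \<xi>) (cube \<rho> x)}" if a: "a < F (\<lambda>_. \<xi>) (cube \<rho> x)" for x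
  proof -
    have "((\<lambda>r. F (\<lambda>_. \<xi>) (cube \<rho> x) - C * (\<rho> ^ CARD('n) - r ^ CARD('n))) \<longlongrightarrow>
      F (\<lambda>_. \<xi>) (cube \<rho> x) - C * (\<rho> ^ CARD('n) - \<rho> ^ CARD('n))) (at_left \<rho>)"
      by (intro tendsto_intros)
    then have "eventually (\<lambda>r. a < F (\<lambda>_. \<xi>) (cube \<rho> x) - C * (\<rho> ^ CARD('n) - r ^ CARD('n))) (at_left \<rho>)"
      by (rule order_tendstoD) (use a in simp)
    moreover have "eventually (\<lambda>r. 0 < r \<and> r < \<rho>) (at_left \<rho>)"
      using \<rho> by (intro eventually_at_leftI[of 0]) auto
    ultimately have "eventually (\<lambda>r. (a < F (\<lambda>_. \<xi>) (cube \<rho> x) - C * (\<rho> ^ CARD('n) - r ^ CARD('n))) \<and> 0 < r \<and> r < \<rho>) (at_left \<rho>)"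
      by (rule eventually_conj)
    then obtain r where r: "a < F (\<lambda>_. \<xi>) (cube \<rho> x) - C * (\<rho> ^ CARD('n) - r ^ CARD('n))" "0 < r" "r < \<rho>"
      using eventually_happens[of _ "at_left \<rho>"] by (auto simp: trivial_limit_at_left_real)
    let ?D = "cube \<rho> x"
    let ?N = "ext (\<lambda>_. \<xi>) ?D"
    interpret finite_measure ?N by (rule finite_ext) auto
    have sub: "cube r x \<subseteq> cube \<rho> x" using r by (intro cube_mono) auto
    have "measure ?N (cube \<rho> x - cube r x) \<le> C * measure lborel (cube \<rho> x - cube r x)"
      unfolding C_def by (intro ext_const_le) auto
    also have "measure lborel (cube \<rho> x - cube r x) = \<rho> ^ CARD('n) - r ^ CARD('n)"
      using sub r by (subst measure_Diff) (auto simp: measure_lborel_cube emeasure_lborel_cube)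
    finally have "F (\<lambda>_. \<xi>) ?D - F (\<lambda>_. \<xi>) (cube r x) \<le> C * (\<rho> ^ CARD('n) - r ^ CARD('n))"
      using sub by (subst (asm) finite_measure_Diff) (auto simp: sets_ext ext_open)
    then have ar: "a < F (\<lambda>_. \<xi>) (cube r x)" using r by simp
    have "a < F (\<lambda>_. \<xi>) (cube \<rho> y)" if y: "y \<in> ball x ((\<rho> - r) / 2)" for y
    proof -
      have "cube r x \<subseteq> cube \<rho> y"
      proof
        fix z assume z: "z \<in> cube r x"
        have "\<bar>z $ i - y $ i\<bar> < \<rho> / 2" for i
        proof -
          have "\<bar>(x - y) $ i\<bar> \<le> norm (x - y)" by (rule component_le_norm_cart)
          also have "\<dots> < (\<rho> - r) / 2" using y by (simp add: dist_norm)
          finally have "\<bar>x $ i - y $ i\<bar> < (\<rho> - r) / 2" by simp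
          moreover have "\<bar>z $ i - x $ i\<bar> < r / 2" using z by (simp add: cube_def)
          moreover have "\<bar>z $ i - y $ i\<bar> \<le> \<bar>z $ i - x $ i\<bar> + \<bar>x $ i - y $ i\<bar>" by simp
          ultimately show ?thesis by (simp add: field_simps)
        qed
        then show "z \<in> cube \<rho> y" by (simp add: cube_def)
      qed
      then have "F (\<lambda>_. \<xi>) (cube r x) \<le> F (\<lambda>_. \<xi>) (cube \<rho> y)"
        by (intro F_mono) auto
      then show ?thesis using ar by simp
    qed
    then show ?thesis using r by (intro exI[of _ "(\<rho> - r) / 2"]) auto
  qed
  then show ?thesis
    unfolding open_contains_ball by blast
qed

text \<open>The limsup runs over uncountably many \<open>\<rho>\<close>. By
  \<open>open_F_cube_greater\<close> each \<open>\<rho>\<close> contributes a closed condition on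
  \<open>x\<close>, so even the uncountable intersection over an interval is closed; the remaining
  unions, over rational \<open>s\<close> and over \<open>k\<close>, are countable.\<close>

lemma borel_measurable_dens [measurable]: "(\<lambda>x. dens x \<xi>) \<in> borel_measurable borel"
proof (rule borel_measurableI_less)
  fix t
  have "{x \<in> space borel. dens x \<xi> < t} =
    (\<Union>s\<in>{s\<in>\<rat>. s < t}. \<Union>k::nat. \<Inter>\<rho>\<in>{0<..<inverse (real (Suc k))}. - {x. s * \<rho> ^ CARD('n) < F (\<lambda>_. \<xi>) (cube \<rho> x)})"
    (is "?L = ?R")
  proof (intro set_eqI iffI)
    fix x assume "x \<in> ?L"
    then obtain s where s: "s \<in> \<rat>" "dens x \<xi> < s" "s < t"
      using Rats_dense_in_real[of "dens x \<xi>" t] by auto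
    from dens_lessD[OF s(2)] obtain b where b: "0 < b" "\<And>\<rho>. 0 < \<rho> \<Longrightarrow> \<rho> < b \<Longrightarrow> quot x \<xi> \<rho> < s"
      unfolding eventually_at_right_field by auto
    obtain k where "inverse (real (Suc k)) < b"
      using reals_Archimedean[OF b(1)] by auto
    then have "\<not> s * \<rho> ^ CARD('n) < F (\<lambda>_. \<xi>) (cube \<rho> x)" if "\<rho> \<in> {0<..<inverse (real (Suc k))}" for \<rho>
      using b(2)[of \<rho>] that unfolding quot_def by (auto simp: divide_less_eq)
    then show "x \<in> ?R" using s by blast
  next
    fix x assume "x \<in> ?R"
    then obtain s k where s: "s < t" and k: "\<And>\<rho>. \<rho> \<in> {0<..<inverse (real (Suc k))} \<Longrightarrow> \<not> s * \<rho> ^ CARD('n) < F (\<lambda>_. \<xi>) (cube \<rho> x)"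
      by blast
    have "quot x \<xi> \<rho> \<le> s" if "0 < \<rho>" "\<rho> < inverse (real (Suc k))" for \<rho>
      using k[of \<rho>] that unfolding quot_def by (auto simp: divide_le_eq)
    then have "eventually (\<lambda>\<rho>. quot x \<xi> \<rho> \<le> s) (at_right 0)"
      unfolding eventually_at_right_field by (intro exI[of _ "inverse (real (Suc k))"]) auto
    then show "x \<in> ?L" using dens_leI[of x \<xi> s] s by auto
  qed
  moreover have "?R \<in> sets borel"
  proof (intro sets.countable_UN''[of "{s \<in> \<rat>. s < t}"])
    show "countable {s \<in> \<rat>. s < t}" using countable_rat by (rule countable_subset[rotated]) auto
    fix s
    have "(\<Inter>\<rho>\<in>{0<..<inverse (real (Suc k))}. - {x. s * \<rho> ^ CARD('n) < F (\<lambda>_. \<xi>) (cube \<rho> x)}) \<in> sets borel" for k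
      by (intro borel_closed closed_INT ballI closed_Compl open_F_cube_greater)
    then show "(\<Union>k. \<Inter>\<rho>\<in>{0<..<inverse (real (Suc k))}. - {x. s * \<rho> ^ CARD('n) < F (\<lambda>_. \<xi>) (cube \<rho> x)}) \<in> sets borel"
      by (intro sets.countable_UN) blast
  qed
  ultimately show "{x \<in> space borel. dens x \<xi> < t} \<in> sets borel" by simp
qed

text \<open>At a density point of the level set \<open>{a \<le> g \<le> b}\<close>, with \<open>a < g x < b\<close> rational, the quotients are
  eventually almost between \<open>a\<close> and \<open>b\<close>; the part of a cube outside the level set is controlled by
  domination, so no integrability of \<open>g\<close> beyond finiteness is needed.\<close>

lemma ext_const_AE_quot:
  assumes D: "D \<in> bounded_opens"
  obtains g where "g \<in> borel_measurable borel" "density lborel g = ext (\<lambda>_. \<xi>) D"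
    "AE x in lborel. x \<in> D \<longrightarrow> g x \<noteq> \<infinity> \<and> ((\<lambda>\<rho>. quot x \<xi> \<rho>) \<longlongrightarrow> enn2real (g x)) (at_right 0)"
proof -
  define C where "C = c0 * (1 + norm \<xi> powr p)"
  have C: "0 < C" unfolding C_def using c0 by (intro mult_pos_pos add_pos_nonneg) auto
  let ?N = "ext (\<lambda>_. \<xi>) D"
  have Dm [measurable]: "D \<in> sets borel" and oD: "open D" using D by (auto dest: bounded_opensD)
  have sN: "sets ?N = sets borel" using D by (simp add: sets_ext)
  interpret N: finite_measure ?N using D by (intro finite_ext) auto
  have "absolutely_continuous lborel ?N"
    unfolding absolutely_continuous_def
  proof
    fix E :: "(real^'n) set" assume E: "E \<in> null_sets lborel"
    then have [measurable]: "E \<in> sets borel" by auto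
    have "measure lborel (E \<inter> D) = 0"
      using E by (intro measure_eq_0_null_sets null_set_Int2) auto
    then have "measure ?N (E \<inter> D) \<le> 0"
      using ext_const_le[OF D, of "E \<inter> D" \<xi>] by auto
    then have "emeasure ?N (E \<inter> D) = 0"
      using measure_nonneg[of ?N "E \<inter> D"] unfolding N.emeasure_eq_measure by simp
    moreover have "emeasure ?N (E - D) \<le> emeasure ?N (- D)"
      by (intro emeasure_mono) (auto simp: sN)
    moreover have "emeasure ?N (- D) = 0" using D by (intro ext_outside) auto
    moreover have "emeasure ?N E \<le> emeasure ?N (E \<inter> D) + emeasure ?N (E - D)"
      using emeasure_subadditive[of "E \<inter> D" ?N "E - D"] by (simp add: sN Int_Diff_Un)
    ultimately have "emeasure ?N E = 0" by simp
    then show "E \<in> null_sets ?N" by (auto simp: null_sets_def sN)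
  qed
  then obtain g where g [measurable]: "g \<in> borel_measurable borel" and gN: "density lborel g = ?N"
    using sigma_finite_measure.Radon_Nikodym[OF sigma_finite_lborel, of ?N] sN by auto
  have emN: "emeasure ?N E = (\<integral>\<^sup>+x\<in>E. g x \<partial>lborel)" if "E \<in> sets borel" for E
    using that unfolding gN[symmetric] by (subst emeasure_density) auto
  have fin: "AE x in lborel. g x \<noteq> \<infinity>"
    using emN[of UNIV] N.emeasure_finite[of UNIV] by (intro nn_integral_noteq_infinite) auto
  \<comment> \<open>For negative \<open>a\<close> the value \<open>ennreal a\<close> is 0. This
    covers the points with \<open>g x = 0\<close>, where every rational \<open>a\<close> below is
    negative.\<close>
  define E where "E ab = {x \<in> D. ennreal (fst ab) \<le> g x \<and> g x \<le> ennreal (snd ab)}" for ab :: "real \<times> real"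
  have Em [measurable]: "E ab \<in> sets borel" for ab
    unfolding E_def by measurable
  \<comment> \<open>Rational endpoints make the family of level sets countable, so one null set
    serves for all of them.\<close>
  have "AE x in lborel. \<forall>ab\<in>\<rat> \<times> \<rat>. x \<in> E ab \<longrightarrow>
      ((\<lambda>\<rho>. measure lborel (cube \<rho> x - E ab) / \<rho> ^ CARD('n)) \<longlongrightarrow> 0) (at_right 0)"
    by (subst AE_ball_countable) (auto intro!: AE_cube_density countable_rat)
  with fin have "AE x in lborel. x \<in> D \<longrightarrow> g x \<noteq> \<infinity> \<and> ((\<lambda>\<rho>. quot x \<xi> \<rho>) \<longlongrightarrow> enn2real (g x)) (at_right 0)"
  proof eventually_elim
    case (elim x)
    show ?case
    proof
      assume x: "x \<in> D"
      define G where "G = enn2real (g x)"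
      have G: "g x = ennreal G" "0 \<le> G" using elim(1) by (auto simp: G_def less_top)
      have "((\<lambda>\<rho>. quot x \<xi> \<rho>) \<longlongrightarrow> G) (at_right 0)"
      proof (rule tendstoI)
        fix e :: real assume e: "0 < e"
        obtain a where a: "a \<in> \<rat>" "G - e / 2 < a" "a < G"
          using Rats_dense_in_real[of "G - e / 2" G] e by auto
        obtain b where b: "b \<in> \<rat>" "G < b" "b < G + e / 2"
          using Rats_dense_in_real[of G "G + e / 2"] e by auto
        let ?E = "E (a, b)"
        define \<delta> where "\<delta> = (\<lambda>\<rho>. measure lborel (cube \<rho> x - ?E) / \<rho> ^ CARD('n))"
        have "x \<in> ?E" using x a b G by (auto simp: E_def intro!: ennreal_leI)
        then have "(\<delta> \<longlongrightarrow> 0) (at_right 0)"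
          using bspec[OF elim(2), of "(a, b)"] a b by (auto simp: \<delta>_def)
        \<comment> \<open>Half of \<open>e\<close> is spent on the distance of \<open>a\<close> and
          \<open>b\<close> from \<open>G\<close>. The part of the cube outside \<open>?E\<close>
          changes the quotient by at most \<open>C * \<delta> \<rho>\<close> upwards and
          \<open>\<bar>a\<bar> * \<delta> \<rho>\<close> downwards; the threshold keeps even the sum
          of both below the other half.\<close>
        then have "eventually (\<lambda>\<rho>. \<delta> \<rho> < e / 2 / (C + \<bar>a\<bar> + 1)) (at_right 0)"
          using e C by (intro order_tendstoD) auto
        then show "eventually (\<lambda>\<rho>. dist (quot x \<xi> \<rho>) G < e) (at_right 0)"
          using eventually_at_right_less[of "0::real"] eventually_cube_subset[OF oD x]
        proof eventually_elim
          case (elim \<rho>)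
          let ?Q = "cube \<rho> x"
          have \<delta>0: "0 \<le> \<delta> \<rho>" using elim by (simp add: \<delta>_def)
          have QE: "measure lborel (?Q - ?E) = \<delta> \<rho> * \<rho> ^ CARD('n)"
            using elim by (simp add: \<delta>_def)
          have finQ: "emeasure lborel (?Q \<inter> ?E) \<noteq> \<infinity>" 
            using emeasure_mono[of "?Q \<inter> ?E" ?Q lborel] emeasure_lborel_cube[of \<rho> x] elim by (auto simp: top_unique)
          have QE2: "measure lborel (?Q \<inter> ?E) = (1 - \<delta> \<rho>) * \<rho> ^ CARD('n)"
          proof -
            have "measure lborel ?Q = measure lborel (?Q \<inter> ?E) + measure lborel (?Q - ?E)"
              using measure_Diff[of lborel ?Q "?Q \<inter> ?E"] elim
              by (simp add: emeasure_lborel_cube Diff_Int2[symmetric] Diff_Int)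
            then show ?thesis
              using elim by (simp add: measure_lborel_cube QE algebra_simps)
          qed
          have NQ: "F (\<lambda>_. \<xi>) ?Q = measure ?N (?Q \<inter> ?E) + measure ?N (?Q - ?E)"
            using elim D by (subst N.finite_measure_Union[symmetric]) (auto simp: sN ext_open Int_Diff_Un)
          have NQ2: "measure ?N (?Q - ?E) \<le> C * (\<delta> \<rho> * \<rho> ^ CARD('n))"
            using ext_const_le[OF D, of "?Q - ?E" \<xi>] elim by (auto simp: QE C_def)
          have up: "measure ?N (?Q \<inter> ?E) \<le> b * measure lborel (?Q \<inter> ?E)"
          proof -
            have "emeasure ?N (?Q \<inter> ?E) \<le> (\<integral>\<^sup>+x\<in>?Q \<inter> ?E. ennreal b \<partial>lborel)"
              by (subst emN) (auto simp: E_def intro!: nn_integral_mono split: split_indicator)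
            also have "\<dots> = ennreal (b * measure lborel (?Q \<inter> ?E))"
              using finQ b G by (simp add: nn_integral_cmult_indicator ennreal_mult emeasure_eq_ennreal_measure)
            finally show ?thesis
              using b G by (simp add: N.emeasure_eq_measure)
          qed
          have lo: "a * measure lborel (?Q \<inter> ?E) \<le> measure ?N (?Q \<inter> ?E)"
          proof (cases "0 \<le> a")
            case True
            have "ennreal (a * measure lborel (?Q \<inter> ?E)) = (\<integral>\<^sup>+x\<in>?Q \<inter> ?E. ennreal a \<partial>lborel)"
              using finQ True by (simp add: nn_integral_cmult_indicator ennreal_mult emeasure_eq_ennreal_measure)
            also have "\<dots> \<le> emeasure ?N (?Q \<inter> ?E)"
              by (subst emN) (auto simp: E_def intro!: nn_integral_mono split: split_indicator)
            finally show ?thesis by (simp add: N.emeasure_eq_measure)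
          next
            case False
            then have "a * measure lborel (?Q \<inter> ?E) \<le> 0"
              by (simp add: mult_nonpos_nonneg)
            then show ?thesis using measure_nonneg[of ?N "?Q \<inter> ?E"] by linarith
          qed
          have up': "quot x \<xi> \<rho> \<le> b + C * \<delta> \<rho>"
          proof -
            have "F (\<lambda>_. \<xi>) ?Q \<le> b * ((1 - \<delta> \<rho>) * \<rho> ^ CARD('n)) + C * (\<delta> \<rho> * \<rho> ^ CARD('n))"
              using up NQ2 unfolding NQ QE2 by linarith
            also have "\<dots> \<le> b * (1 * \<rho> ^ CARD('n)) + C * (\<delta> \<rho> * \<rho> ^ CARD('n))"
              using \<delta>0 b G elim by (intro add_right_mono mult_left_mono mult_right_mono) auto
            finally show ?thesis
              using elim unfolding quot_def by (simp add: pos_divide_le_eq algebra_simps)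
          qed
          have lo': "a - \<bar>a\<bar> * \<delta> \<rho> \<le> quot x \<xi> \<rho>"
          proof -
            have "(a - \<bar>a\<bar> * \<delta> \<rho>) * \<rho> ^ CARD('n) \<le> (a - a * \<delta> \<rho>) * \<rho> ^ CARD('n)"
              using elim \<delta>0 by (intro mult_right_mono diff_left_mono) auto
            also have "\<dots> = a * ((1 - \<delta> \<rho>) * \<rho> ^ CARD('n))"
              by (simp add: algebra_simps)
            also have "\<dots> \<le> measure ?N (?Q \<inter> ?E)"
              using lo unfolding QE2 .
            also have "\<dots> \<le> F (\<lambda>_. \<xi>) ?Q"
              unfolding NQ by simp
            finally show ?thesis
              using elim unfolding quot_def by (simp add: pos_le_divide_eq)
          qed
          have "(C + \<bar>a\<bar> + 1) * \<delta> \<rho> < e / 2"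
          proof -
            have "0 < C + \<bar>a\<bar> + 1" using C by linarith
            from elim(1)[unfolded pos_less_divide_eq[OF this]] show ?thesis by (simp only: mult.commute)
          qed
          then have "C * \<delta> \<rho> + \<bar>a\<bar> * \<delta> \<rho> < e / 2"
            using \<delta>0 by (simp add: distrib_right)
          moreover have "0 \<le> C * \<delta> \<rho>" "0 \<le> \<bar>a\<bar> * \<delta> \<rho>" using \<delta>0 C by auto
          ultimately show ?case
            using up' lo' a b unfolding dist_real_def abs_less_iff by linarith
        qed
      qed
      then show "g x \<noteq> \<infinity> \<and> ((\<lambda>\<rho>. quot x \<xi> \<rho>) \<longlongrightarrow> enn2real (g x)) (at_right 0)"
        using elim(1) by (simp add: G_def)
    qed
  qed
  then show thesis using that g gN by blast
qed

text \<open>Almost everywhere the quotients converge, so their limsup is the Radon-Nikodym density.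
  Replacing that density by \<open>dens\<close> removes its dependence on \<open>D\<close>.\<close>

lemma emeasure_ext_const:
  assumes D: "D \<in> bounded_opens" and E: "E \<in> sets borel" "E \<subseteq> D"
  shows "emeasure (ext (\<lambda>_. \<xi>) D) E = (\<integral>\<^sup>+x\<in>E. ennreal (dens x \<xi>) \<partial>lborel)"
proof -
  obtain g where g: "g \<in> borel_measurable borel" "density lborel g = ext (\<lambda>_. \<xi>) D"
    "AE x in lborel. x \<in> D \<longrightarrow> g x \<noteq> \<infinity> \<and> ((\<lambda>\<rho>. quot x \<xi> \<rho>) \<longlongrightarrow> enn2real (g x)) (at_right 0)"
    using ext_const_AE_quot[OF D] .
  have "emeasure (ext (\<lambda>_. \<xi>) D) E = (\<integral>\<^sup>+x\<in>E. g x \<partial>lborel)"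
    unfolding g(2)[symmetric] using g(1) E by (subst emeasure_density) auto
  also have "\<dots> = (\<integral>\<^sup>+x\<in>E. ennreal (dens x \<xi>) \<partial>lborel)"
    using g(3)
    by (intro nn_integral_cong_AE, eventually_elim)
       (use E dens_eq_lim in \<open>auto simp: less_top split: split_indicator\<close>)
  finally show ?thesis .
qed

end

section \<open>Integral representation\<close>

text \<open>Real functions measurable for a completed measure have Borel representatives, so
  \<open>u\<close>, cut off to 0 outside \<open>D\<close>, is treated componentwise.\<close>

lemma lebesgue_on_ex_borel:
  fixes u :: "real^'n \<Rightarrow> real^'d"
  assumes D: "D \<in> sets borel" and u: "u \<in> borel_measurable (lebesgue_on D)"
  obtains v where "v \<in> borel_measurable borel" "AE x in lebesgue_on D. u x = v x"
proof -
  have uD: "(\<lambda>x. indicator D x *\<^sub>R u x) \<in> borel_measurable lebesgue"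
    using D u by (simp add: borel_measurable_restrict_space_iff)
  have ex: "\<forall>i. \<exists>g. g \<in> borel_measurable lborel \<and> (AE x in lborel. (indicator D x *\<^sub>R u x) $ i = (g x :: real))"
    unfolding Bex_def[symmetric]
    by (intro allI completion_ex_borel_measurable_real measurable_compose[OF uD]
        borel_measurable_continuous_onI continuous_intros)
  from choice[OF ex] obtain g where "\<forall>i. g i \<in> borel_measurable lborel \<and> (AE x in lborel. (indicator D x *\<^sub>R u x) $ i = g i x)"
    by (rule exE)
  then have g [measurable]: "g i \<in> borel_measurable borel"
    and geq: "AE x in lborel. (indicator D x *\<^sub>R u x) $ i = g i x" for i
    by simp_all
  define v where "v x = (\<Sum>i\<in>UNIV. g i x *\<^sub>R axis i (1::real))" for x
  have "v \<in> borel_measurable borel"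
    unfolding v_def by measurable
  moreover have "AE x in lborel. \<forall>i\<in>UNIV. (indicator D x *\<^sub>R u x) $ i = g i x"
    using geq by (intro AE_finite_allI) auto
  then have "AE x in lebesgue. \<forall>i\<in>UNIV. (indicator D x *\<^sub>R u x) $ i = g i x"
    by (rule AE_completion)
  then have "AE x in lebesgue_on D. u x = v x"
    using D
  proof (subst AE_restrict_space_iff, simp, elim eventually_mono, intro impI)
    fix x assume *: "\<forall>i\<in>UNIV. (indicator D x *\<^sub>R u x) $ i = g i x" "x \<in> D"
    then have "v x = (\<Sum>i\<in>UNIV. u x $ i *\<^sub>R axis i 1)"
      unfolding v_def by (intro sum.cong) auto
    then show "u x = v x"
      by (simp add: basis_expansion scalar_mult_eq_scaleR[symmetric])
  qed
  ultimately show thesis using that by blast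
qed

context Lip_functional
begin

text \<open>For a simple second argument only countably many sections of \<open>dens\<close> occur,
  and continuity in the second variable passes to the limit. The first argument is a general
  \<open>h\<close> so that the rule also applies on product spaces, where Fubini needs joint
  measurability.\<close>

lemma measurable_dens_comp [measurable (raw)]:
  assumes h [measurable]: "h \<in> measurable M borel" and u: "u \<in> borel_measurable M"
  shows "(\<lambda>x. dens (h x) (u x)) \<in> borel_measurable M"
proof -
  obtain s where s: "\<And>i. simple_function M (s i)" "\<And>x. x \<in> space M \<Longrightarrow> (\<lambda>i. s i x) \<longlonglongrightarrow> u x"
    using borel_measurable_implies_sequence_metric[OF u, of 0] by blast
  have "(\<lambda>x. dens (h x) (s i x)) \<in> borel_measurable M" for i
  proof (rule measurable_compose_countable'[where I = "s i ` space M"])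
    show "s i \<in> measurable M (count_space (s i ` space M))"
      using s(1)[of i] by (subst measurable_count_space_eq2) (auto simp: simple_function_def)
    show "countable (s i ` space M)"
      using s(1)[of i] by (auto simp: simple_function_def intro: countable_finite)
  qed measurable
  moreover have "(\<lambda>i. dens (h x) (s i x)) \<longlonglongrightarrow> dens (h x) (u x)" if "x \<in> space M" for x
    by (rule continuous_on_tendsto_compose[OF continuous_dens s(2)[OF that]]) auto
  ultimately show ?thesis
    by (rule borel_measurable_LIMSEQ_metric)
qed

lemma F_simple:
  assumes D: "D \<in> bounded_opens" and u: "simple_function borel u"
  shows "has_bochner_integral (lebesgue_on D) (\<lambda>x. dens x (u x)) (F u D)"
proof -
  have um [measurable]: "u \<in> borel_measurable borel"
    using u by (rule borel_measurable_simple_function)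
  have fin: "finite (range u)"
    using u by (simp add: simple_function_def)
  obtain B where B: "\<And>x. norm (u x) \<le> B"
    using finite_imp_bounded[OF fin] by (auto simp: bounded_iff)
  have uL: "u \<in> Lp p D"
    using p by (intro Lp_bounded[OF D um B]) auto
  have Dm [measurable]: "D \<in> sets borel" using D by (rule bounded_opensD)
  interpret N: finite_measure "ext u D" by (rule finite_ext[OF D uL])
  define E where "E y = u -` {y} \<inter> D" for y
  have E [measurable]: "E y \<in> sets borel" for y
    unfolding E_def by measurable
  have disj: "disjoint_family_on E (range u)"
    by (auto simp: disjoint_family_on_def E_def)
  have DE: "(\<Union>y\<in>range u. E y) = D" by (auto simp: E_def)
  have "emeasure (ext u D) D = (\<Sum>y\<in>range u. emeasure (ext u D) (E y))"
    \<comment> \<open>\<open>D\<close> is rewritten as a union of level sets only as the set being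
      measured; the \<open>D\<close> inside \<open>ext u D\<close> has to stay.\<close>
    unfolding DE[symmetric, THEN arg_cong[of _ _ "emeasure (ext u D)"]]
    by (rule sum_emeasure[symmetric]) (use fin E disj in \<open>auto simp: sets_ext[OF D uL]\<close>)
  also have "\<dots> = (\<Sum>y\<in>range u. \<integral>\<^sup>+x\<in>E y. ennreal (dens x (u x)) \<partial>lborel)"
  proof (rule sum.cong)
    fix y
    interpret Ny: finite_measure "ext (\<lambda>_. y) D" using D by (intro finite_ext) auto
    have "measure (ext u D) (E y) = measure (ext (\<lambda>_. y) D) (E y)"
      by (rule ext_eq_on[OF D um B, of "\<lambda>_. y" "norm y"]) (simp_all add: E, auto simp: E_def)
    then have "emeasure (ext u D) (E y) = emeasure (ext (\<lambda>_. y) D) (E y)"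
      by (simp add: N.emeasure_eq_measure Ny.emeasure_eq_measure)
    also have "\<dots> = (\<integral>\<^sup>+x\<in>E y. ennreal (dens x y) \<partial>lborel)"
      by (intro emeasure_ext_const[OF D] E) (simp add: E_def)
    also have "\<dots> = (\<integral>\<^sup>+x\<in>E y. ennreal (dens x (u x)) \<partial>lborel)"
      by (intro nn_integral_cong) (auto simp: E_def split: split_indicator)
    finally show "emeasure (ext u D) (E y) = (\<integral>\<^sup>+x\<in>E y. ennreal (dens x (u x)) \<partial>lborel)" .
  qed simp
  also have "\<dots> = (\<integral>\<^sup>+x. (\<Sum>y\<in>range u. ennreal (dens x (u x)) * indicator (E y) x) \<partial>lborel)"
    by (subst nn_integral_sum) auto
  also have "\<dots> = (\<integral>\<^sup>+x\<in>D. ennreal (dens x (u x)) \<partial>lborel)"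
  proof (intro nn_integral_cong)
    fix x
    have "(\<Sum>y\<in>range u. ennreal (dens x (u x)) * indicator (E y) x) = (\<Sum>y\<in>{u x}. ennreal (dens x (u x)) * indicator (E y) x)"
      using fin by (intro sum.mono_neutral_right) (auto simp: E_def split: split_indicator)
    then show "(\<Sum>y\<in>range u. ennreal (dens x (u x)) * indicator (E y) x) = ennreal (dens x (u x)) * indicator D x"
      by (simp add: E_def indicator_def)
  qed
  also have "\<dots> = (\<integral>\<^sup>+x. ennreal (dens x (u x)) \<partial>lebesgue_on D)"
    by (subst nn_integral_lebesgue_on_borel) auto
  finally have "(\<integral>\<^sup>+x. ennreal (dens x (u x)) \<partial>lebesgue_on D) = ennreal (F u D)"
    using D bounded_opensD(1)[OF D] by (simp add: N.emeasure_eq_measure ext_open[OF D uL])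
  then show ?thesis
    using F_nonneg[OF D uL] borel_measurable_lebesgue_on[of "\<lambda>x. dens x (u x)" D]
    by (intro has_bochner_integral_nn_integral) auto
qed

lemma F_borel:
  assumes D: "D \<in> bounded_opens" and um [measurable]: "u \<in> borel_measurable borel" and uL: "u \<in> Lp p D"
  shows "has_bochner_integral (lebesgue_on D) (\<lambda>x. dens x (u x)) (F u D)"
proof -
  let ?M = "lebesgue_on D"
  interpret finite_measure ?M
    using D by (intro finite_measure_lebesgue_on bounded_opensD)
  obtain s where s: "\<And>i. simple_function borel (s i)" "\<And>x. (\<lambda>i. s i x) \<longlonglongrightarrow> u x" "\<And>i x. norm (s i x) \<le> 2 * norm (u x)"
    using borel_measurable_implies_sequence_metric[OF um, of 0] by auto
  have sm [measurable]: "s i \<in> borel_measurable borel" for i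
    using s(1) by (rule borel_measurable_simple_function)
  have intu: "integrable ?M (\<lambda>x. norm (u x) powr p)"
    using uL by (simp add: Lp_def)
  have intc: "integrable ?M (\<lambda>x. c * norm (u x) powr p)" for c
    using intu by (rule integrable_mult_right)
  have meas: "g \<in> borel_measurable borel \<Longrightarrow> g \<in> borel_measurable ?M" for g :: "real^'n \<Rightarrow> real"
    by (rule borel_measurable_lebesgue_on)
  have sL: "s i \<in> Lp p D" for i
  proof -
    have "integrable ?M (\<lambda>x. norm (s i x) powr p)"
    proof (rule Bochner_Integration.integrable_bound[OF intc[of "2 powr p"]])
      show "AE x in ?M. norm (norm (s i x) powr p) \<le> norm (2 powr p * norm (u x) powr p)"
        using s(3) p by (auto simp: powr_mult[symmetric] intro!: powr_mono2)
    qed (intro meas, measurable)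
    then show ?thesis
      using borel_measurable_lebesgue_on[OF sm[of i]] by (simp add: Lp_def)
  qed
  have "(\<lambda>i. LINT x|?M. norm (s i x - u x) powr p) \<longlonglongrightarrow> (LINT x|?M. 0)"
  \<comment> \<open>The constant 3 is 2 + 1, from \<open>norm (s i x) \<le> 2 * norm (u x)\<close>
    and the triangle inequality.\<close>
  proof (rule integral_dominated_convergence[where w = "\<lambda>x. 3 powr p * norm (u x) powr p"])
    show "AE x in ?M. (\<lambda>i. norm (s i x - u x) powr p) \<longlonglongrightarrow> 0"
    proof (intro AE_I2)
      fix x
      have "(\<lambda>i. norm (s i x - u x)) \<longlonglongrightarrow> 0"
        using s(2)[of x] by (simp add: tendsto_norm_zero_iff LIM_zero_iff)
      then show "(\<lambda>i. norm (s i x - u x) powr p) \<longlonglongrightarrow> 0"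
        using p by (intro tendsto_zero_powrI[OF _ tendsto_const]) auto
    qed
    show "AE x in ?M. norm (norm (s i x - u x) powr p) \<le> 3 powr p * norm (u x) powr p" for i
    proof (intro AE_I2)
      fix x
      have "norm (s i x - u x) \<le> 3 * norm (u x)"
        using norm_triangle_ineq4[of "s i x" "u x"] s(3)[of i x] by linarith
      then have "norm (s i x - u x) powr p \<le> (3 * norm (u x)) powr p"
        using p by (intro powr_mono2) auto
      then show "norm (norm (s i x - u x) powr p) \<le> 3 powr p * norm (u x) powr p"
        by (simp add: powr_mult)
    qed
  qed (auto intro: meas intc intu)
  then have "(\<lambda>i. LINT x|?M. norm (s i x - u x) powr p) \<longlonglongrightarrow> 0" by simp
  then have nrm: "(\<lambda>i. Lp_norm p D (\<lambda>x. s i x - u x)) \<longlonglongrightarrow> 0"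
    unfolding Lp_norm_def using p
    by (intro tendsto_zero_powrI[OF _ tendsto_const]) (auto intro!: always_eventually Bochner_Integration.integral_nonneg)
  have "(\<lambda>i. F (s i) D - F u D) \<longlonglongrightarrow> 0"
  proof (rule Lim_null_comparison)
    let ?n = "\<lambda>i. Lp_norm p D (\<lambda>x. s i x - u x)"
    have "(\<lambda>i. ?n i powr (p - 1)) \<longlonglongrightarrow> 0"
      using p by (intro tendsto_zero_powrI[OF nrm tendsto_const]) auto
    then have "(\<lambda>i. c1 * (measure lebesgue D powr ((p - 1) / p) + F u D powr ((p - 1) / p) + ?n i powr (p - 1)) * ?n i)
      \<longlonglongrightarrow> c1 * (measure lebesgue D powr ((p - 1) / p) + F u D powr ((p - 1) / p) + 0) * 0"
      by (intro tendsto_mult tendsto_add tendsto_const nrm)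
    then show "(\<lambda>i. c1 * (measure lebesgue D powr ((p - 1) / p) + F u D powr ((p - 1) / p) + ?n i powr (p - 1)) * ?n i) \<longlonglongrightarrow> 0"
      by simp
    show "eventually (\<lambda>i. norm (F (s i) D - F u D) \<le> c1 * (measure lebesgue D powr ((p - 1) / p) + F u D powr ((p - 1) / p) + ?n i powr (p - 1)) * ?n i) sequentially"
    proof (intro always_eventually allI)
      fix i
      have "min (F (s i) D) (F u D) powr ((p - 1) / p) \<le> F u D powr ((p - 1) / p)"
        using p F_nonneg[OF D sL] F_nonneg[OF D uL] by (intro powr_mono2) auto
      then have "c1 * (measure lebesgue D powr ((p - 1) / p) + min (F (s i) D) (F u D) powr ((p - 1) / p) + ?n i powr (p - 1)) * ?n i
        \<le> c1 * (measure lebesgue D powr ((p - 1) / p) + F u D powr ((p - 1) / p) + ?n i powr (p - 1)) * ?n i"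
        using c1 by (intro mult_right_mono mult_left_mono add_mono order_refl) auto
      then show "norm (F (s i) D - F u D) \<le> c1 * (measure lebesgue D powr ((p - 1) / p) + F u D powr ((p - 1) / p) + ?n i powr (p - 1)) * ?n i"
        using F_Lipschitz[OF D sL uL, of i] unfolding real_norm_def by (rule order_trans[rotated])
    qed
  qed
  then have lim1: "(\<lambda>i. F (s i) D) \<longlonglongrightarrow> F u D"
    by (simp only: LIM_zero_iff)
  \<comment> \<open>The growth bound at norm \<open>2 * norm (u x)\<close>: it dominates
    \<open>dens\<close> along the whole approximating sequence and at \<open>u\<close>
    itself.\<close>
  define w where "w x = c0 + c0 * (2 powr p) * norm (u x) powr p" for x
  have w: "integrable ?M w"
    unfolding w_def by (intro Bochner_Integration.integrable_add intc) simp
  have bound: "dens x \<xi> \<le> w x" if "norm \<xi> \<le> 2 * norm (u x)" for x \<xi>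
  proof -
    have "norm \<xi> powr p \<le> (2 * norm (u x)) powr p"
      using that p by (intro powr_mono2) auto
    then have "c0 * (1 + norm \<xi> powr p) \<le> c0 * (1 + (2 * norm (u x)) powr p)"
      using c0 by (intro mult_left_mono add_left_mono) auto
    also have "\<dots> = w x"
      by (simp add: w_def powr_mult algebra_simps)
    finally show ?thesis using dens_upper[of x \<xi>] by linarith
  qed
  have lim2: "(\<lambda>i. LINT x|?M. dens x (s i x)) \<longlonglongrightarrow> (LINT x|?M. dens x (u x))"
  proof (rule integral_dominated_convergence[where w = w])
    show "AE x in ?M. (\<lambda>i. dens x (s i x)) \<longlonglongrightarrow> dens x (u x)"
      by (intro AE_I2 continuous_on_tendsto_compose[OF continuous_dens s(2)]) auto
    show "AE x in ?M. norm (dens x (s i x)) \<le> w x" for i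
      using s(3) bound by auto
  qed (auto intro: meas w)
  have "(LINT x|?M. dens x (s i x)) = F (s i) D" for i
    using F_simple[OF D s(1)] by (rule has_bochner_integral_integral_eq)
  then have "(LINT x|?M. dens x (u x)) = F u D"
    using LIMSEQ_unique[OF lim1] lim2 by simp
  moreover have "integrable ?M (\<lambda>x. dens x (u x))"
    by (rule Bochner_Integration.integrable_bound[OF w])
       (auto intro!: meas order_trans[OF bound abs_ge_self])
  ultimately show ?thesis
    by (simp add: has_bochner_integral_iff)
qed

text \<open>The second clause of \<open>class_I\<close> permits passing from \<open>u\<close> to a
  Borel representative.\<close>

lemma F_integral:
  assumes D: "D \<in> bounded_opens" and u: "u \<in> Lp p D"
  shows "has_bochner_integral (lebesgue_on D) (\<lambda>x. dens x (u x)) (F u D)"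
proof -
  have "u \<in> borel_measurable (lebesgue_on D)"
    using u by (simp add: Lp_def)
  then obtain v where v: "v \<in> borel_measurable borel" "AE x in lebesgue_on D. u x = v x"
    using lebesgue_on_ex_borel bounded_opensD(2)[OF D] by blast
  have vL: "v \<in> Lp p D"
  proof -
    have "integrable (lebesgue_on D) (\<lambda>x. norm (v x) powr p)"
      using u v(2) borel_measurable_lebesgue_on[of "\<lambda>x. norm (v x) powr p" D] v(1)
      by (subst integrable_cong_AE[of _ _ "\<lambda>x. norm (u x) powr p"]) (auto simp: Lp_def)
    then show ?thesis
      using borel_measurable_lebesgue_on[OF v(1)] by (simp add: Lp_def)
  qed
  have "has_bochner_integral (lebesgue_on D) (\<lambda>x. dens x (v x)) (F v D)"
    using F_borel[OF D v(1) vL] .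
  moreover have "F u D = F v D"
    using F_cong_AE[OF D u vL v(2)] .
  moreover have "(\<lambda>x. x) \<in> measurable (lebesgue_on D) borel"
    using borel_measurable_lebesgue_on[of "\<lambda>x::real^'n. x" D] by simp
  then have "(\<lambda>x. dens x (u x)) \<in> borel_measurable (lebesgue_on D)" "(\<lambda>x. dens x (v x)) \<in> borel_measurable (lebesgue_on D)"
    using u vL by (auto simp: Lp_def intro: measurable_dens_comp)
  ultimately show ?thesis
    using v(2) by (subst has_bochner_integral_cong_AE[of _ _ "\<lambda>x. dens x (v x)"]) auto
qed

end

section \<open>Periodic functions\<close>

lemma nn_integral_lborel_affine:
  fixes f :: "'a::euclidean_space \<Rightarrow> ennreal"
  assumes [measurable]: "f \<in> borel_measurable borel" and c: "c \<noteq> 0"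
  shows "(\<integral>\<^sup>+x. f x \<partial>lborel) = ennreal (\<bar>c\<bar> ^ DIM('a)) * (\<integral>\<^sup>+x. f (t + c *\<^sub>R x) \<partial>lborel)"
  by (subst lborel_affine[OF c, of t]) (simp add: nn_integral_density nn_integral_distr nn_integral_cmult)

lemma nn_integral_lborel_translation:
  fixes f :: "'a::euclidean_space \<Rightarrow> ennreal"
  assumes "f \<in> borel_measurable borel"
  shows "(\<integral>\<^sup>+x. f (t + x) \<partial>lborel) = (\<integral>\<^sup>+x. f x \<partial>lborel)"
  using nn_integral_lborel_affine[OF assms, of 1 t] by simp

lemma integral_lborel_affine:
  fixes f :: "'a::euclidean_space \<Rightarrow> real"
  assumes [measurable]: "f \<in> borel_measurable borel" and c: "c \<noteq> 0"
  shows "(LINT x|lborel. f x) = \<bar>c\<bar> ^ DIM('a) * (LINT x|lborel. f (t + c *\<^sub>R x))"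
  by (subst lborel_affine[OF c, of t]) (simp add: integral_density integral_distr)

section \<open>Lattice translations and period cells\<close>

definition periodic :: "real \<Rightarrow> (real^'n \<Rightarrow> 'b) \<Rightarrow> bool" where
  "periodic \<rho> w \<longleftrightarrow> (\<forall>x i. w (x + axis i \<rho>) = w x)"

definition lattice_vec :: "real \<Rightarrow> ('n \<Rightarrow> int) \<Rightarrow> real^'n" where
  "lattice_vec \<rho> k = (\<chi> i. \<rho> * of_int (k i))"

lemma periodic_lattice:
  assumes w: "periodic \<rho> w"
  shows "w (x + lattice_vec \<rho> k) = w x"
proof -
  have nat: "w (x + of_nat m *\<^sub>R axis i \<rho>) = w x" for m i x
  proof (induction m arbitrary: x)
    case (Suc m)
    have "w (x + of_nat (Suc m) *\<^sub>R axis i \<rho>) = w ((x + of_nat m *\<^sub>R axis i \<rho>) + axis i \<rho>)"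
      by (simp add: algebra_simps)
    then show ?case using w Suc by (simp add: periodic_def)
  qed simp
  have int: "w (x + of_int m *\<^sub>R axis i \<rho>) = w x" for m i x
  proof (cases "0 \<le> m")
    case True
    then show ?thesis using nat[of x "nat m" i] by simp
  next
    case False
    then show ?thesis using nat[of "x + of_int m *\<^sub>R axis i \<rho>" "nat (- m)" i] by simp
  qed
  have "w (x + (\<Sum>i\<in>I. of_int (k i) *\<^sub>R axis i \<rho>)) = w x" if "finite I" for I x
    using that
  proof (induction I arbitrary: x)
    case (insert j I)
    have "w (x + (\<Sum>i\<in>insert j I. of_int (k i) *\<^sub>R axis i \<rho>)) = w ((x + of_int (k j) *\<^sub>R axis j \<rho>) + (\<Sum>i\<in>I. of_int (k i) *\<^sub>R axis i \<rho>))"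
      using insert by (simp add: algebra_simps)
    then show ?case using insert int by simp
  qed simp
  moreover have "lattice_vec \<rho> k = (\<Sum>i\<in>UNIV. of_int (k i) *\<^sub>R axis i \<rho>)"
    by (simp add: lattice_vec_def vec_eq_iff axis_def if_distrib[of "\<lambda>x. _ * x"] mult.commute cong: if_cong)
  ultimately show ?thesis by simp
qed

text \<open>Half-open, so that the lattice translates cover every point exactly once.\<close>

definition half_open_cube :: "real \<Rightarrow> real^'n \<Rightarrow> (real^'n) set" where
  "half_open_cube \<rho> a = {y. \<forall>i. a $ i - \<rho> / 2 \<le> y $ i \<and> y $ i < a $ i + \<rho> / 2}"

lemma half_open_cube_borel [measurable]: "half_open_cube \<rho> a \<in> sets borel"
proof -
  have "half_open_cube \<rho> a = (\<Inter>i. {y. a $ i - \<rho> / 2 \<le> y $ i} \<inter> {y. y $ i < a $ i + \<rho> / 2})"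
    by (auto simp: half_open_cube_def)
  moreover have "{y. a $ i - \<rho> / 2 \<le> y $ i} \<inter> {y. y $ i < a $ i + \<rho> / 2} \<in> sets borel" for i
    by (intro sets.Int borel_closed borel_open closed_Collect_le open_Collect_less continuous_intros)
  ultimately show ?thesis by (simp add: sets.finite_INT)
qed

lemma tile_unique:
  assumes \<rho>: "0 < \<rho>"
  obtains k where "\<And>j. (y :: real^'n) - lattice_vec \<rho> j \<in> half_open_cube \<rho> a \<longleftrightarrow> j = k"
proof
  fix j :: "'n \<Rightarrow> int"
  \<comment> \<open>The summand \<open>1 / 2\<close> accounts for the centring of the cell at
    \<open>a\<close>: after it, the cell corresponds to an interval starting at 0, and
    \<open>floor\<close> counts the translates.\<close>
  let ?k = "\<lambda>i. \<lfloor>(y $ i - a $ i) / \<rho> + 1 / 2\<rfloor>"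
  have "a $ i - \<rho> / 2 \<le> y $ i - \<rho> * of_int m \<and> y $ i - \<rho> * of_int m < a $ i + \<rho> / 2
    \<longleftrightarrow> \<lfloor>(y $ i - a $ i) / \<rho> + 1 / 2\<rfloor> = m" for i m
    using \<rho> unfolding floor_eq_iff by (simp add: field_simps)
  then show "y - lattice_vec \<rho> j \<in> half_open_cube \<rho> a \<longleftrightarrow> j = ?k"
    by (auto simp: half_open_cube_def lattice_vec_def fun_eq_iff)
qed

text \<open>A partition of unity by translates of the cell, written as an integral over a counting
  measure so that it can be interchanged with the integral over space.\<close>

lemma nn_integral_tile:
  assumes "0 < \<rho>"
  shows "(\<integral>\<^sup>+j. indicator (half_open_cube \<rho> a) (y - lattice_vec \<rho> j) \<partial>count_space UNIV) = (1 :: ennreal)"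
proof -
  obtain k where k: "\<And>j. y - lattice_vec \<rho> j \<in> half_open_cube \<rho> a \<longleftrightarrow> j = k"
    using tile_unique[OF assms] by blast
  have "(\<lambda>j. indicator (half_open_cube \<rho> a) (y - lattice_vec \<rho> j) :: ennreal) = indicator {k}"
    using k by (auto simp: fun_eq_iff indicator_def)
  then show ?thesis by simp
qed

text \<open>The cell around \<open>b\<close> is cut by the translates of the cell around
  \<open>a\<close>. Moving each piece back by its lattice vector, which \<open>h\<close> does not
  notice, gives the cell around \<open>a\<close> cut by the translates of the one around
  \<open>b\<close>.\<close>

lemma nn_integral_half_open_cube_periodic:
  fixes h :: "real^'n \<Rightarrow> ennreal"
  assumes \<rho>: "0 < \<rho>" and h [measurable]: "h \<in> borel_measurable borel" and per: "periodic \<rho> h"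
  shows "(\<integral>\<^sup>+y\<in>half_open_cube \<rho> b. h y \<partial>lborel) = (\<integral>\<^sup>+y\<in>half_open_cube \<rho> a. h y \<partial>lborel)"
proof -
  let ?A = "half_open_cube \<rho> a" and ?B = "half_open_cube \<rho> b"
  have cnt: "countable (UNIV :: ('n \<Rightarrow> int) set)" by (rule countableI_type)
  have "(\<integral>\<^sup>+y\<in>?B. h y \<partial>lborel) = (\<integral>\<^sup>+y. \<integral>\<^sup>+j. h y * indicator ?B y * indicator ?A (y - lattice_vec \<rho> j) \<partial>count_space UNIV \<partial>lborel)"
    by (subst nn_integral_cmult) (simp_all add: nn_integral_tile[OF \<rho>])
  also have "\<dots> = (\<integral>\<^sup>+j. \<integral>\<^sup>+y. h y * indicator ?B y * indicator ?A (y - lattice_vec \<rho> j) \<partial>lborel \<partial>count_space UNIV)"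
    by (rule nn_integral_count_space_nn_integral[OF cnt]) measurable
  also have "\<dots> = (\<integral>\<^sup>+j. \<integral>\<^sup>+y. h y * indicator ?A y * indicator ?B (y - lattice_vec \<rho> (\<lambda>i. - j i)) \<partial>lborel \<partial>count_space UNIV)"
  proof (rule nn_integral_cong)
    fix j :: "'n \<Rightarrow> int"
    have neg: "lattice_vec \<rho> (\<lambda>i. - j i) = - lattice_vec \<rho> j"
      by (simp add: lattice_vec_def vec_eq_iff)
    have "(\<integral>\<^sup>+y. h y * indicator ?B y * indicator ?A (y - lattice_vec \<rho> j) \<partial>lborel) =
      (\<integral>\<^sup>+y. h (lattice_vec \<rho> j + y) * indicator ?B (lattice_vec \<rho> j + y) * indicator ?A ((lattice_vec \<rho> j + y) - lattice_vec \<rho> j) \<partial>lborel)"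
      by (subst nn_integral_lborel_translation[symmetric, where t = "lattice_vec \<rho> j"]) auto
    also have "\<dots> = (\<integral>\<^sup>+y. h y * indicator ?A y * indicator ?B (y - lattice_vec \<rho> (\<lambda>i. - j i)) \<partial>lborel)"
      using periodic_lattice[OF per, of _ j] by (simp add: neg add.commute mult_ac)
    finally show "(\<integral>\<^sup>+y. h y * indicator ?B y * indicator ?A (y - lattice_vec \<rho> j) \<partial>lborel) = \<dots>" .
  qed
  \<comment> \<open>Moving a piece by a lattice vector reverses the sign of the index; negation
    permutes all indices.\<close>
  also have "\<dots> = (\<integral>\<^sup>+j. \<integral>\<^sup>+y. h y * indicator ?A y * indicator ?B (y - lattice_vec \<rho> j) \<partial>lborel \<partial>count_space UNIV)"
  proof -
    have "bij (\<lambda>(j :: 'n \<Rightarrow> int) i. - j i)"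
      by (rule involuntory_imp_bij) simp
    then show ?thesis
      by (rule nn_integral_bij_count_space)
  qed
  also have "\<dots> = (\<integral>\<^sup>+y. \<integral>\<^sup>+j. h y * indicator ?A y * indicator ?B (y - lattice_vec \<rho> j) \<partial>count_space UNIV \<partial>lborel)"
    by (rule nn_integral_count_space_nn_integral[OF cnt, symmetric]) measurable
  also have "\<dots> = (\<integral>\<^sup>+y\<in>?A. h y \<partial>lborel)"
    by (subst nn_integral_cmult) (simp_all add: nn_integral_tile[OF \<rho>])
  finally show ?thesis .
qed

text \<open>The two cubes differ only on faces \<open>y $ i = a $ i - \<rho> / 2\<close>, which lie
  in hyperplanes.\<close>

lemma AE_half_open_cube_iff: "AE y in lborel. y \<in> half_open_cube \<rho> a \<longleftrightarrow> y \<in> cube \<rho> (a :: real^'n)"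
proof -
  have "AE y in lborel. \<forall>i. y $ i \<noteq> a $ i - \<rho> / 2"
  proof (subst AE_all_countable, rule allI)
    fix i
    have "{y. y $ i = a $ i - \<rho> / 2} \<in> null_sets lborel"
    proof -
      have "negligible {y :: real^'n. axis i 1 \<bullet> y = a $ i - \<rho> / 2}"
        by (rule negligible_hyperplane) (simp add: axis_eq_0_iff)
      then have "negligible {y :: real^'n. y $ i = a $ i - \<rho> / 2}"
        by (simp add: inner_axis')
      moreover have "closed {y :: real^'n. y $ i = a $ i - \<rho> / 2}"
        by (intro closed_Collect_eq continuous_intros)
      ultimately show ?thesis
        by (auto simp: negligible_iff_null_sets null_sets_def)
    qed
    then show "AE y in lborel. y $ i \<noteq> a $ i - \<rho> / 2"
      by (rule AE_I') auto
  qed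
  then show ?thesis
  proof (rule AE_mp, intro AE_I2 impI)
    fix y assume y: "\<forall>i. y $ i \<noteq> a $ i - \<rho> / 2"
    have "(a $ i - \<rho> / 2 \<le> y $ i \<and> y $ i < a $ i + \<rho> / 2) \<longleftrightarrow> \<bar>y $ i - a $ i\<bar> < \<rho> / 2" for i
      using y[rule_format, of i] unfolding abs_less_iff by (intro iffI conjI; elim conjE; linarith)
    then show "y \<in> half_open_cube \<rho> a \<longleftrightarrow> y \<in> cube \<rho> a"
      by (simp add: half_open_cube_def cube_def)
  qed
qed

lemma nn_integral_cube_periodic:
  fixes h :: "real^'n \<Rightarrow> ennreal"
  assumes \<rho>: "0 < \<rho>" and h: "h \<in> borel_measurable borel" and per: "periodic \<rho> h"
  shows "(\<integral>\<^sup>+y\<in>cube \<rho> b. h y \<partial>lborel) = (\<integral>\<^sup>+y\<in>cube \<rho> a. h y \<partial>lborel)"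
proof -
  have "(\<integral>\<^sup>+y\<in>cube \<rho> c. h y \<partial>lborel) = (\<integral>\<^sup>+y\<in>half_open_cube \<rho> c. h y \<partial>lborel)" for c
    using AE_half_open_cube_iff[of \<rho> c] by (intro nn_integral_cong_AE) (auto split: split_indicator)
  then show ?thesis
    using nn_integral_half_open_cube_periodic[OF assms, of b a] by simp
qed

text \<open>Translating the variable moves the cell to the centre \<open>y + z\<close>, and
  periodicity moves it back.\<close>

lemma nn_integral_cube_shift:
  fixes h :: "real^'n \<Rightarrow> ennreal"
  assumes \<rho>: "0 < \<rho>" and h [measurable]: "h \<in> borel_measurable borel" and per: "periodic \<rho> h"
  shows "(\<integral>\<^sup>+s\<in>cube \<rho> z. h (y + s) \<partial>lborel) = (\<integral>\<^sup>+s\<in>cube \<rho> z. h s \<partial>lborel)"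
proof -
  have "(\<integral>\<^sup>+s\<in>cube \<rho> z. h (y + s) \<partial>lborel) = (\<integral>\<^sup>+s. h (y + s) * indicator (cube \<rho> (y + z)) (y + s) \<partial>lborel)"
    by (intro nn_integral_cong) (auto simp: cube_def split: split_indicator)
  also have "\<dots> = (\<integral>\<^sup>+s\<in>cube \<rho> (y + z). h s \<partial>lborel)"
    by (subst nn_integral_lborel_translation[symmetric, where t = y]) auto
  finally show ?thesis
    using nn_integral_cube_periodic[OF assms] by simp
qed

lemma integrable_cube_bounded:
  fixes g :: "real^'n \<Rightarrow> real"
  assumes [measurable]: "g \<in> borel_measurable borel" and bound: "\<And>x. \<bar>g x\<bar> \<le> B"
  shows "integrable lborel (\<lambda>x. indicator (cube \<rho> z) x * g x)"
proof (rule Bochner_Integration.integrable_bound)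
  show "integrable lborel (\<lambda>x. B * indicator (cube \<rho> z) x)"
    using emeasure_bounded_finite[OF bounded_cube, of \<rho> z] by (intro integrable_mult_right integrable_real_indicator) auto
  show "AE x in lborel. norm (indicator (cube \<rho> z) x * g x) \<le> norm (B * indicator (cube \<rho> z) x)"
    using bound order_trans[OF bound abs_ge_self] by (auto split: split_indicator)
qed measurable

text \<open>Adding the bound \<open>B\<close> makes the integrand nonnegative, so the result for
  nonnegative integrals applies; the integral of \<open>B\<close> then cancels.\<close>

lemma integral_cube_shift:
  fixes g :: "real^'n \<Rightarrow> real"
  assumes \<rho>: "0 < \<rho>" and g [measurable]: "g \<in> borel_measurable borel" and per: "periodic \<rho> g"
    and bound: "\<And>x. \<bar>g x\<bar> \<le> B"
  shows "(LINT s|lborel. indicator (cube \<rho> z) s * g (y + s)) = (LINT s|lborel. indicator (cube \<rho> z) s * g s)"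
proof -
  let ?I = "\<lambda>f. (LINT s|lborel. indicator (cube \<rho> z) s * f s)"
  have nn: "?I (\<lambda>s. f s + B) = enn2real (\<integral>\<^sup>+s\<in>cube \<rho> z. ennreal (f s + B) \<partial>lborel)"
    if [measurable]: "f \<in> borel_measurable borel" and "\<And>s. \<bar>f s\<bar> \<le> B" for f :: "real^'n \<Rightarrow> real"
  proof -
    have "0 \<le> f s + B" for s using that(2)[of s] by linarith
    then have "?I (\<lambda>s. f s + B) = enn2real (\<integral>\<^sup>+s. ennreal (indicator (cube \<rho> z) s * (f s + B)) \<partial>lborel)"
      by (intro integral_eq_nn_integral) auto
    also have "(\<integral>\<^sup>+s. ennreal (indicator (cube \<rho> z) s * (f s + B)) \<partial>lborel) = (\<integral>\<^sup>+s\<in>cube \<rho> z. ennreal (f s + B) \<partial>lborel)"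
      by (intro nn_integral_cong) (auto split: split_indicator)
    finally show ?thesis .
  qed
  have split: "?I (\<lambda>s. f s + B) = ?I f + ?I (\<lambda>_. B)"
    if "f \<in> borel_measurable borel" "\<And>s. \<bar>f s\<bar> \<le> B" for f :: "real^'n \<Rightarrow> real"
    unfolding distrib_left using integrable_cube_bounded[OF that] integrable_cube_bounded[of "\<lambda>_. B" "\<bar>B\<bar>"]
    by (intro Bochner_Integration.integral_add) auto
  have "periodic \<rho> (\<lambda>s. ennreal (g s + B))"
    using per by (simp add: periodic_def)
  then have "?I (\<lambda>s. g (y + s) + B) = ?I (\<lambda>s. g s + B)"
    using nn_integral_cube_shift[OF \<rho>, of "\<lambda>s. ennreal (g s + B)" y z] bound
    by (subst (1 2) nn) auto
  then show ?thesis
    using split[of "\<lambda>s. g (y + s)"] split[of g] bound by simp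
qed

section \<open>Oscillating functions in the weak norm\<close>

lemma smooth_continuous: "smooth f \<Longrightarrow> continuous_on UNIV f"
  using Ck.simps(1)[of f] unfolding smooth_def by blast

lemma smooth_differentiable: "smooth f \<Longrightarrow> f differentiable (at x)"
  using Ck.simps(2)[of 0 f] unfolding smooth_def by blast

lemma smooth_partial_continuous:
  "smooth f \<Longrightarrow> continuous_on UNIV (\<lambda>x. frechet_derivative f (at x) (axis i 1))"
  using Ck.simps(2)[of 0 f] unfolding smooth_def Ck.simps(1) by blast

lemma smooth_has_derivative:
  "smooth \<phi> \<Longrightarrow> (\<phi> has_derivative (\<lambda>h. grad \<phi> x *v h)) (at x)"
  unfolding grad_def using jacobian_works smooth_differentiable by blast

lemma smooth_grad_continuous:
  fixes \<phi> :: "real^'n \<Rightarrow> real^'m"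
  assumes "smooth \<phi>"
  shows "continuous_on UNIV (grad \<phi>)"
proof -
  have "grad \<phi> = (\<lambda>x. \<chi> i j. frechet_derivative \<phi> (at x) (axis j 1) $ i)"
    by (simp add: fun_eq_iff grad_def jacobian_def matrix_def)
  then show ?thesis
    by (simp only:) (intro continuous_on_vec_lambda continuous_on_component smooth_partial_continuous assms)
qed

lemma norm_matrix_vector_le: "norm (M *v h) \<le> norm (M :: real^'n^'m) * norm h"
proof -
  have "norm (M *v h) = L2_set (\<lambda>i. norm ((M *v h) $ i)) UNIV"
    by (simp add: norm_vec_def)
  also have "\<dots> \<le> L2_set (\<lambda>i. norm (M $ i) * norm h) UNIV"
    by (intro L2_set_mono) (simp_all add: matrix_vector_mul_component Cauchy_Schwarz_ineq2)
  also have "\<dots> = norm M * norm h"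
    by (simp add: L2_set_left_distrib norm_vec_def)
  finally show ?thesis .
qed

lemma norm_column_le: "norm (column i M) \<le> norm (M :: real^'n^'m)"
  using norm_matrix_vector_le[of M "axis i 1"] by (simp add: matrix_vector_mult_basis)

lemma test_function_support:
  assumes "\<phi> \<in> test_functions D"
  obtains K where "compact K" "K \<subseteq> D" "\<And>x. x \<notin> K \<Longrightarrow> \<phi> x = 0" "\<And>x. x \<notin> K \<Longrightarrow> grad \<phi> x = 0"
proof -
  obtain K where K: "compact K" "K \<subseteq> D" "\<And>x. x \<notin> K \<Longrightarrow> \<phi> x = 0"
    using assms unfolding test_functions_def by blast
  have "grad \<phi> x = 0" if x: "x \<notin> K" for x
  proof -
    have "open (- K)" using K(1) by (simp add: compact_imp_closed open_Compl)
    then have "(\<phi> has_derivative (\<lambda>_. 0)) (at x)"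
      using K(3) x by (intro has_derivative_transform_within_open[of "\<lambda>_. 0" "\<lambda>_. 0" x UNIV "- K" \<phi>]) auto
    then have "frechet_derivative \<phi> (at x) = (\<lambda>_. 0)"
      by (rule frechet_derivative_at[symmetric])
    then show ?thesis
      by (simp add: grad_def jacobian_def matrix_def vec_eq_iff)
  qed
  then show thesis using that K by blast
qed

lemma test_function_smooth: "\<phi> \<in> test_functions D \<Longrightarrow> smooth \<phi>"
  by (simp add: test_functions_def)

lemma integrable_compact_support:
  fixes g :: "'a::euclidean_space \<Rightarrow> 'b::{banach, second_countable_topology}"
  assumes "continuous_on UNIV g" "compact K" "\<And>x. x \<notin> K \<Longrightarrow> g x = 0"
  shows "integrable lborel g"
proof -
  have "integrable lborel (\<lambda>x. indicator K x *\<^sub>R g x)"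
    by (rule borel_integrable_compact[OF assms(2) continuous_on_subset[OF assms(1) subset_UNIV]])
  moreover have "(\<lambda>x. indicator K x *\<^sub>R g x) = g"
    using assms(3) by (auto simp: fun_eq_iff indicator_def)
  ultimately show ?thesis by simp
qed

text \<open>The difference is the integral of \<open>grad \<psi>\<close> along the segment from
  \<open>x - h\<close> to \<open>x\<close>. After exchanging the integrals, each \<open>t\<close>
  contributes a translate of \<open>grad \<psi>\<close>, whose L1 norm does not depend on
  \<open>t\<close>.\<close>

lemma translation_estimate:
  fixes \<psi> :: "real^'n \<Rightarrow> real^'m"
  assumes \<psi>: "smooth \<psi>"
  shows "(\<integral>\<^sup>+x. ennreal (norm (\<psi> x - \<psi> (x - h))) \<partial>lborel) \<le> ennreal (norm h) * (\<integral>\<^sup>+x. ennreal (norm (grad \<psi> x)) \<partial>lborel)"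
proof -
  have gc: "continuous_on UNIV (grad \<psi>)" by (rule smooth_grad_continuous[OF \<psi>])
  have gm [measurable]: "grad \<psi> \<in> borel_measurable borel"
    using gc by (rule borel_measurable_continuous_onI)
  have pt: "ennreal (norm (\<psi> x - \<psi> (x - h))) \<le> (\<integral>\<^sup>+t\<in>{0..1}. ennreal (norm (grad \<psi> (x - h + t *\<^sub>R h)) * norm h) \<partial>lborel)" for x
  proof -
    let ?f' = "\<lambda>t. grad \<psi> (x - h + t *\<^sub>R h) *v h"
    let ?n = "\<lambda>t. norm (grad \<psi> (x - h + t *\<^sub>R h)) * norm h"
    have gcx: "continuous_on {0..1} (\<lambda>t::real. grad \<psi> (x - h + t *\<^sub>R h))"
      by (intro continuous_on_compose2[OF gc] continuous_intros) auto
    have nc: "continuous_on {0..1} ?n"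
      by (intro continuous_intros gcx)
    have "(?f' has_integral \<psi> (x - h + 1 *\<^sub>R h) - \<psi> (x - h + 0 *\<^sub>R h)) {0..1}"
    proof (rule fundamental_theorem_of_calculus)
      fix t :: real
      have "((\<lambda>t. \<psi> (x - h + t *\<^sub>R h)) has_derivative (\<lambda>s. grad \<psi> (x - h + t *\<^sub>R h) *v (s *\<^sub>R h))) (at t within {0..1})"
        by (rule has_derivative_compose[OF _ smooth_has_derivative[OF \<psi>], of "\<lambda>t. x - h + t *\<^sub>R h"])
           (auto intro!: derivative_eq_intros)
      then show "((\<lambda>t. \<psi> (x - h + t *\<^sub>R h)) has_vector_derivative ?f' t) (at t within {0..1})"
        by (simp add: has_vector_derivative_def matrix_vector_mult_scaleR)
    qed simp
    then have int: "(?f' has_integral \<psi> x - \<psi> (x - h)) {0..1}" by simp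
    have "norm (\<psi> x - \<psi> (x - h)) \<le> integral {0..1} ?n"
      using integral_norm_bound_integral[of ?f' "{0..1}" ?n] int integrable_continuous_real[OF nc]
        integral_unique[OF int] norm_matrix_vector_le
      by (auto simp: has_integral_integrable)
    also have "\<dots> = (LINT t:{0..1}|lborel. ?n t)"
      using borel_integrable_atLeastAtMost'[OF nc] by (intro set_borel_integral_eq_integral(2)[symmetric])
    finally have "ennreal (norm (\<psi> x - \<psi> (x - h))) \<le> ennreal (LINT t:{0..1}|lborel. ?n t)"
      by (rule ennreal_leI)
    also have "\<dots> = (\<integral>\<^sup>+t. ennreal (indicator {0..1} t * ?n t) \<partial>lborel)"
      using borel_integrable_atLeastAtMost'[OF nc] unfolding set_lebesgue_integral_def set_integrable_def real_scaleR_def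
      by (intro nn_integral_eq_integral[symmetric]) auto
    also have "\<dots> = (\<integral>\<^sup>+t\<in>{0..1}. ennreal (?n t) \<partial>lborel)"
      by (intro nn_integral_cong) (auto split: split_indicator)
    finally show ?thesis .
  qed
  have "(\<integral>\<^sup>+x. ennreal (norm (\<psi> x - \<psi> (x - h))) \<partial>lborel)
     \<le> (\<integral>\<^sup>+x. \<integral>\<^sup>+t. ennreal (norm (grad \<psi> (x - h + t *\<^sub>R h)) * norm h) * indicator {0..1::real} t \<partial>lborel \<partial>lborel)"
    by (intro nn_integral_mono pt)
  also have "\<dots> = (\<integral>\<^sup>+t. \<integral>\<^sup>+x. ennreal (norm (grad \<psi> (x - h + t *\<^sub>R h)) * norm h) * indicator {0..1::real} t \<partial>lborel \<partial>lborel)"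
    by (rule lborel_pair.Fubini'[symmetric]) measurable
  also have "\<dots> = (\<integral>\<^sup>+t\<in>{0..1::real}. ennreal (norm h) * (\<integral>\<^sup>+x. ennreal (norm (grad \<psi> x)) \<partial>lborel) \<partial>lborel)"
  proof (intro nn_integral_cong)
    fix t :: real
    have "(\<integral>\<^sup>+x. ennreal (norm (grad \<psi> (x - h + t *\<^sub>R h)) * norm h) * indicator {0..1::real} t \<partial>lborel)
      = ennreal (norm h) * (\<integral>\<^sup>+x. ennreal (norm (grad \<psi> ((t *\<^sub>R h - h) + x))) \<partial>lborel) * indicator {0..1} t"
      by (simp add: ennreal_mult'' nn_integral_multc nn_integral_cmult mult.commute algebra_simps)
    also have "(\<integral>\<^sup>+x. ennreal (norm (grad \<psi> ((t *\<^sub>R h - h) + x))) \<partial>lborel) = (\<integral>\<^sup>+x. ennreal (norm (grad \<psi> x)) \<partial>lborel)"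
      by (rule nn_integral_lborel_translation) measurable
    finally show "(\<integral>\<^sup>+x. ennreal (norm (grad \<psi> (x - h + t *\<^sub>R h)) * norm h) * indicator {0..1::real} t \<partial>lborel)
      = ennreal (norm h) * (\<integral>\<^sup>+x. ennreal (norm (grad \<psi> x)) \<partial>lborel) * indicator {0..1} t" .
  qed
  also have "\<dots> = ennreal (norm h) * (\<integral>\<^sup>+x. ennreal (norm (grad \<psi> x)) \<partial>lborel)"
    by (subst nn_integral_cmult) auto
  finally show ?thesis .
qed

text \<open>The average over \<open>s\<close> in a period cell of the integrals of \<open>w (n x + s0 + s) \<bullet> \<psi> x\<close> vanishes. Moving the
  shift \<open>s\<close> onto \<open>\<psi>\<close>, each of them differs from the integral for \<open>s = 0\<close> only by a translation of \<open>\<psi>\<close>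
  by \<open>s / n\<close>.\<close>

lemma oscillation_estimate:
  fixes w \<psi> :: "real^'n \<Rightarrow> real^'m"
  assumes \<rho>: "0 < \<rho>" and w [measurable]: "w \<in> borel_measurable borel" and per: "periodic \<rho> w"
    and bound: "\<And>x. norm (w x) \<le> B"
    and mean: "\<And>v. (LINT s|lborel. indicator (cube \<rho> z) s * (w s \<bullet> v)) = 0"
    and R: "cube \<rho> z \<subseteq> cball 0 R" and n: "0 < n" and \<psi>: "\<psi> \<in> test_functions D"
  shows "\<bar>LINT x|lborel. w (n *\<^sub>R x + s0) \<bullet> \<psi> x\<bar> \<le> B * (R / n) * (LINT x|lborel. norm (grad \<psi> x))"
proof -
  let ?C = "cube \<rho> z"
  \<comment> \<open>\<open>V\<close> absorbs the phase \<open>s0\<close>: its bound is that of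
    \<open>w\<close>, and periodicity keeps all its cell averages zero, so the estimate cannot
    depend on \<open>s0\<close>.\<close>
  define V where "V y = w (y + s0)" for y
  have V [measurable]: "V \<in> borel_measurable borel" unfolding V_def by measurable
  have VB: "norm (V y) \<le> B" for y unfolding V_def by (rule bound)
  have B0: "0 \<le> B" using bound[of 0] norm_ge_zero[of "w 0"] by linarith
  have "norm z \<le> R" using subsetD[OF R center_in_cube[OF \<rho>]] by simp
  then have R0: "0 \<le> R" by (rule order_trans[OF norm_ge_zero])
  have VBi: "\<bar>V y \<bullet> v\<bar> \<le> B * norm v" for y v
    using order_trans[OF Cauchy_Schwarz_ineq2 mult_right_mono[OF VB]] by simp
  have meanV: "(LINT s|lborel. indicator ?C s * (V (y + s) \<bullet> v)) = 0" for y v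
  proof -
    have "(LINT s|lborel. indicator ?C s * (w ((y + s0) + s) \<bullet> v)) = (LINT s|lborel. indicator ?C s * (w s \<bullet> v))"
    proof (rule integral_cube_shift[OF \<rho>, where g = "\<lambda>s. w s \<bullet> v" and B = "B * norm v"])
      show "\<bar>w x \<bullet> v\<bar> \<le> B * norm v" for x
        using order_trans[OF Cauchy_Schwarz_ineq2 mult_right_mono[OF bound]] by simp
    qed (use per in \<open>auto simp: periodic_def\<close>)
    then show ?thesis by (simp add: V_def mean add_ac)
  qed
  have sm: "smooth \<psi>" using \<psi> by (rule test_function_smooth)
  obtain K where K: "compact K" "\<And>x. x \<notin> K \<Longrightarrow> \<psi> x = 0" "\<And>x. x \<notin> K \<Longrightarrow> grad \<psi> x = 0"
    using test_function_support[OF \<psi>] by metis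
  have \<psi>c: "continuous_on UNIV \<psi>" by (rule smooth_continuous[OF sm])
  have \<psi>m [measurable]: "\<psi> \<in> borel_measurable borel" using \<psi>c by (rule borel_measurable_continuous_onI)
  have int\<psi>: "integrable lborel \<psi>" using \<psi>c K(1,2) by (rule integrable_compact_support)
  have intg: "integrable lborel (grad \<psi>)"
    using smooth_grad_continuous[OF sm] K(1,3) by (rule integrable_compact_support)
  define Gr where "Gr = (LINT x|lborel. norm (grad \<psi> x))"
  have Gr: "(\<integral>\<^sup>+x. ennreal (norm (grad \<psi> x)) \<partial>lborel) = ennreal Gr"
    unfolding Gr_def using intg by (intro nn_integral_eq_integral) auto
  have Gr0: "0 \<le> Gr" unfolding Gr_def by (intro Bochner_Integration.integral_nonneg) simp
  have intV: "integrable lborel (\<lambda>x. V (n *\<^sub>R x + s) \<bullet> \<psi> x)" for s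
    by (rule Bochner_Integration.integrable_bound[of _ "\<lambda>x. B *\<^sub>R norm (\<psi> x)"])
       (use int\<psi> VBi B0 in \<open>auto intro!: order_trans[OF VBi]\<close>)
  define I where "I = (LINT x|lborel. V (n *\<^sub>R x) \<bullet> \<psi> x)"
  define J where "J s = (LINT x|lborel. V (n *\<^sub>R x + s) \<bullet> \<psi> x)" for s
  have IJ: "\<bar>I - J s\<bar> \<le> B * (R / n) * Gr" if s: "s \<in> ?C" for s
  proof -
    let ?h = "(1 / n) *\<^sub>R s"
    \<comment> \<open>Replacing \<open>x\<close> by \<open>x - ?h\<close> cancels \<open>s\<close>
      in the argument of \<open>V\<close>, since \<open>n *\<^sub>R ?h = s\<close>.\<close>
    have "J s = (LINT x|lborel. V (n *\<^sub>R (- ?h + 1 *\<^sub>R x) + s) \<bullet> \<psi> (- ?h + 1 *\<^sub>R x))"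
      unfolding J_def by (subst integral_lborel_affine[of _ 1 "- ?h"]) auto
    then have Js: "J s = (LINT x|lborel. V (n *\<^sub>R x) \<bullet> \<psi> (x - ?h))"
      using n by (simp add: scaleR_diff_right algebra_simps)
    have int\<psi>': "integrable lborel (\<lambda>x. \<psi> (x - ?h))"
    proof (rule integrable_compact_support)
      show "continuous_on UNIV (\<lambda>x. \<psi> (x - ?h))"
        by (intro continuous_on_compose2[OF \<psi>c] continuous_intros) auto
      show "compact ((\<lambda>x. ?h + x) ` K)" using K(1) by (rule compact_translation)
      show "\<psi> (x - ?h) = 0" if "x \<notin> (\<lambda>x. ?h + x) ` K" for x
      proof -
        have "x - ?h \<notin> K"
        proof
          assume "x - ?h \<in> K"
          then have "?h + (x - ?h) \<in> (\<lambda>x. ?h + x) ` K" by blast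
          then show False using that by simp
        qed
        then show ?thesis by (rule K(2))
      qed
    qed
    have int2: "integrable lborel (\<lambda>x. V (n *\<^sub>R x) \<bullet> \<psi> (x - ?h))"
      by (rule Bochner_Integration.integrable_bound[of _ "\<lambda>x. B *\<^sub>R norm (\<psi> (x - ?h))"])
         (use int\<psi>' B0 in \<open>auto intro!: order_trans[OF VBi]\<close>)
    have "I - J s = (LINT x|lborel. V (n *\<^sub>R x) \<bullet> (\<psi> x - \<psi> (x - ?h)))"
      unfolding I_def Js inner_diff_right using intV[of 0] int2
      by (intro Bochner_Integration.integral_diff[symmetric]) auto
    then have "\<bar>I - J s\<bar> \<le> (LINT x|lborel. norm (V (n *\<^sub>R x) \<bullet> (\<psi> x - \<psi> (x - ?h))))"
      by (simp only: real_norm_def[symmetric] integral_norm_bound)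
    also have "\<dots> \<le> (LINT x|lborel. B * norm (\<psi> x - \<psi> (x - ?h)))"
    proof (rule Bochner_Integration.integral_mono)
      have "integrable lborel (\<lambda>x. V (n *\<^sub>R x) \<bullet> (\<psi> x - \<psi> (x - ?h)))"
        unfolding inner_diff_right using intV[of 0] int2 by (intro Bochner_Integration.integrable_diff) auto
      then show "integrable lborel (\<lambda>x. norm (V (n *\<^sub>R x) \<bullet> (\<psi> x - \<psi> (x - ?h))))"
        by (rule integrable_norm)
      show "integrable lborel (\<lambda>x. B * norm (\<psi> x - \<psi> (x - ?h)))"
        by (intro integrable_mult_right integrable_norm Bochner_Integration.integrable_diff int\<psi> int\<psi>')
    qed (use VBi in simp)
    also have "\<dots> = B * (LINT x|lborel. norm (\<psi> x - \<psi> (x - ?h)))" by simp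
    also have "\<dots> \<le> B * (norm ?h * Gr)"
    proof (rule mult_left_mono[OF _ B0])
      have "ennreal (LINT x|lborel. norm (\<psi> x - \<psi> (x - ?h))) = (\<integral>\<^sup>+x. ennreal (norm (\<psi> x - \<psi> (x - ?h))) \<partial>lborel)"
        using int\<psi> int\<psi>' by (intro nn_integral_eq_integral[symmetric]) auto
      also have "\<dots> \<le> ennreal (norm ?h) * ennreal Gr"
        unfolding Gr[symmetric] by (rule translation_estimate[OF sm])
      also have "\<dots> = ennreal (norm ?h * Gr)"
        by (rule ennreal_mult[symmetric]) (use Gr0 in auto)
      finally show "(LINT x|lborel. norm (\<psi> x - \<psi> (x - ?h))) \<le> norm ?h * Gr"
        using Gr0 by (subst (asm) ennreal_le_iff) auto
    qed
    also have "\<dots> \<le> B * (R / n * Gr)"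
    proof (intro mult_left_mono mult_right_mono B0 Gr0)
      have "norm s \<le> R" using s R by auto
      then show "norm ?h \<le> R / n" using n by (simp add: divide_right_mono)
    qed
    finally show ?thesis by (simp add: mult.assoc)
  qed
  \<comment> \<open>The cut-off to the cell makes \<open>f\<close> integrable on the product.
    Integrating in \<open>s\<close> first gives 0 for every \<open>x\<close> by
    \<open>meanV\<close>; in the other order this says that the integral of \<open>J\<close> over
    the cell vanishes.\<close>
  define f where "f = (\<lambda>(s, x). indicator ?C s * (V (n *\<^sub>R x + s) \<bullet> \<psi> x))"
  have fm [measurable]: "f \<in> borel_measurable (lborel \<Otimes>\<^sub>M lborel)"
    unfolding f_def by measurable
  have intC: "integrable lborel (\<lambda>s. c * indicator ?C s :: real)" for c
    using emeasure_bounded_finite[OF bounded_cube, of \<rho> z] by (intro integrable_mult_right integrable_real_indicator) auto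
  have intf: "integrable (lborel \<Otimes>\<^sub>M lborel) f"
  proof (rule lborel_pair.Fubini_integrable[OF fm])
    show "integrable lborel (\<lambda>s. LINT x|lborel. norm (f (s, x)))"
    proof (rule Bochner_Integration.integrable_bound[OF intC[of "B * (LINT x|lborel. norm (\<psi> x))"]])
      show "AE s in lborel. norm (LINT x|lborel. norm (f (s, x))) \<le> norm ((B * (LINT x|lborel. norm (\<psi> x))) * indicator ?C s)"
      proof (rule AE_I2)
        fix s
        have "(LINT x|lborel. norm (f (s, x))) \<le> (LINT x|lborel. (indicator ?C s * B) * norm (\<psi> x))"
          using int\<psi> intV[of s] VBi unfolding f_def
          by (intro Bochner_Integration.integral_mono) (auto split: split_indicator)
        then show "norm (LINT x|lborel. norm (f (s, x))) \<le> norm ((B * (LINT x|lborel. norm (\<psi> x))) * indicator ?C s)"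
          by (simp add: abs_mult B0 mult_ac)
      qed
    qed measurable
    show "AE s in lborel. integrable lborel (\<lambda>x. f (s, x))"
      unfolding f_def using intV by auto
  qed
  have "(LINT s|lborel. LINT x|lborel. f (s, x)) = (LINT x|lborel. LINT s|lborel. f (s, x))"
    using lborel_pair.Fubini_integral[of "\<lambda>s x. f (s, x)"] intf by simp
  also have "\<dots> = 0"
  proof -
    have "(LINT s|lborel. f (s, x)) = 0" for x
      unfolding f_def prod.case by (rule meanV)
    then show ?thesis by simp
  qed
  finally have J0: "(LINT s|lborel. indicator ?C s * J s) = 0"
    by (simp add: f_def J_def)
  have intJ: "integrable lborel (\<lambda>s. indicator ?C s * J s)"
    using lborel_pair.integrable_fst'[OF intf] by (simp add: f_def J_def)
  \<comment> \<open>The volume of the cell times \<open>I\<close>; subtracting the vanishing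
    integral of \<open>J\<close> leaves the integral of \<open>I - J s\<close> over the cell, and
    \<open>IJ\<close> bounds this integrand.\<close>
  have "\<rho> ^ CARD('n) * I = (LINT s|lborel. I * indicator ?C s)"
    using \<rho> by (simp add: measure_lborel_cube)
  also have "\<dots> = (LINT s|lborel. I * indicator ?C s) - (LINT s|lborel. indicator ?C s * J s)"
    by (simp add: J0)
  also have "\<dots> = (LINT s|lborel. I * indicator ?C s - indicator ?C s * J s)"
    by (intro Bochner_Integration.integral_diff[symmetric] intC intJ)
  finally have "\<bar>\<rho> ^ CARD('n) * I\<bar> \<le> (LINT s|lborel. norm (I * indicator ?C s - indicator ?C s * J s))"
    by (simp only: real_norm_def[symmetric] integral_norm_bound)
  also have "\<dots> \<le> (LINT s|lborel. B * (R / n) * Gr * indicator ?C s)"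
    using IJ by (intro Bochner_Integration.integral_mono integrable_norm Bochner_Integration.integrable_diff intC intJ)
      (auto split: split_indicator)
  also have "\<dots> = \<rho> ^ CARD('n) * (B * (R / n) * Gr)"
    using \<rho> by (simp add: measure_lborel_cube)
  finally have "\<rho> ^ CARD('n) * \<bar>I\<bar> \<le> \<rho> ^ CARD('n) * (B * (R / n) * Gr)"
    using \<rho> by (simp add: abs_mult)
  then have "\<bar>I\<bar> \<le> B * (R / n) * Gr"
    by (rule mult_left_le_imp_le) (use \<rho> in simp)
  then show ?thesis
    by (simp add: I_def V_def Gr_def)
qed

section \<open>L1 convergence from Lp convergence, and approximation of Sobolev pairs\<close>

lemma Lp_diff:
  assumes u: "u \<in> Lp q D" and v: "v \<in> Lp q D" and q: "0 < q"
  shows "(\<lambda>x. u x - v x) \<in> Lp q D"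
proof -
  have [measurable]: "u \<in> borel_measurable (lebesgue_on D)" "v \<in> borel_measurable (lebesgue_on D)"
    using u v by (simp_all add: Lp_def)
  have "integrable (lebesgue_on D) (\<lambda>x. norm (u x - v x) powr q)"
  proof (rule Bochner_Integration.integrable_bound)
    show "integrable (lebesgue_on D) (\<lambda>x. 2 powr q * (norm (u x) powr q + norm (v x) powr q))"
      using u v by (intro integrable_mult_right Bochner_Integration.integrable_add) (simp_all add: Lp_def)
    show "AE x in lebesgue_on D. norm (norm (u x - v x) powr q) \<le> norm (2 powr q * (norm (u x) powr q + norm (v x) powr q))"
    proof (rule AE_I2)
      fix x
      have "norm (u x - v x) \<le> 2 * max (norm (u x)) (norm (v x))"
        using norm_triangle_ineq4[of "u x" "v x"] by linarith
      then have "norm (u x - v x) powr q \<le> (2 * max (norm (u x)) (norm (v x))) powr q"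
        using q by (intro powr_mono2) auto
      also have "\<dots> \<le> 2 powr q * (norm (u x) powr q + norm (v x) powr q)"
        by (auto simp: powr_mult max_def)
      finally show "norm (norm (u x - v x) powr q) \<le> norm (2 powr q * (norm (u x) powr q + norm (v x) powr q))"
        by simp
    qed
  qed measurable
  then show ?thesis by (simp add: Lp_def)
qed

text \<open>A substitute for Hoelder's inequality on domains of finite measure.\<close>

lemma le_add_powr:
  fixes t \<epsilon> q :: real
  assumes "0 \<le> t" "0 < \<epsilon>" "1 < q"
  shows "t \<le> \<epsilon> + \<epsilon> powr (1 - q) * t powr q"
proof (cases "t \<le> \<epsilon>")
  case False
  then have "t powr (1 - q) \<le> \<epsilon> powr (1 - q)"
    using assms by (intro powr_mono2') auto
  then have "t powr (1 - q) * t powr q \<le> \<epsilon> powr (1 - q) * t powr q"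
    by (rule mult_right_mono) simp
  moreover have "t powr (1 - q) * t powr q = t"
    using False assms by (simp add: powr_add[symmetric])
  ultimately show ?thesis using assms by linarith
qed (simp add: add_increasing2)

text \<open>The parameter \<open>\<epsilon>\<close> is left free: a small value makes the first term
  negligible when \<open>Lp_norm\<close> tends to 0, while the value 1 gives the crude bound used
  for pairs with gradient norm at most 1.\<close>

lemma
  fixes g :: "real^'n \<Rightarrow> 'b::euclidean_space"
  assumes D: "D \<in> bounded_opens" and g: "g \<in> Lp q D" and q: "1 < q"
  shows Lp_integrable: "integrable (lebesgue_on D) g"
    and L1_le_Lp: "0 < \<epsilon> \<Longrightarrow> (LINT x|lebesgue_on D. norm (g x)) \<le> \<epsilon> * measure lebesgue D + \<epsilon> powr (1 - q) * Lp_norm q D g powr q"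
proof -
  interpret finite_measure "lebesgue_on D"
    using D by (intro finite_measure_lebesgue_on bounded_opensD)
  have gm [measurable]: "g \<in> borel_measurable (lebesgue_on D)" using g by (simp add: Lp_def)
  have int: "integrable (lebesgue_on D) (\<lambda>x. \<epsilon> + \<epsilon> powr (1 - q) * norm (g x) powr q)" for \<epsilon>
    using g by (intro Bochner_Integration.integrable_add integrable_mult_right) (simp_all add: Lp_def)
  have "integrable (lebesgue_on D) (\<lambda>x. norm (g x))"
  proof (rule Bochner_Integration.integrable_bound[OF int[of 1]])
    show "AE x in lebesgue_on D. norm (norm (g x)) \<le> norm (1 + 1 powr (1 - q) * norm (g x) powr q)"
      using le_add_powr[of "norm (g _)" 1 q] q by (auto intro!: order_trans[OF _ abs_ge_self])
  qed measurable
  then show 1: "integrable (lebesgue_on D) g"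
    using gm by (rule integrable_norm_cancel)
  assume \<epsilon>: "0 < \<epsilon>"
  have "(LINT x|lebesgue_on D. norm (g x)) \<le> (LINT x|lebesgue_on D. \<epsilon> + \<epsilon> powr (1 - q) * norm (g x) powr q)"
    using \<epsilon> q by (intro Bochner_Integration.integral_mono integrable_norm 1 int le_add_powr) auto
  also have "\<dots> = \<epsilon> * measure lebesgue D + \<epsilon> powr (1 - q) * Lp_norm q D g powr q"
    using g q bounded_opensD(3)[OF D]
    by (subst Bochner_Integration.integral_add)
       (simp_all add: Lp_def Lp_norm_powr measure_restrict_space fmeasurableD mult.commute)
  finally show "(LINT x|lebesgue_on D. norm (g x)) \<le> \<epsilon> * measure lebesgue D + \<epsilon> powr (1 - q) * Lp_norm q D g powr q" .
qed

lemma L1_tendsto: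
  fixes g :: "nat \<Rightarrow> real^'n \<Rightarrow> 'b::euclidean_space"
  assumes D: "D \<in> bounded_opens" and g: "\<And>k. g k \<in> Lp q D" and q: "1 < q"
    and lim: "(\<lambda>k. Lp_norm q D (g k)) \<longlonglongrightarrow> 0"
  shows "(\<lambda>k. LINT x|lebesgue_on D. norm (g k x)) \<longlonglongrightarrow> 0"
proof (rule tendstoI)
  fix e :: real assume e: "0 < e"
  \<comment> \<open>The summand 1 keeps the denominator positive when \<open>D\<close> is null and
    makes \<open>\<epsilon> * measure lebesgue D\<close> strictly less than
    \<open>e / 2\<close>.\<close>
  define \<epsilon> where "\<epsilon> = e / (2 * (measure lebesgue D + 1))"
  have pos: "0 < measure lebesgue D + 1" using measure_nonneg[of lebesgue D] by linarith
  have \<epsilon>: "0 < \<epsilon>" using e pos by (simp add: \<epsilon>_def)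
  have "\<epsilon> * (measure lebesgue D + 1) = e / 2"
    using pos unfolding \<epsilon>_def by (simp add: field_simps)
  then have *: "\<epsilon> * measure lebesgue D < e / 2" using \<epsilon> by (simp add: distrib_left)
  have "(\<lambda>k. \<epsilon> powr (1 - q) * Lp_norm q D (g k) powr q) \<longlonglongrightarrow> \<epsilon> powr (1 - q) * 0"
    using q by (intro tendsto_mult tendsto_const tendsto_zero_powrI[OF lim tendsto_const]) auto
  then have "eventually (\<lambda>k. \<epsilon> powr (1 - q) * Lp_norm q D (g k) powr q < e / 2) sequentially"
    by (rule order_tendstoD) (use e in simp)
  then show "eventually (\<lambda>k. dist (LINT x|lebesgue_on D. norm (g k x)) 0 < e) sequentially"
  proof eventually_elim
    case (elim k)
    have "0 \<le> (LINT x|lebesgue_on D. norm (g k x))"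
      by (intro Bochner_Integration.integral_nonneg) simp
    then show ?case
      using L1_le_Lp[OF D g q \<epsilon>, of k] elim * by (simp add: dist_real_def)
  qed
qed

lemma bounded_compact_support:
  fixes g :: "'a::topological_space \<Rightarrow> 'b::real_normed_vector"
  assumes "continuous_on UNIV g" "compact K" "\<And>x. x \<notin> K \<Longrightarrow> g x = 0"
  obtains B where "\<And>x. norm (g x) \<le> B"
proof -
  have "bounded (g ` K)"
    using assms by (intro compact_imp_bounded compact_continuous_image) (auto intro: continuous_on_subset)
  then obtain b where b: "\<And>x. x \<in> K \<Longrightarrow> norm (g x) \<le> b"
    by (auto simp: bounded_iff)
  have "norm (g x) \<le> max b 0" for x
    using b[of x] assms(3)[of x] by (cases "x \<in> K") auto
  then show thesis using that by blast
qed

lemma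
  assumes D: "D \<in> bounded_opens" and \<phi>: "\<phi> \<in> test_functions E" and q: "0 \<le> q"
  shows Lp_test_function: "\<phi> \<in> Lp q D" and Lp_grad_test_function: "grad \<phi> \<in> Lp q D"
proof -
  obtain K where K: "compact K" "\<And>x. x \<notin> K \<Longrightarrow> \<phi> x = 0" "\<And>x. x \<notin> K \<Longrightarrow> grad \<phi> x = 0"
    using test_function_support[OF \<phi>] by metis
  have c: "continuous_on UNIV \<phi>" "continuous_on UNIV (grad \<phi>)"
    using test_function_smooth[OF \<phi>] by (auto intro: smooth_continuous smooth_grad_continuous)
  show "\<phi> \<in> Lp q D"
    using bounded_compact_support[OF c(1) K(1,2)] Lp_bounded[OF D borel_measurable_continuous_onI[OF c(1)] _ q] by metis
  show "grad \<phi> \<in> Lp q D"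
    using bounded_compact_support[OF c(2) K(1,3)] Lp_bounded[OF D borel_measurable_continuous_onI[OF c(2)] _ q] by metis
qed

text \<open>The functionals to be tested have bounded coefficients, so L1 convergence of the test
  functions and of their gradients is enough to pass to the limit.\<close>

lemma W1q0_approx:
  assumes D: "D \<in> bounded_opens" and q: "1 < q" and \<psi>: "(\<psi>, G) \<in> W1q0 q D"
  obtains \<phi> where "\<And>k::nat. \<phi> k \<in> test_functions D"
    "(\<lambda>k. LINT x|lebesgue_on D. norm (\<phi> k x - \<psi> x)) \<longlonglongrightarrow> 0"
    "(\<lambda>k. LINT x|lebesgue_on D. norm (grad (\<phi> k) x - G x)) \<longlonglongrightarrow> 0"
proof -
  obtain \<phi> where L: "\<psi> \<in> Lp q D" "G \<in> Lp q D" and \<phi>: "\<And>k::nat. \<phi> k \<in> test_functions D"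
    and lim: "(\<lambda>k. Lp_norm q D (\<lambda>x. \<phi> k x - \<psi> x)) \<longlonglongrightarrow> 0" "(\<lambda>k. Lp_norm q D (\<lambda>x. grad (\<phi> k) x - G x)) \<longlonglongrightarrow> 0"
    using \<psi> unfolding W1q0_def by blast
  have q0: "0 < q" "0 \<le> q" using q by auto
  show thesis
    using L1_tendsto[OF D Lp_diff[OF Lp_test_function[OF D \<phi> q0(2)] L(1) q0(1)] q lim(1)]
      L1_tendsto[OF D Lp_diff[OF Lp_grad_test_function[OF D \<phi> q0(2)] L(2) q0(1)] q lim(2)]
    by (rule that[OF \<phi>])
qed

lemma integrable_inner_bounded:
  fixes W g :: "real^'n \<Rightarrow> 'b::euclidean_space"
  assumes W: "W \<in> borel_measurable borel" "\<And>x. norm (W x) \<le> B" and g: "integrable (lebesgue_on D) g"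
  shows "integrable (lebesgue_on D) (\<lambda>x. W x \<bullet> g x)"
proof (rule Bochner_Integration.integrable_bound)
  show "integrable (lebesgue_on D) (\<lambda>x. B * norm (g x))"
    using g by (intro integrable_mult_right integrable_norm)
  have "norm (W x \<bullet> g x) \<le> norm (B * norm (g x))" for x
  proof -
    have "norm (W x \<bullet> g x) \<le> norm (W x) * norm (g x)" by (simp add: Cauchy_Schwarz_ineq2)
    also have "\<dots> \<le> B * norm (g x)" by (intro mult_right_mono W) simp
    finally show ?thesis by simp
  qed
  then show "AE x in lebesgue_on D. norm (W x \<bullet> g x) \<le> norm (B * norm (g x))" by simp
  show "(\<lambda>x. W x \<bullet> g x) \<in> borel_measurable (lebesgue_on D)"
    using borel_measurable_lebesgue_on[OF W(1)] g by (intro borel_measurable_inner) auto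
qed

lemma tendsto_integral_inner:
  fixes W g :: "real^'n \<Rightarrow> 'b::euclidean_space"
  assumes W: "W \<in> borel_measurable borel" "\<And>x. norm (W x) \<le> B" and g: "integrable (lebesgue_on D) g"
    and G: "\<And>k. integrable (lebesgue_on D) (G k)"
    and lim: "(\<lambda>k. LINT x|lebesgue_on D. norm (G k x - g x)) \<longlonglongrightarrow> 0"
  shows "(\<lambda>k. LINT x|lebesgue_on D. W x \<bullet> G k x) \<longlonglongrightarrow> (LINT x|lebesgue_on D. W x \<bullet> g x)"
proof -
  let ?M = "lebesgue_on D"
  have "(\<lambda>k. (LINT x|?M. W x \<bullet> G k x) - (LINT x|?M. W x \<bullet> g x)) \<longlonglongrightarrow> 0"
  proof (rule Lim_null_comparison)
    show "(\<lambda>k. B * (LINT x|?M. norm (G k x - g x))) \<longlonglongrightarrow> 0"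
      using tendsto_mult[OF tendsto_const lim, of B] by simp
    show "eventually (\<lambda>k. norm ((LINT x|?M. W x \<bullet> G k x) - (LINT x|?M. W x \<bullet> g x)) \<le> B * (LINT x|?M. norm (G k x - g x))) sequentially"
    proof (intro always_eventually allI)
      fix k
      have d: "integrable ?M (\<lambda>x. G k x - g x)" using G g by (rule Bochner_Integration.integrable_diff)
      have "(LINT x|?M. W x \<bullet> G k x) - (LINT x|?M. W x \<bullet> g x) = (LINT x|?M. W x \<bullet> (G k x - g x))"
        unfolding inner_diff_right
        by (intro Bochner_Integration.integral_diff[symmetric] integrable_inner_bounded[OF W] G g)
      then have "norm ((LINT x|?M. W x \<bullet> G k x) - (LINT x|?M. W x \<bullet> g x)) \<le> (LINT x|?M. norm (W x \<bullet> (G k x - g x)))"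
        by (simp only: integral_norm_bound)
      also have "\<dots> \<le> (LINT x|?M. B * norm (G k x - g x))"
      proof (rule Bochner_Integration.integral_mono)
        show "integrable ?M (\<lambda>x. norm (W x \<bullet> (G k x - g x)))"
          by (intro integrable_norm integrable_inner_bounded[OF W] d)
        show "integrable ?M (\<lambda>x. B * norm (G k x - g x))"
          by (intro integrable_mult_right integrable_norm d)
        fix x
        have "norm (W x \<bullet> (G k x - g x)) \<le> norm (W x) * norm (G k x - g x)" by (simp add: Cauchy_Schwarz_ineq2)
        also have "\<dots> \<le> B * norm (G k x - g x)" by (intro mult_right_mono W) simp
        finally show "norm (W x \<bullet> (G k x - g x)) \<le> B * norm (G k x - g x)" .
      qed
      also have "\<dots> = B * (LINT x|?M. norm (G k x - g x))" by simp
      finally show "norm ((LINT x|?M. W x \<bullet> G k x) - (LINT x|?M. W x \<bullet> g x)) \<le> B * (LINT x|?M. norm (G k x - g x))" .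
    qed
  qed
  then show ?thesis by (simp only: LIM_zero_iff)
qed

lemma integral_lebesgue_on_support:
  fixes g :: "real^'n \<Rightarrow> real"
  assumes "D \<in> sets borel" "g \<in> borel_measurable borel" "\<And>x. x \<notin> D \<Longrightarrow> g x = 0"
  shows "(LINT x|lebesgue_on D. g x) = (LINT x|lborel. g x)"
proof -
  have "(\<lambda>x. indicator D x * g x) = g"
    using assms(3) by (auto simp: fun_eq_iff indicator_def)
  then show ?thesis using integral_lebesgue_on_borel[OF assms(1,2)] by simp
qed

text \<open>Each differentiation produces a factor \<open>m\<close>; the scalar \<open>c\<close> is
  part of the statement so that the induction hypothesis absorbs it.\<close>

lemma Ck_affine: "Ck k f \<Longrightarrow> Ck k (\<lambda>y. c *\<^sub>R f (b + m *\<^sub>R y))"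
proof (induction k arbitrary: f c)
  case 0
  then show ?case
    by (auto intro!: continuous_intros continuous_on_compose2[of UNIV f])
next
  case (Suc k)
  have f: "f differentiable (at x)" for x using Suc.prems by simp
  have der: "((\<lambda>y. c *\<^sub>R f (b + m *\<^sub>R y)) has_derivative
      (\<lambda>h. c *\<^sub>R frechet_derivative f (at (b + m *\<^sub>R y)) (m *\<^sub>R h))) (at y)" for y
    by (intro has_derivative_scaleR_right has_derivative_compose[OF _ frechet_derivative_works[THEN iffD1, OF f]])
       (auto intro!: derivative_eq_intros)
  have "frechet_derivative (\<lambda>y. c *\<^sub>R f (b + m *\<^sub>R y)) (at y) h
    = (c * m) *\<^sub>R frechet_derivative f (at (b + m *\<^sub>R y)) h" for y h
    unfolding frechet_derivative_at[OF der, symmetric]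
    using linear_frechet_derivative[OF f[of "b + m *\<^sub>R y"]] by (simp add: linear_cmul)
  moreover have "Ck k (\<lambda>y. (c * m) *\<^sub>R frechet_derivative f (at (b + m *\<^sub>R y)) (axis i 1))" for i
    using Suc.prems by (intro Suc.IH[of "\<lambda>x. frechet_derivative f (at x) (axis i 1)"]) simp
  ultimately show ?case
    by (simp add: differentiableI[OF der])
qed

lemma smooth_affine: "smooth f \<Longrightarrow> smooth (\<lambda>y. f (b + m *\<^sub>R y))"
  using Ck_affine[of _ f 1 b m] by (simp add: smooth_def)

lemma grad_affine:
  assumes "smooth \<phi>"
  shows "grad (\<lambda>y. \<phi> (b + m *\<^sub>R y)) y = m *\<^sub>R grad \<phi> (b + m *\<^sub>R y)"
proof -
  have "((\<lambda>y. \<phi> (b + m *\<^sub>R y)) has_derivative (\<lambda>h. grad \<phi> (b + m *\<^sub>R y) *v (m *\<^sub>R h))) (at y)"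
    by (rule has_derivative_compose[OF _ smooth_has_derivative[OF assms], of "\<lambda>y. b + m *\<^sub>R y"])
       (auto intro!: derivative_eq_intros)
  then have "(\<lambda>h. grad \<phi> (b + m *\<^sub>R y) *v (m *\<^sub>R h)) = (\<lambda>h. grad (\<lambda>y. \<phi> (b + m *\<^sub>R y)) y *v h)"
    using smooth_has_derivative[OF smooth_affine[OF assms]] by (rule has_derivative_unique)
  then show ?thesis
    by (simp add: matrix_eq fun_eq_iff matrix_vector_mult_scaleR scaleR_matrix_vector_assoc)
qed

text \<open>The operator is homogeneous of first order with constant coefficients. Composing the
  test function with the inverse of \<open>x \<mapsto> s + n *\<^sub>R x\<close> therefore changes
  the pairing only by the factor \<open>n ^ CARD('n) / n\<close>, and being free survives dilation
  and translation.\<close>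

lemma A_free_affine:
  fixes A :: "'n::finite \<Rightarrow> real^'d^'l"
  assumes w: "continuous_on UNIV w" and free: "\<forall>\<psi>\<in>test_functions UNIV. A_distribution A w \<psi> = 0"
    and \<phi>: "\<phi> \<in> test_functions D" and n: "0 < n"
  shows "(\<Sum>i\<in>UNIV. LINT x|lborel. (A i *v w (n *\<^sub>R x + s)) \<bullet> column i (grad \<phi> x)) = 0"
proof -
  define b where "b = - ((1 / n) *\<^sub>R s)"
  define \<phi>' where "\<phi>' y = \<phi> (b + (1 / n) *\<^sub>R y)" for y
  have sm: "smooth \<phi>" using \<phi> by (rule test_function_smooth)
  have b: "b + (1 / n) *\<^sub>R (s + n *\<^sub>R x) = x" for x
    using n by (simp add: b_def algebra_simps)
  obtain K where K: "compact K" "\<And>x. x \<notin> K \<Longrightarrow> \<phi> x = 0"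
    using test_function_support[OF \<phi>] by metis
  have "\<phi>' \<in> test_functions UNIV"
    unfolding test_functions_def
  proof (intro CollectI conjI exI[of _ "(\<lambda>x. s + n *\<^sub>R x) ` K"] allI impI)
    show "smooth \<phi>'" unfolding \<phi>'_def by (rule smooth_affine[OF sm])
    show "compact ((\<lambda>x. s + n *\<^sub>R x) ` K)"
      by (intro compact_continuous_image continuous_intros K)
    fix y assume y: "y \<notin> (\<lambda>x. s + n *\<^sub>R x) ` K"
    have "y = s + n *\<^sub>R (b + (1 / n) *\<^sub>R y)"
      using n by (simp add: b_def algebra_simps)
    then have "b + (1 / n) *\<^sub>R y \<notin> K" using y by blast
    then show "\<phi>' y = 0" unfolding \<phi>'_def by (rule K(2))
  qed simp
  then have "A_distribution A w \<phi>' = 0" using free by blast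
  then have 0: "(\<Sum>i\<in>UNIV. LINT x|lebesgue. (A i *v w x) \<bullet> column i (grad \<phi>' x)) = 0"
    by (simp add: A_distribution_def)
  have "(LINT x|lebesgue. (A i *v w x) \<bullet> column i (grad \<phi>' x))
    = n ^ CARD('n) * ((1 / n) * (LINT x|lborel. (A i *v w (n *\<^sub>R x + s)) \<bullet> column i (grad \<phi> x)))" for i
  proof -
    have "continuous_on UNIV (\<lambda>x. (A i *v w x) \<bullet> column i (grad \<phi>' x))"
    proof -
      have "continuous_on UNIV (grad \<phi>')"
        unfolding \<phi>'_def by (intro smooth_grad_continuous smooth_affine sm)
      then show ?thesis
        unfolding column_def
        by (intro continuous_on_inner continuous_on_vec_lambda continuous_on_component
            continuous_on_compose2[OF matrix_vector_mult_linear_continuous_on w subset_UNIV]) simp_all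
    qed
    then have m: "(\<lambda>x. (A i *v w x) \<bullet> column i (grad \<phi>' x)) \<in> borel_measurable borel"
      by (rule borel_measurable_continuous_onI)
    have "(LINT x|lebesgue. (A i *v w x) \<bullet> column i (grad \<phi>' x)) = (LINT x|lborel. (A i *v w x) \<bullet> column i (grad \<phi>' x))"
      using m by (intro integral_completion) simp
    also have "\<dots> = n ^ CARD('n) * (LINT x|lborel. (A i *v w (s + n *\<^sub>R x)) \<bullet> column i (grad \<phi>' (s + n *\<^sub>R x)))"
      using n by (subst integral_lborel_affine[OF m, of n s]) auto
    also have "\<dots> = n ^ CARD('n) * (LINT x|lborel. (1 / n) * ((A i *v w (n *\<^sub>R x + s)) \<bullet> column i (grad \<phi> x)))"
    proof -
      have "grad \<phi>' (s + n *\<^sub>R x) = (1 / n) *\<^sub>R grad \<phi> x" for x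
        unfolding \<phi>'_def grad_affine[OF sm] b ..
      then have "column i (grad \<phi>' (s + n *\<^sub>R x)) = (1 / n) *\<^sub>R column i (grad \<phi> x)" for x
        by (simp add: column_def vec_eq_iff)
      then show ?thesis by (simp add: add.commute)
    qed
    finally show ?thesis by simp
  qed
  then have "n ^ CARD('n) * ((1 / n) * (\<Sum>i\<in>UNIV. LINT x|lborel. (A i *v w (n *\<^sub>R x + s)) \<bullet> column i (grad \<phi> x))) = 0"
    using 0 by (simp only: sum_distrib_left)
  then show ?thesis using n by simp
qed

lemma bounded_linear_column: "bounded_linear (column i :: real^'n^'m \<Rightarrow> real^'m)"
proof -
  have "linear (column i :: real^'n^'m \<Rightarrow> real^'m)"
    by (rule linearI) (simp_all add: column_def vec_eq_iff)
  then show ?thesis by (simp add: linear_conv_bounded_linear)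
qed

text \<open>In the first dual norm, \<open>oscillation_estimate\<close> passes from test functions
  to their limits and leaves \<open>B * (R / n)\<close> times the L1 norm of \<open>G\<close>; the
  latter is at most \<open>measure lebesgue D + 1\<close> when \<open>Lp_norm q D G \<le> 1\<close>.
  The second dual norm is exactly 0 by \<open>A_free_affine\<close>.\<close>

lemma A_norm_oscillation:
  fixes A :: "'n::finite \<Rightarrow> real^'d^'l" and w :: "real^'n \<Rightarrow> real^'d"
  assumes D: "D \<in> bounded_opens" and q: "1 < q" and \<rho>: "0 < \<rho>"
    and w: "continuous_on UNIV w" and per: "periodic \<rho> w" and bound: "\<And>x. norm (w x) \<le> B"
    and mean: "\<And>v. (LINT s|lborel. indicator (cube \<rho> z) s * (w s \<bullet> v)) = 0"
    and R: "cube \<rho> z \<subseteq> cball 0 R" and n: "0 < n"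
    and free: "\<forall>\<psi>\<in>test_functions UNIV. A_distribution A w \<psi> = 0"
  shows "A_norm A q D (\<lambda>x. w (n *\<^sub>R x + s)) \<le> ennreal (B * (R / n) * (measure lebesgue D + 1))"
proof -
  define W where "W x = w (n *\<^sub>R x + s)" for x
  let ?M = "lebesgue_on D"
  have Dm: "D \<in> sets borel" using D by (rule bounded_opensD)
  have Wc: "continuous_on UNIV W"
    unfolding W_def by (intro continuous_on_compose2[OF w] continuous_intros) auto
  have wm: "w \<in> borel_measurable borel" using w by (rule borel_measurable_continuous_onI)
  have Wm: "W \<in> borel_measurable borel" using Wc by (rule borel_measurable_continuous_onI)
  have WB: "norm (W x) \<le> B" for x unfolding W_def by (rule bound)
  have B0: "0 \<le> B" using bound[of 0] norm_ge_zero[of "w 0"] by linarith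
  have "norm z \<le> R" using subsetD[OF R center_in_cube[OF \<rho>]] by simp
  then have R0: "0 \<le> R" by (rule order_trans[OF norm_ge_zero])
  define K0 where "K0 = B * (R / n)"
  have K0: "0 \<le> K0" using B0 R0 n by (simp add: K0_def)
  have bound1: "\<bar>Lp_functional D W (\<psi>, G)\<bar> \<le> K0 * (measure lebesgue D + 1)"
    if \<psi>: "(\<psi>, G) \<in> W1q0 q D" and G1: "Lp_norm q D G \<le> 1" for \<psi> G
  proof -
    obtain \<phi> where \<phi>: "\<And>k. \<phi> k \<in> test_functions D"
      and lim: "(\<lambda>k. LINT x|?M. norm (\<phi> k x - \<psi> x)) \<longlonglongrightarrow> 0" "(\<lambda>k. LINT x|?M. norm (grad (\<phi> k) x - G x)) \<longlonglongrightarrow> 0"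
      using W1q0_approx[OF D q \<psi>] by blast
    have L: "\<psi> \<in> Lp q D" "G \<in> Lp q D" using \<psi> by (auto simp: W1q0_def)
    have q0: "0 \<le> q" using q by simp
    have int\<phi>: "integrable ?M (\<phi> k)" "integrable ?M (grad (\<phi> k))" for k
      using Lp_integrable[OF D Lp_test_function[OF D \<phi> q0] q] Lp_integrable[OF D Lp_grad_test_function[OF D \<phi> q0] q] by auto
    have intG: "integrable ?M \<psi>" "integrable ?M G" using L q by (auto intro: Lp_integrable[OF D])
    have t: "(\<lambda>k. \<bar>LINT x|?M. W x \<bullet> \<phi> k x\<bar>) \<longlonglongrightarrow> \<bar>LINT x|?M. W x \<bullet> \<psi> x\<bar>"
      by (intro tendsto_rabs tendsto_integral_inner[OF Wm WB intG(1) int\<phi>(1) lim(1)])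
    have r: "(\<lambda>k. K0 * ((LINT x|?M. norm (grad (\<phi> k) x - G x)) + (LINT x|?M. norm (G x)))) \<longlonglongrightarrow> K0 * (0 + (LINT x|?M. norm (G x)))"
      by (intro tendsto_mult tendsto_add tendsto_const lim(2))
    have le: "\<bar>LINT x|?M. W x \<bullet> \<phi> k x\<bar> \<le> K0 * ((LINT x|?M. norm (grad (\<phi> k) x - G x)) + (LINT x|?M. norm (G x)))" for k
    proof -
      obtain K where K: "K \<subseteq> D" "\<And>x. x \<notin> K \<Longrightarrow> \<phi> k x = 0" "\<And>x. x \<notin> K \<Longrightarrow> grad (\<phi> k) x = 0"
        using test_function_support[OF \<phi>] by metis
      have zero: "\<phi> k x = 0" "grad (\<phi> k) x = 0" if "x \<notin> D" for x
        using that K(1) K(2,3)[of x] by auto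
      have sm: "smooth (\<phi> k)" using \<phi> by (rule test_function_smooth)
      have m: "(\<lambda>x. W x \<bullet> \<phi> k x) \<in> borel_measurable borel" "(\<lambda>x. norm (grad (\<phi> k) x)) \<in> borel_measurable borel"
        by (auto intro!: borel_measurable_continuous_onI continuous_on_inner continuous_on_norm Wc
            smooth_continuous[OF sm] smooth_grad_continuous[OF sm])
      have "(LINT x|?M. W x \<bullet> \<phi> k x) = (LINT x|lborel. W x \<bullet> \<phi> k x)"
        by (intro integral_lebesgue_on_support[OF Dm m(1)]) (simp add: zero)
      moreover have "(LINT x|?M. norm (grad (\<phi> k) x)) = (LINT x|lborel. norm (grad (\<phi> k) x))"
        by (intro integral_lebesgue_on_support[OF Dm m(2)]) (simp add: zero)
      ultimately have "\<bar>LINT x|?M. W x \<bullet> \<phi> k x\<bar> \<le> K0 * (LINT x|?M. norm (grad (\<phi> k) x))"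
        using oscillation_estimate[OF \<rho> wm per bound mean R n \<phi>[of k], of s] by (simp add: W_def K0_def)
      also have "(LINT x|?M. norm (grad (\<phi> k) x)) \<le> (LINT x|?M. norm (grad (\<phi> k) x - G x) + norm (G x))"
        by (intro Bochner_Integration.integral_mono integrable_norm Bochner_Integration.integrable_add
            Bochner_Integration.integrable_diff int\<phi> intG) (simp add: norm_triangle_sub add.commute)
      also have "\<dots> = (LINT x|?M. norm (grad (\<phi> k) x - G x)) + (LINT x|?M. norm (G x))"
        by (intro Bochner_Integration.integral_add integrable_norm Bochner_Integration.integrable_diff int\<phi> intG)
      finally show ?thesis using K0 by (simp add: mult_left_mono)
    qed
    have "\<bar>LINT x|?M. W x \<bullet> \<psi> x\<bar> \<le> K0 * (0 + (LINT x|?M. norm (G x)))"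
      by (rule LIMSEQ_le[OF t r]) (use le in blast)
    also have "\<dots> \<le> K0 * (measure lebesgue D + 1)"
    proof (rule mult_left_mono[OF _ K0])
      have "Lp_norm q D G powr q \<le> 1 powr q"
        using G1 q by (intro powr_mono2) auto
      then show "0 + (LINT x|?M. norm (G x)) \<le> measure lebesgue D + 1"
        using L1_le_Lp[OF D L(2) q, of 1] by simp
    qed
    finally show ?thesis by (simp add: Lp_functional_def)
  qed
  have bound2: "A_functional A D W (\<psi>, G) = 0" if \<psi>: "(\<psi>, G) \<in> W1q0 q D" for \<psi> G
  proof -
    obtain \<phi> where \<phi>: "\<And>k. \<phi> k \<in> test_functions D"
      and "(\<lambda>k. LINT x|?M. norm (\<phi> k x - \<psi> x)) \<longlonglongrightarrow> 0"
      and lim: "(\<lambda>k. LINT x|?M. norm (grad (\<phi> k) x - G x)) \<longlonglongrightarrow> 0"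
      using W1q0_approx[OF D q \<psi>] by blast
    have L: "G \<in> Lp q D" using \<psi> by (auto simp: W1q0_def)
    have q0: "0 \<le> q" using q by simp
    have int\<phi>: "integrable ?M (grad (\<phi> k))" for k
      by (rule Lp_integrable[OF D Lp_grad_test_function[OF D \<phi> q0] q])
    have intG: "integrable ?M G" using L q by (rule Lp_integrable[OF D])
    have intc: "integrable ?M (\<lambda>x. column i (g x))" if "integrable ?M g" for i and g :: "real^'n \<Rightarrow> real^'n^'l"
      using bounded_linear_column that by (rule integrable_bounded_linear)
    have AWc: "continuous_on UNIV (\<lambda>x. A i *v W x)" for i
      by (rule continuous_on_compose2[OF matrix_vector_mult_linear_continuous_on Wc subset_UNIV])
    have AWm: "(\<lambda>x. A i *v W x) \<in> borel_measurable borel" for i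
      using AWc by (rule borel_measurable_continuous_onI)
    have AWB: "norm (A i *v W x) \<le> norm (A i) * B" for i x
      using order_trans[OF norm_matrix_vector_le mult_left_mono[OF WB]] by simp
    have "(\<lambda>k. LINT x|?M. norm (column i (grad (\<phi> k) x) - column i (G x))) \<longlonglongrightarrow> 0" for i
    proof (rule Lim_null_comparison[OF always_eventually[OF allI] lim])
      fix k
      have "column i (grad (\<phi> k) x) - column i (G x) = column i (grad (\<phi> k) x - G x)" for x
        by (simp add: column_def vec_eq_iff)
      then show "norm (LINT x|?M. norm (column i (grad (\<phi> k) x) - column i (G x))) \<le> (LINT x|?M. norm (grad (\<phi> k) x - G x))"
        using norm_column_le
        by (auto simp: abs_of_nonneg intro!: Bochner_Integration.integral_mono integrable_norm intc Bochner_Integration.integrable_diff int\<phi> intG)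
    qed
    then have t: "(\<lambda>k. LINT x|?M. (A i *v W x) \<bullet> column i (grad (\<phi> k) x)) \<longlonglongrightarrow> (LINT x|?M. (A i *v W x) \<bullet> column i (G x))" for i
      by (intro tendsto_integral_inner[OF AWm AWB] intc int\<phi> intG)
    have "(\<lambda>k. \<Sum>i\<in>UNIV. LINT x|?M. (A i *v W x) \<bullet> column i (grad (\<phi> k) x)) \<longlonglongrightarrow> (\<Sum>i\<in>UNIV. LINT x|?M. (A i *v W x) \<bullet> column i (G x))"
      by (intro tendsto_sum t)
    moreover have "(\<Sum>i\<in>UNIV. LINT x|?M. (A i *v W x) \<bullet> column i (grad (\<phi> k) x)) = 0" for k
    proof -
      obtain K where K: "K \<subseteq> D" "\<And>x. x \<notin> K \<Longrightarrow> grad (\<phi> k) x = 0"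
        using test_function_support[OF \<phi>] by metis
      have "continuous_on UNIV (\<lambda>x. (A i *v W x) \<bullet> column i (grad (\<phi> k) x))" for i
        unfolding column_def
        by (intro continuous_on_inner AWc continuous_on_vec_lambda continuous_on_component
            smooth_grad_continuous test_function_smooth[OF \<phi>])
      then have m: "(\<lambda>x. (A i *v W x) \<bullet> column i (grad (\<phi> k) x)) \<in> borel_measurable borel" for i
        by (rule borel_measurable_continuous_onI)
      have zero: "column i (grad (\<phi> k) x) = 0" if "x \<notin> D" for i x
        using that K(1) K(2)[of x] by (auto simp: column_def vec_eq_iff)
      have "(LINT x|?M. (A i *v W x) \<bullet> column i (grad (\<phi> k) x)) = (LINT x|lborel. (A i *v W x) \<bullet> column i (grad (\<phi> k) x))" for i
        by (intro integral_lebesgue_on_support[OF Dm m]) (simp add: zero)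
      then show ?thesis
        using A_free_affine[OF w free \<phi>[of k] n, of s] by (simp add: W_def)
    qed
    ultimately have "(\<Sum>i\<in>UNIV. LINT x|?M. (A i *v W x) \<bullet> column i (G x)) = 0"
      by (simp add: LIMSEQ_const_iff)
    then show ?thesis by (simp add: A_functional_def)
  qed
  have "dual_norm q D (Lp_functional D W) \<le> ennreal (K0 * (measure lebesgue D + 1))"
    unfolding dual_norm_def using bound1 by (auto intro!: SUP_least ennreal_leI)
  moreover have "dual_norm q D (A_functional A D W) \<le> 0"
    unfolding dual_norm_def by (rule SUP_least) (auto simp: bound2)
  ultimately have "A_norm A q D W \<le> ennreal (K0 * (measure lebesgue D + 1)) + 0"
    unfolding A_norm_def by (rule add_mono)
  then show ?thesis by (simp add: W_def[abs_def] K0_def)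
qed

lemma periodic_bounded:
  fixes w :: "real^'n \<Rightarrow> 'b::real_normed_vector"
  assumes \<rho>: "0 < \<rho>" and w: "continuous_on UNIV w" and per: "periodic \<rho> w"
  obtains B where "\<And>x. norm (w x) \<le> B"
proof -
  let ?K = "cbox (\<chi> i. - \<rho> / 2) (\<chi> i. \<rho> / 2) :: (real^'n) set"
  have "bounded (w ` ?K)"
    by (intro compact_imp_bounded compact_continuous_image continuous_on_subset[OF w]) auto
  then obtain B where B: "\<And>x. x \<in> ?K \<Longrightarrow> norm (w x) \<le> B"
    by (auto simp: bounded_iff)
  have "norm (w x) \<le> B" for x
  proof -
    obtain k where k: "\<And>j. x - lattice_vec \<rho> j \<in> half_open_cube \<rho> 0 \<longleftrightarrow> j = k"
      using tile_unique[OF \<rho>] by blast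
    have "x - lattice_vec \<rho> k \<in> half_open_cube \<rho> 0" by (simp add: k)
    then have "x - lattice_vec \<rho> k \<in> ?K"
      by (simp add: half_open_cube_def mem_box_cart less_imp_le)
    then show ?thesis
      using B periodic_lattice[OF per, of "x - lattice_vec \<rho> k" k] by simp
  qed
  then show thesis using that by blast
qed

section \<open>Quasiconvexity of the density\<close>

context Lip_functional
begin

text \<open>In the nonnegative form, integrals over points and over shifts can be exchanged without
  integrability conditions.\<close>

lemma F_nn_integral:
  assumes D: "D \<in> bounded_opens" and u [measurable]: "u \<in> borel_measurable borel" and uL: "u \<in> Lp p D"
  shows "ennreal (F u D) = (\<integral>\<^sup>+x\<in>D. ennreal (dens x (u x)) \<partial>lborel)"
proof -
  have "(\<integral>\<^sup>+x. ennreal (dens x (u x)) \<partial>lebesgue_on D) = ennreal (F u D)"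
    using F_borel[OF D u uL] nn_integral_eq_integral[of "lebesgue_on D" "\<lambda>x. dens x (u x)"]
    by (simp add: has_bochner_integral_iff)
  moreover have "(\<integral>\<^sup>+x. ennreal (dens x (u x)) \<partial>lebesgue_on D) = (\<integral>\<^sup>+x\<in>D. ennreal (dens x (u x)) \<partial>lborel)"
    by (rule nn_integral_lebesgue_on_borel[OF bounded_opensD(2)[OF D]]) measurable
  ultimately show ?thesis by simp
qed

lemma F_le_average:
  fixes A :: "'n \<Rightarrow> real^'d^'l" and w :: "real^'n \<Rightarrow> real^'d"
  assumes sc: "F \<in> class_I_sc A p q c0" and D: "D \<in> bounded_opens" and q: "1 < q" and \<rho>: "0 < \<rho>"
    and w: "continuous_on UNIV w" and per: "periodic \<rho> w" and bound: "\<And>x. norm (w x) \<le> B"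
    and mean: "\<And>v. (LINT s|lborel. indicator (cube \<rho> z) s * (w s \<bullet> v)) = 0"
    and free: "\<forall>\<psi>\<in>test_functions UNIV. A_distribution A w \<psi> = 0"
  shows "ennreal (\<rho> ^ CARD('n) * F (\<lambda>_. \<xi>) D) \<le> (\<integral>\<^sup>+s\<in>cube \<rho> z. ennreal (F (\<lambda>_. \<xi> + w s) D) \<partial>lborel)"
proof (rule ennreal_le_epsilon)
  fix e :: real assume e: "0 < e"
  \<comment> \<open>The loss in the semicontinuity inequality is later integrated over the period
    cell, hence the division by its volume.\<close>
  define \<epsilon> where "\<epsilon> = e / \<rho> ^ CARD('n)"
  have \<epsilon>: "0 < \<epsilon>" "\<rho> ^ CARD('n) * \<epsilon> = e" using e \<rho> by (auto simp: \<epsilon>_def)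
  let ?C = "cube \<rho> z"
  have [measurable]: "w \<in> borel_measurable borel" using w by (rule borel_measurable_continuous_onI)
  have Dm [measurable]: "D \<in> sets borel" using D by (rule bounded_opensD)
  obtain R where R: "?C \<subseteq> cball 0 R"
    using bounded_subset_ballD[OF bounded_cube, of \<rho> z 0] ball_subset_cball by blast
  have "\<forall>\<epsilon>>0. \<exists>\<delta>>0. \<forall>v\<in>Lp p D. A_norm A q D (\<lambda>x. v x - \<xi>) < ennreal \<delta> \<longrightarrow> F (\<lambda>_. \<xi>) D - \<epsilon> < F v D"
    using sc[unfolded class_I_sc_def mem_Collect_eq, THEN conjunct2, THEN bspec, OF D, THEN bspec, OF const_Lp[OF D, of \<xi>]] .
  then obtain \<delta> where \<delta>: "0 < \<delta>"
    "\<And>v. v \<in> Lp p D \<Longrightarrow> A_norm A q D (\<lambda>x. v x - \<xi>) < ennreal \<delta> \<Longrightarrow> F (\<lambda>_. \<xi>) D - \<epsilon> < F v D"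
    using \<epsilon>(1) by blast
  define b where "b = \<bar>B * R * (measure lebesgue D + 1)\<bar>"
  \<comment> \<open>Here \<open>n * \<delta> = b + \<delta>\<close>, so
    \<open>b / n < \<delta>\<close>. The real number \<open>n\<close> is fixed before
    \<open>s\<close>, which is possible because neither \<open>\<delta>\<close> nor the norm bound
    involves \<open>s\<close>.\<close>
  define n where "n = b / \<delta> + 1"
  have n: "0 < n" unfolding n_def b_def using \<delta>(1) by (intro add_nonneg_pos) auto
  have "B * (R / n) * (measure lebesgue D + 1) \<le> b / n"
    unfolding b_def using n by (simp add: divide_right_mono)
  also have "\<dots> < \<delta>"
    using n \<delta>(1) by (simp add: pos_divide_less_eq) (simp add: n_def distrib_left)
  finally have small: "B * (R / n) * (measure lebesgue D + 1) < \<delta>" .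
  have uL: "(\<lambda>x. \<xi> + w (n *\<^sub>R x + s)) \<in> Lp p D" for s
  proof (rule Lp_bounded[OF D])
    show "norm (\<xi> + w (n *\<^sub>R x + s)) \<le> norm \<xi> + B" for x
      using norm_triangle_ineq[of \<xi> "w (n *\<^sub>R x + s)"] bound[of "n *\<^sub>R x + s"] by linarith
  qed (use p in simp_all)
  have low: "F (\<lambda>_. \<xi>) D - \<epsilon> \<le> F (\<lambda>x. \<xi> + w (n *\<^sub>R x + s)) D" for s
  proof -
    have "A_norm A q D (\<lambda>x. w (n *\<^sub>R x + s)) \<le> ennreal (B * (R / n) * (measure lebesgue D + 1))"
      by (rule A_norm_oscillation[OF D q \<rho> w per bound mean R n free])
    also have "\<dots> < ennreal \<delta>"
      using small \<delta>(1) by (simp add: ennreal_lessI)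
    finally show ?thesis
      using \<delta>(2)[OF uL] by (simp add: less_imp_le)
  qed
  have "ennreal (\<rho> ^ CARD('n) * (F (\<lambda>_. \<xi>) D - \<epsilon>)) = (\<integral>\<^sup>+s\<in>?C. ennreal (F (\<lambda>_. \<xi>) D - \<epsilon>) \<partial>lborel)"
    using \<rho> by (subst nn_integral_cmult_indicator) (simp_all add: emeasure_lborel_cube ennreal_mult' mult.commute)
  also have "\<dots> \<le> (\<integral>\<^sup>+s. (\<integral>\<^sup>+x. ennreal (dens x (\<xi> + w (n *\<^sub>R x + s))) * indicator D x * indicator ?C s \<partial>lborel) \<partial>lborel)"
  proof (rule nn_integral_mono)
    fix s
    have "ennreal (F (\<lambda>_. \<xi>) D - \<epsilon>) \<le> (\<integral>\<^sup>+x\<in>D. ennreal (dens x (\<xi> + w (n *\<^sub>R x + s))) \<partial>lborel)"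
      by (subst F_nn_integral[OF D _ uL, symmetric]) (simp_all add: ennreal_leI low)
    then have "ennreal (F (\<lambda>_. \<xi>) D - \<epsilon>) * indicator ?C s \<le> (\<integral>\<^sup>+x\<in>D. ennreal (dens x (\<xi> + w (n *\<^sub>R x + s))) \<partial>lborel) * indicator ?C s"
      by (rule mult_right_mono) simp
    then show "ennreal (F (\<lambda>_. \<xi>) D - \<epsilon>) * indicator ?C s \<le> (\<integral>\<^sup>+x. ennreal (dens x (\<xi> + w (n *\<^sub>R x + s))) * indicator D x * indicator ?C s \<partial>lborel)"
      by (subst nn_integral_multc) auto
  qed
  also have "\<dots> = (\<integral>\<^sup>+x. (\<integral>\<^sup>+s. ennreal (dens x (\<xi> + w (n *\<^sub>R x + s))) * indicator D x * indicator ?C s \<partial>lborel) \<partial>lborel)"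
    by (rule lborel_pair.Fubini'[symmetric]) measurable
  \<comment> \<open>For fixed \<open>x\<close> the integrand is periodic in \<open>s\<close>, so the
    shift by \<open>n *\<^sub>R x\<close> leaves its integral over the cell unchanged. The point
    \<open>x\<close> in \<open>dens x\<close> is not touched: oscillation and space variable are
    decoupled at this step.\<close>
  also have "\<dots> = (\<integral>\<^sup>+x. (\<integral>\<^sup>+s. ennreal (dens x (\<xi> + w s)) * indicator D x * indicator ?C s \<partial>lborel) \<partial>lborel)"
  proof (rule nn_integral_cong)
    fix x
    show "(\<integral>\<^sup>+s. ennreal (dens x (\<xi> + w (n *\<^sub>R x + s))) * indicator D x * indicator ?C s \<partial>lborel)
      = (\<integral>\<^sup>+s. ennreal (dens x (\<xi> + w s)) * indicator D x * indicator ?C s \<partial>lborel)"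
      using per by (intro nn_integral_cube_shift[OF \<rho>, where h = "\<lambda>s. ennreal (dens x (\<xi> + w s)) * indicator D x"])
        (auto simp: periodic_def)
  qed
  also have "\<dots> = (\<integral>\<^sup>+s. (\<integral>\<^sup>+x. ennreal (dens x (\<xi> + w s)) * indicator D x * indicator ?C s \<partial>lborel) \<partial>lborel)"
    by (rule lborel_pair.Fubini') measurable
  also have "\<dots> = (\<integral>\<^sup>+s\<in>?C. ennreal (F (\<lambda>_. \<xi> + w s) D) \<partial>lborel)"
    by (intro nn_integral_cong) (simp add: nn_integral_multc F_nn_integral[OF D] D)
  finally have "ennreal (\<rho> ^ CARD('n) * (F (\<lambda>_. \<xi>) D - \<epsilon>)) \<le> (\<integral>\<^sup>+s\<in>?C. ennreal (F (\<lambda>_. \<xi> + w s) D) \<partial>lborel)" .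
  \<comment> \<open>\<open>ennreal\<close> sends negative numbers to 0; in that case
    \<open>e\<close> alone already bounds the left-hand side.\<close>
  moreover have "ennreal (\<rho> ^ CARD('n) * F (\<lambda>_. \<xi>) D) \<le> ennreal (\<rho> ^ CARD('n) * (F (\<lambda>_. \<xi>) D - \<epsilon>)) + ennreal e"
  proof (cases "0 \<le> \<rho> ^ CARD('n) * (F (\<lambda>_. \<xi>) D - \<epsilon>)")
    case True
    then show ?thesis using e \<epsilon>(2) by (simp add: right_diff_distrib flip: ennreal_plus)
  next
    case False
    then have "\<rho> ^ CARD('n) * F (\<lambda>_. \<xi>) D \<le> e" using \<epsilon>(2) by (simp add: right_diff_distrib)
    then show ?thesis by (simp add: ennreal_leI add_increasing)
  qed
  ultimately show "ennreal (\<rho> ^ CARD('n) * F (\<lambda>_. \<xi>) D) \<le> (\<integral>\<^sup>+s\<in>?C. ennreal (F (\<lambda>_. \<xi> + w s) D) \<partial>lborel) + ennreal e"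
    using add_right_mono order_trans by blast
qed

lemma dens_le_average:
  fixes A :: "'n \<Rightarrow> real^'d^'l" and w :: "real^'n \<Rightarrow> real^'d"
  assumes sc: "F \<in> class_I_sc A p q c0" and q: "1 < q" and \<rho>: "0 < \<rho>"
    and w: "continuous_on UNIV w" and per: "periodic \<rho> w" and bound: "\<And>x. norm (w x) \<le> B"
    and mean: "\<And>v. (LINT s|lborel. indicator (cube \<rho> z) s * (w s \<bullet> v)) = 0"
    and free: "\<forall>\<psi>\<in>test_functions UNIV. A_distribution A w \<psi> = 0"
  shows "ennreal (\<rho> ^ CARD('n) * dens x \<xi>) \<le> (\<integral>\<^sup>+s\<in>cube \<rho> z. ennreal (dens x (\<xi> + w s)) \<partial>lborel)"
proof -
  let ?C = "cube \<rho> z"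
  have wm [measurable]: "w \<in> borel_measurable borel" using w by (rule borel_measurable_continuous_onI)
  \<comment> \<open>On a constant function \<open>F\<close> is the integral of \<open>dens\<close>
    over the cube, which is measurable in the constant by joint measurability of
    \<open>dens\<close>.\<close>
  have qm: "(\<lambda>s. ennreal (quot x (\<xi> + w s) r)) \<in> borel_measurable borel" if r: "0 < r" for r
  proof -
    have "ennreal (quot x (\<xi> + w s) r) = ennreal (F (\<lambda>_. \<xi> + w s) (cube r x)) / ennreal (r ^ CARD('n))" for s
      using r F_nonneg[of "cube r x" "\<lambda>_. \<xi> + w s"] by (simp add: quot_def divide_ennreal)
    moreover have "(\<lambda>s. ennreal (F (\<lambda>_. \<xi> + w s) (cube r x))) \<in> borel_measurable borel"
    proof -
      have "ennreal (F (\<lambda>_. \<xi> + w s) (cube r x)) = (\<integral>\<^sup>+y\<in>cube r x. ennreal (dens y (\<xi> + w s)) \<partial>lborel)" for s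
        by (rule F_nn_integral) auto
      then show ?thesis by (simp only:) measurable
    qed
    ultimately show ?thesis by (simp only:) (rule borel_measurable_divide_ennreal[OF _ borel_measurable_const])
  qed
  have qC: "(\<lambda>s. ennreal (quot x (\<xi> + w s) r) * indicator ?C s) \<in> borel_measurable lborel" if r: "0 < r" for r
    using borel_measurable_times_ennreal[OF qm[OF r] borel_measurable_indicator[of ?C]] by simp
  have avg: "ennreal (\<rho> ^ CARD('n) * quot x \<xi> r) \<le> (\<integral>\<^sup>+s\<in>?C. ennreal (quot x (\<xi> + w s) r) \<partial>lborel)" if r: "0 < r" for r
  proof -
    have "ennreal (\<rho> ^ CARD('n) * F (\<lambda>_. \<xi>) (cube r x)) \<le> (\<integral>\<^sup>+s\<in>?C. ennreal (F (\<lambda>_. \<xi> + w s) (cube r x)) \<partial>lborel)"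
      by (rule F_le_average[OF sc cube_in_bounded_opens q \<rho> w per bound mean free])
    also have "\<dots> = (\<integral>\<^sup>+s. ennreal (r ^ CARD('n)) * (ennreal (quot x (\<xi> + w s) r) * indicator ?C s) \<partial>lborel)"
      using r quot_nonneg[OF r]
      by (intro nn_integral_cong) (auto simp: quot_def ennreal_mult[symmetric] mult.assoc[symmetric])
    also have "\<dots> = ennreal (r ^ CARD('n)) * (\<integral>\<^sup>+s\<in>?C. ennreal (quot x (\<xi> + w s) r) \<partial>lborel)"
      by (intro nn_integral_cmult qC r)
    also have "ennreal (\<rho> ^ CARD('n) * F (\<lambda>_. \<xi>) (cube r x)) = ennreal (r ^ CARD('n)) * ennreal (\<rho> ^ CARD('n) * quot x \<xi> r)"
      using r by (subst ennreal_mult'[symmetric]) (simp_all add: quot_def)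
    finally have "ennreal (r ^ CARD('n)) * ennreal (\<rho> ^ CARD('n) * quot x \<xi> r)
      \<le> ennreal (r ^ CARD('n)) * (\<integral>\<^sup>+s\<in>?C. ennreal (quot x (\<xi> + w s) r) \<partial>lborel)"
      .
    then show ?thesis
      using r by (simp add: ennreal_mult_le_mult_iff)
  qed
  \<comment> \<open>The limsup is approached along a sequence: if all quotients on the interval
    stayed below the density by \<open>1 / Suc k\<close>, then \<open>dens_leI\<close> would give a
    contradiction.\<close>
  have "\<exists>r. 0 < r \<and> r < 1 / real (Suc k) \<and> dens x \<xi> - 1 / real (Suc k) < quot x \<xi> r" for k
  proof (rule ccontr)
    assume "\<nexists>r. 0 < r \<and> r < 1 / real (Suc k) \<and> dens x \<xi> - 1 / real (Suc k) < quot x \<xi> r"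
    then have "quot x \<xi> r \<le> dens x \<xi> - 1 / real (Suc k)" if "0 < r" "r < 1 / real (Suc k)" for r
      using that by (meson not_less)
    then have "eventually (\<lambda>r. quot x \<xi> r \<le> dens x \<xi> - 1 / real (Suc k)) (at_right 0)"
      by (intro eventually_at_rightI[of 0 "1 / real (Suc k)"]) simp_all
    then have "dens x \<xi> \<le> dens x \<xi> - 1 / real (Suc k)" by (rule dens_leI)
    then show False by simp
  qed
  then have "\<forall>k. \<exists>r. 0 < r \<and> r < 1 / real (Suc k) \<and> dens x \<xi> - 1 / real (Suc k) < quot x \<xi> r" by blast
  from choice[OF this] obtain r where r: "\<And>k. 0 < r k" "\<And>k. r k < 1 / real (Suc k)"
    "\<And>k. dens x \<xi> - 1 / real (Suc k) < quot x \<xi> (r k)" by blast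
  have inv: "(\<lambda>k. 1 / real (Suc k)) \<longlonglongrightarrow> 0"
    using LIMSEQ_inverse_real_of_nat by (simp add: inverse_eq_divide)
  have "r \<longlonglongrightarrow> 0"
    by (rule tendsto_sandwich[OF _ _ tendsto_const inv]) (use r in \<open>auto intro!: always_eventually less_imp_le\<close>)
  then have rlim: "filterlim r (at_right 0) sequentially"
    using r(1) by (auto simp: filterlim_at less_imp_neq[symmetric] intro!: always_eventually)
  define u where "u k s = ennreal (quot x (\<xi> + w s) (r k)) * indicator ?C s" for k s
  have "(\<lambda>k. ennreal (\<rho> ^ CARD('n) * (dens x \<xi> - 1 / real (Suc k)))) \<longlonglongrightarrow> ennreal (\<rho> ^ CARD('n) * (dens x \<xi> - 0))"
    by (intro tendsto_ennrealI tendsto_mult tendsto_diff tendsto_const inv)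
  then have "ennreal (\<rho> ^ CARD('n) * dens x \<xi>) = limsup (\<lambda>k. ennreal (\<rho> ^ CARD('n) * (dens x \<xi> - 1 / real (Suc k))))"
    by (intro lim_imp_Limsup[symmetric]) auto
  also have "\<dots> \<le> limsup (\<lambda>k. \<integral>\<^sup>+s. u k s \<partial>lborel)"
  proof (intro Limsup_mono always_eventually allI)
    fix k
    have "\<rho> ^ CARD('n) * (dens x \<xi> - 1 / real (Suc k)) \<le> \<rho> ^ CARD('n) * quot x \<xi> (r k)"
      using r(3)[of k] \<rho> by (intro mult_left_mono less_imp_le) auto
    then show "ennreal (\<rho> ^ CARD('n) * (dens x \<xi> - 1 / real (Suc k))) \<le> (\<integral>\<^sup>+s. u k s \<partial>lborel)"
      unfolding u_def using avg[OF r(1)] by (rule order_trans[OF ennreal_leI])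
  qed
  also have "\<dots> \<le> (\<integral>\<^sup>+s. limsup (\<lambda>k. u k s) \<partial>lborel)"
  proof (rule nn_integral_limsup)
    \<comment> \<open>The growth bound on the bounded range of \<open>\<xi> + w s\<close> is the
      integrable majorant for the reverse Fatou lemma.\<close>
    let ?b = "c0 * (1 + (norm \<xi> + B) powr p)"
    show "u k \<in> borel_measurable lborel" for k
      unfolding u_def by (intro qC r(1))
    show "(\<lambda>s. ennreal ?b * indicator ?C s) \<in> borel_measurable lborel" by measurable
    show "AE s in lborel. u k s \<le> ennreal ?b * indicator ?C s" for k
    proof (rule AE_I2)
      fix s
      have "norm (\<xi> + w s) powr p \<le> (norm \<xi> + B) powr p"
        using p norm_triangle_ineq[of \<xi> "w s"] bound[of s] by (intro powr_mono2) auto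
      then have "c0 * (1 + norm (\<xi> + w s) powr p) \<le> ?b"
        using c0 by (intro mult_left_mono add_left_mono) auto
      then have "quot x (\<xi> + w s) (r k) \<le> ?b"
        using quot_upper[OF r(1), of x "\<xi> + w s" k] by linarith
      then show "u k s \<le> ennreal ?b * indicator ?C s"
        unfolding u_def by (intro mult_right_mono ennreal_leI) auto
    qed
    show "(\<integral>\<^sup>+s. ennreal ?b * indicator ?C s \<partial>lborel) < \<infinity>"
      using \<rho> by (simp add: nn_integral_cmult_indicator emeasure_lborel_cube ennreal_mult_less_top)
  qed
  also have "\<dots> \<le> (\<integral>\<^sup>+s\<in>?C. ennreal (dens x (\<xi> + w s)) \<partial>lborel)"
  proof (rule nn_integral_mono)
    fix s
    have "limsup (\<lambda>k. ennreal (quot x (\<xi> + w s) (r k))) \<le> ennreal (dens x (\<xi> + w s))"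
    \<comment> \<open>The slack \<open>e\<close> is there because \<open>dens_lessD\<close> needs a
      number strictly above the density.\<close>
    proof (rule ennreal_le_epsilon)
      fix e :: real assume "0 < e"
      then have "dens x (\<xi> + w s) < dens x (\<xi> + w s) + e" by simp
      from dens_lessD[OF this] have "eventually (\<lambda>k. quot x (\<xi> + w s) (r k) < dens x (\<xi> + w s) + e) sequentially"
        using rlim by (rule eventually_compose_filterlim)
      then have "eventually (\<lambda>k. ennreal (quot x (\<xi> + w s) (r k)) \<le> ennreal (dens x (\<xi> + w s) + e)) sequentially"
        by (rule eventually_mono) (intro ennreal_leI less_imp_le)
      then have "limsup (\<lambda>k. ennreal (quot x (\<xi> + w s) (r k))) \<le> ennreal (dens x (\<xi> + w s) + e)"
        by (rule Limsup_bounded)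
      then show "limsup (\<lambda>k. ennreal (quot x (\<xi> + w s) (r k))) \<le> ennreal (dens x (\<xi> + w s)) + ennreal e"
        using \<open>0 < e\<close> by (simp add: ennreal_plus)
    qed
    then show "limsup (\<lambda>k. u k s) \<le> ennreal (dens x (\<xi> + w s)) * indicator ?C s"
      by (cases "s \<in> ?C") (simp_all add: u_def Limsup_const)
  qed
  finally show ?thesis .
qed

lemma A_quasiconvex_dens:
  fixes A :: "'n \<Rightarrow> real^'d^'l"
  assumes sc: "F \<in> class_I_sc A p q c0" and q: "1 < q"
  shows "A_quasiconvex A (dens x)"
  unfolding A_quasiconvex_def
proof (intro conjI allI impI)
  show "dens x \<in> borel_measurable borel"
    using continuous_dens by (rule borel_measurable_continuous_onI)
  show "bounded (dens x ` K)" if "compact K" for K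
    using that by (intro compact_imp_bounded compact_continuous_image continuous_on_subset[OF continuous_dens]) auto
  fix \<rho> :: real and z :: "real^'n" and \<xi> and w :: "real^'n \<Rightarrow> real^'d"
  assume \<rho>: "0 < \<rho>" and sm: "smooth w" and per: "\<forall>x i. w (x + axis i \<rho>) = w x"
    and free: "\<forall>\<psi>\<in>test_functions UNIV. A_distribution A w \<psi> = 0"
    and mean: "(LINT x|lebesgue_on (cube \<rho> z). w x) = 0"
  let ?C = "cube \<rho> z"
  let ?M = "lebesgue_on ?C"
  have w: "continuous_on UNIV w" using sm by (rule smooth_continuous)
  have wm [measurable]: "w \<in> borel_measurable borel" using w by (rule borel_measurable_continuous_onI)
  have per': "periodic \<rho> w" using per by (simp add: periodic_def)
  obtain B where B: "\<And>x. norm (w x) \<le> B"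
    using periodic_bounded[OF \<rho> w per'] by blast
  \<comment> \<open>Integrability of \<open>w\<close> allows the inner product with \<open>v\<close>
    to be pulled out of its vector mean. The exponent 2 stands for any exponent above 1, since
    \<open>w\<close> is bounded.\<close>
  have intw: "integrable ?M w"
    by (rule Lp_integrable[of _ _ 2]) (auto intro: Lp_bounded[OF _ wm B])
  have mean': "(LINT s|lborel. indicator ?C s * (w s \<bullet> v)) = 0" for v
  proof -
    have "(LINT s|lborel. indicator ?C s * (w s \<bullet> v)) = (LINT s|?M. w s \<bullet> v)"
      by (intro integral_lebesgue_on_borel[symmetric]) auto
    also have "\<dots> = (LINT s|?M. w s) \<bullet> v"
      using intw by (intro integral_inner_left) auto
    finally show ?thesis by (simp add: mean)
  qed
  let ?g = "\<lambda>s. dens x (\<xi> + w s)"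
  have gm [measurable]: "?g \<in> borel_measurable borel"
    by (intro borel_measurable_continuous_onI continuous_on_compose2[OF continuous_dens] continuous_intros w) auto
  have intg: "integrable ?M ?g"
  proof -
    have "(\<lambda>s. \<xi> + w s) \<in> Lp p ?C"
    proof (rule Lp_bounded[of _ _ "norm \<xi> + B"])
      show "norm (\<xi> + w s) \<le> norm \<xi> + B" for s
        using norm_triangle_ineq[of \<xi> "w s"] B[of s] by linarith
    qed (use p in auto)
    then have int: "integrable ?M (\<lambda>s. norm (\<xi> + w s) powr p)" by (simp add: Lp_def)
    interpret finite_measure ?M by (intro finite_measure_lebesgue_on bounded_opensD) simp
    show ?thesis
    proof (rule Bochner_Integration.integrable_bound)
      show "integrable ?M (\<lambda>s. c0 * (1 + norm (\<xi> + w s) powr p))"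
        by (intro integrable_mult_right Bochner_Integration.integrable_add int) simp
      show "AE s in ?M. norm (?g s) \<le> norm (c0 * (1 + norm (\<xi> + w s) powr p))"
        using dens_upper by (auto intro: order_trans[OF _ abs_ge_self])
    qed (rule borel_measurable_lebesgue_on[OF gm])
  qed
  have "ennreal (\<rho> ^ CARD('n) * dens x \<xi>) \<le> (\<integral>\<^sup>+s\<in>?C. ennreal (?g s) \<partial>lborel)"
    by (rule dens_le_average[OF sc q \<rho> w per' B mean' free])
  also have "\<dots> = (\<integral>\<^sup>+s. ennreal (?g s) \<partial>?M)"
    by (intro nn_integral_lebesgue_on_borel[symmetric]) auto
  also have "\<dots> = ennreal (LINT s|?M. ?g s)"
    using intg by (intro nn_integral_eq_integral) auto
  finally have "\<rho> ^ CARD('n) * dens x \<xi> \<le> (LINT s|?M. ?g s)"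
    by (subst (asm) ennreal_le_iff) (auto intro: Bochner_Integration.integral_nonneg)
  then show "dens x \<xi> \<le> (LINT s|?M. ?g s) / measure lebesgue ?C"
    using \<rho> unfolding measure_lebesgue_cube[OF less_imp_le[OF \<rho>]]
    by (simp add: pos_le_divide_eq mult.commute)
qed

lemma dens_class_F_Lip: "dens \<in> class_F_Lip p c0 c1"
proof -
  have "(\<lambda>x. dens x \<xi>) \<in> borel_measurable lebesgue" for \<xi>
    by (intro measurable_completion) simp
  then show ?thesis
    by (simp add: class_F_Lip_def class_F_def Caratheodory_def continuous_dens p_growth_def
        dens_lower dens_upper p_Lipschitz_dens)
qed

end

theorem theorem3p3:
  fixes A :: "'n::finite \<Rightarrow> real^'d::finite^'l::finite"
    and p q c0 c1 c1hat :: real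
    and F :: "(real^'n \<Rightarrow> real^'d) \<Rightarrow> (real^'n) set \<Rightarrow> real"
    and f :: "real^'n \<Rightarrow> real^'d \<Rightarrow> real"
  assumes "1 < p" and "1 < q" and "1 / p + 1 / q = 1"
    and "constant_rank A"
    and "1 \<le> c0" and "1 \<le> c1hat" and "c1hat \<le> c1"
    and "qc_Lipschitz_constant A p c0 c1hat"
    and "F \<in> class_I_Lip p c0 c1"
    and f_def: "\<And>x \<xi>. f x \<xi> = real_of_ereal (upper_cube_density F x \<xi>)"
  shows "(\<forall>x \<xi>. \<bar>upper_cube_density F x \<xi>\<bar> \<noteq> \<infinity>) \<and>
    f \<in> class_F_Lip p c0 c1 \<and>
    (\<forall>D\<in>bounded_opens. \<forall>u\<in>Lp p D.
       has_bochner_integral (lebesgue_on D) (\<lambda>x. f x (u x)) (F u D)) \<and>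
    (F \<in> class_I_sc A p q c0 \<longrightarrow>
       (\<forall>x. A_quasiconvex A (f x)) \<and> f \<in> class_F_Lip p c0 c1 \<inter> class_F_qc A p c0)"
proof -
  interpret Lip_functional p c0 c1 F
    using assms by unfold_locales auto
  have f: "f = dens"
    by (intro ext) (simp add: f_def dens_def)
  show ?thesis
    using upper_cube_density_finite dens_class_F_Lip F_integral A_quasiconvex_dens[OF _ assms(2)]
    unfolding f by (auto simp: class_F_qc_def class_F_Lip_def)
qed

end
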